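(* Let $m$ be an odd positive integer with $m\equiv 0 \pmod 3$, let $n$ be a positive integer, and let $k$ be an integer with $k\equiv \pm 1\pmod{18}$ and $\gcd(m,k)=1$. Let $d_1$ be the square-free part of $3(4m^{3n}-k^2)$. Then $3$ divides $h(d_1)$, the class number of $\mathbb{Q}(\sqrt{d_1})$.
   Context: For a non-square integer $d$, $h(d)$ denotes the class number of the quadratic field $\mathbb{Q}(\sqrt{d})$. The square-free part of a nonzero integer $N$ is the unique square-free integer $d$ (of the same sign as $N$) such that $N=t^2d$ for some integer $t$. *)

theory Defs
  imports
    Complex_Main
    "HOL-Algebra.Ideal"
    "HOL-Computational_Algebra.Polynomial"
    "HOL-Computational_Algebra.Squarefree"
    "HOL-Number_Theory.Cong"
begin

text \<open>The field \<open>\<rat>(\<surd>d)\<close> as a subfield of the complex numbers. For \<open>d < 0\<close> the principal root is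
  \<open>csqrt d = \<i> * sqrt (-d)\<close>; the set does not depend on which of the two roots is taken.\<close>

definition quadratic_field :: "int \<Rightarrow> complex set" where
  "quadratic_field d = {of_rat a + of_rat b * csqrt (of_int d) | a b. True}"

definition quadratic_integers :: "int \<Rightarrow> complex ring" where
  "quadratic_integers d =
     \<lparr>carrier = {z \<in> quadratic_field d. algebraic_int z},
      monoid.mult = (*), one = 1, ring.zero = 0, add = (+)\<rparr>"

definition nonzero_ideals :: "('a, 'b) ring_scheme \<Rightarrow> 'a set set" where
  "nonzero_ideals R = {I. ideal I R \<and> I \<noteq> {\<zero>\<^bsub>R\<^esub>}}"

text \<open>Nonzero ideals \<open>I\<close>, \<open>J\<close> lie in the same class iff \<open>a I = b J\<close> for some nonzero \<open>a\<close>, \<open>b\<close>, i.e.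
  iff they differ by a principal fractional ideal. Since every fractional ideal is a nonzero scalar
  multiple of an integral one, the classes are exactly the elements of the ideal class group.\<close>

definition ideal_class_rel :: "('a, 'b) ring_scheme \<Rightarrow> ('a set \<times> 'a set) set" where
  "ideal_class_rel R =
     {(I, J). I \<in> nonzero_ideals R \<and> J \<in> nonzero_ideals R \<and>
        (\<exists>a \<in> carrier R - {\<zero>\<^bsub>R\<^esub>}. \<exists>b \<in> carrier R - {\<zero>\<^bsub>R\<^esub>}.
           a <#\<^bsub>R\<^esub> I = b <#\<^bsub>R\<^esub> J)}"

definition ideal_classes :: "('a, 'b) ring_scheme \<Rightarrow> 'a set set set" where
  "ideal_classes R = nonzero_ideals R // ideal_class_rel R"

text \<open>The set of ideal classes of the ring of integers of a number field is finite, so the convention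
  that \<open>card\<close> is \<open>0\<close> on infinite sets plays no role here.\<close>

definition class_number :: "int \<Rightarrow> nat" where
  "class_number d = card (ideal_classes (quadratic_integers d))"

end

theory Submission
  imports Defs "HOL-Number_Theory.Number_Theory"
begin

text \<open>
  Put \<open>M = m ^ n\<close> and write \<open>d\<^sub>1 = -3 D\<close> with \<open>D t\<^sup>2 = k\<^sup>2 - 4 M ^ 3\<close>. Then \<open>d\<^sub>1 \<equiv> 1 (mod 8)\<close>, so \<open>2\<close>
  splits in \<open>\<rat>(\<surd>d\<^sub>1)\<close>; let \<open>P\<close> be a prime above \<open>2\<close>. Multiplication by \<open>P\<close> permutes the ideal
  classes, and it is enough to show that all its cycle lengths are divisible by \<open>3\<close>. If \<open>P ^ j\<close> moves
  an ideal within its class, it is principal, and the norm of a generator gives odd \<open>x\<close>, \<open>y\<close> with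
  \<open>x\<^sup>2 + 3 D y\<^sup>2 = \<plusminus>2 ^ (j + 2)\<close>.

  Modulo the Eisenstein integer \<open>\<gamma> = (k y \<surd>-3 - t x) / 2\<close>, cleared of common factors, this equation
  reads \<open>2 ^ j k\<^sup>2 \<equiv> \<plusminus>M ^ 3 x\<^sup>2\<close>, an equality of cubic residue symbols of rational integers modulo \<open>\<gamma>\<close>.
  By cubic reciprocity the symbol of \<open>r\<close> modulo \<open>\<gamma>\<close> depends only on \<open>\<gamma>\<close> modulo \<open>r\<close>. Now \<open>\<gamma>\<close> is
  congruent to a rational integer, or to one times \<open>\<surd>-3\<close>, modulo the primes dividing \<open>k\<close> or \<open>x\<close>, so
  their symbols are trivial up to a twist making \<open>\<gamma>\<close> primary, which the congruence \<open>k\<^sup>2 \<equiv> 1 (mod 9)\<close>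
  controls. As \<open>\<gamma>\<close> is \<open>\<omega>\<close> or \<open>\<omega>\<^sup>2\<close> modulo \<open>2\<close>, the symbol of \<open>2\<close> is nontrivial, and \<open>3\<close> divides \<open>j\<close>.
\<close>

section \<open>Eisenstein integers\<close>

text \<open>Why the prime 2: the cubic X^3 - 3 M X - k has discriminant 27 (4 M^3 - k^2), which is
  \<open>d\<^sub>1\<close> times a square, and modulo 2 it is the irreducible X^3 + X + 1. Its
  splitting field is an unramified cubic extension of the quadratic field in which P stays inert, so
  by class field theory the class of P has order divisible by 3. The proof keeps this P but replaces
  the Artin symbol by cubic residue symbols; M^3 is the norm of (k + t sqrt(D)) / 2, the Kummer
  generator of that extension. The obstacle is cubic reciprocity, usually proved with Gauss sums in
  a cyclotomic ring and prime factorization in Z[omega]. Here Gauss sums become elements of the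
  group ring of Z/p over Z[omega], where a congruence modulo q is read off coefficientwise. Only
  rational integers occur below the symbol's bar, and gamma is taken apart one factor at a time by
  induction on its norm. The second obstacle is the prime 3: gamma need not be primary, and the
  twist that repairs this adds symbols of omega which have to cancel.\<close>

datatype eis = Eis (re: int) (om: int)

lemma eis_eq_iff: "z = w \<longleftrightarrow> re z = re w \<and> om z = om w"
  by (cases z; cases w) auto

text \<open>\<open>Eis a b\<close> stands for a + b omega with omega^2 = -1 - omega. With a type of
  its own, \<open>dvd\<close> is divisibility in Z[omega], and congruences there are plain
  \<open>dvd\<close> statements.\<close>

instantiation eis :: comm_ring_1
begin
definition zero_eis :: eis where "0 = Eis 0 0"
definition one_eis :: eis where "1 = Eis 1 0"
definition plus_eis :: "eis \<Rightarrow> eis \<Rightarrow> eis" where "z + w = Eis (re z + re w) (om z + om w)"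
definition minus_eis :: "eis \<Rightarrow> eis \<Rightarrow> eis" where "z - w = Eis (re z - re w) (om z - om w)"
definition uminus_eis :: "eis \<Rightarrow> eis" where "- z = Eis (- re z) (- om z)"
definition times_eis :: "eis \<Rightarrow> eis \<Rightarrow> eis" where
  "z * w = Eis (re z * re w - om z * om w) (re z * om w + om z * re w - om z * om w)"
instance
  by standard (auto simp: eis_eq_iff zero_eis_def one_eis_def plus_eis_def minus_eis_def
    uminus_eis_def times_eis_def algebra_simps)
end

lemma eis_simps [simp]:
  "re 0 = 0" "om 0 = 0" "re 1 = 1" "om 1 = 0"
  "re (z + w) = re z + re w" "om (z + w) = om z + om w"
  "re (z - w) = re z - re w" "om (z - w) = om z - om w"
  "re (- z) = - re z" "om (- z) = - om z"
  "re (z * w) = re z * re w - om z * om w"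
  "om (z * w) = re z * om w + om z * re w - om z * om w"
  by (simp_all add: zero_eis_def one_eis_def plus_eis_def minus_eis_def uminus_eis_def times_eis_def)

lemma of_nat_eis: "of_nat n = Eis (int n) 0"
  by (induction n) (auto simp: eis_eq_iff)

lemma of_int_eis: "of_int n = Eis n 0"
  by (cases n rule: int_diff_cases) (auto simp: eis_eq_iff of_nat_eis)

lemma eis_of_simps [simp]: "re (of_nat n) = int n" "om (of_nat n) = 0"
  "re (of_int i) = i" "om (of_int i) = 0" "re (numeral v) = numeral v" "om (numeral v) = 0"
proof -
  show "re (numeral v) = numeral v" "om (numeral v) = 0"
    by (metis eis.sel of_nat_eis of_nat_numeral)+
qed (simp_all add: of_nat_eis of_int_eis)

definition enorm :: "eis \<Rightarrow> int" where "enorm z = (re z)\<^sup>2 - re z * om z + (om z)\<^sup>2"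

definition ecnj :: "eis \<Rightarrow> eis" where "ecnj z = Eis (re z - om z) (- om z)"

lemma ecnj_simps [simp]: "re (ecnj z) = re z - om z" "om (ecnj z) = - om z"
  by (simp_all add: ecnj_def)

lemma ecnj_hom [simp]: "ecnj (z * w) = ecnj z * ecnj w" "ecnj (z + w) = ecnj z + ecnj w"
  "ecnj (z - w) = ecnj z - ecnj w" "ecnj (- z) = - ecnj z" "ecnj 1 = 1" "ecnj 0 = 0"
  "ecnj (of_nat n) = of_nat n" "ecnj (of_int i) = of_int i" "ecnj (ecnj z) = z"
  by (auto simp: eis_eq_iff algebra_simps)

lemma ecnj_power [simp]: "ecnj (z ^ n) = ecnj z ^ n"
  by (induction n) auto

lemma ecnj_sum [simp]: "ecnj (sum f A) = (\<Sum>x\<in>A. ecnj (f x))"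
  by (induction A rule: infinite_finite_induct) auto

lemma mult_ecnj: "z * ecnj z = of_int (enorm z)"
  by (auto simp: eis_eq_iff enorm_def algebra_simps power2_eq_square)

lemma enorm_mult [simp]: "enorm (z * w) = enorm z * enorm w"
  by (simp add: enorm_def algebra_simps power2_eq_square)

lemma enorm_ecnj [simp]: "enorm (ecnj z) = enorm z"
  by (simp add: enorm_def algebra_simps power2_eq_square)

lemma enorm_of [simp]: "enorm (of_int i) = i\<^sup>2" "enorm (of_nat n) = (int n)\<^sup>2"
  "enorm 0 = 0" "enorm 1 = 1"
  by (simp_all add: enorm_def)

lemma four_enorm: "4 * enorm z = (2 * re z - om z)\<^sup>2 + 3 * (om z)\<^sup>2"
  by (simp add: enorm_def algebra_simps power2_eq_square)

lemma enorm_nonneg [simp]: "enorm z \<ge> 0"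
  using four_enorm[of z] by (smt (verit) zero_le_power2)

lemma enorm_eq_0_iff [simp]: "enorm z = 0 \<longleftrightarrow> z = 0"
proof
  assume "enorm z = 0"
  then have "(2 * re z - om z)\<^sup>2 + 3 * (om z)\<^sup>2 = 0" using four_enorm[of z] by simp
  then have "(om z)\<^sup>2 = 0" "(2 * re z - om z)\<^sup>2 = 0"
    by (smt (verit) zero_le_power2)+
  then show "z = 0" by (auto simp: eis_eq_iff)
qed auto

instance eis :: idom
proof
  fix a b :: eis
  assume "a \<noteq> 0" "b \<noteq> 0"
  then have "enorm (a * b) \<noteq> 0" by simp
  then show "a * b \<noteq> 0" using enorm_eq_0_iff by blast
qed

text \<open>Since 1 and omega form a Z-basis, congruences modulo rational integers can be tested on
  coordinates.\<close>

lemma of_int_dvd_eis: "of_int i dvd z \<longleftrightarrow> i dvd re z \<and> i dvd om z"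
proof
  assume "i dvd re z \<and> i dvd om z"
  then obtain a b where "re z = i * a" "om z = i * b" by (auto elim!: dvdE)
  then have "z = of_int i * Eis a b" by (auto simp: eis_eq_iff)
  then show "of_int i dvd z" by simp
qed (auto elim!: dvdE)

lemma of_nat_dvd_eis: "of_nat i dvd z \<longleftrightarrow> int i dvd re z \<and> int i dvd om z"
  using of_int_dvd_eis[of "int i" z] by simp

lemma ecnj_dvd: "ecnj z dvd ecnj w \<longleftrightarrow> z dvd w"
  by (metis ecnj_hom(1) ecnj_hom(9) dvd_def)

definition \<omega> :: eis where "\<omega> = Eis 0 1"

lemma omega_simps [simp]: "re \<omega> = 0" "om \<omega> = 1" "enorm \<omega> = 1"
  by (simp_all add: \<omega>_def enorm_def)

lemma omega_2: "\<omega>\<^sup>2 = Eis (-1) (-1)" and omega_3 [simp]: "\<omega> ^ 3 = 1"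
  by (simp_all add: eis_eq_iff eval_nat_numeral)

lemma ecnj_omega: "ecnj \<omega> = \<omega>\<^sup>2"
  by (simp add: eis_eq_iff omega_2)

lemma omega_power_mod: "\<omega> ^ n = \<omega> ^ (n mod 3)"
proof -
  have "\<omega> ^ n = \<omega> ^ (3 * (n div 3) + n mod 3)" by simp
  then show ?thesis by (simp only: power_add power_mult omega_3 power_one mult_1_left)
qed

lemma omega_power_cong: "[i = j] (mod 3) \<Longrightarrow> \<omega> ^ i = \<omega> ^ j"
  by (metis cong_def omega_power_mod)

lemma omega_power_cases: "\<omega> ^ n = 1 \<or> \<omega> ^ n = \<omega> \<or> \<omega> ^ n = \<omega>\<^sup>2"
proof -
  have "n mod 3 = 0 \<or> n mod 3 = 1 \<or> n mod 3 = 2" by linarith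
  then show ?thesis using omega_power_mod[of n] by (auto)
qed

text \<open>Two distinct cube roots of unity differ by an element of norm 3, so they stay distinct
  modulo every other prime. Hence a congruence modulo q determines the value of a symbol.\<close>

lemma omega_power_cong_mod:
  assumes "prime q" "q \<noteq> 3" "of_nat q dvd \<omega> ^ i - \<omega> ^ j"
  shows "[i = j] (mod 3)"
proof -
  have q: "\<not> int q dvd 1" "\<not> int q dvd -1" using assms(1) not_prime_unit by force+
  have "i mod 3 = 0 \<or> i mod 3 = 1 \<or> i mod 3 = 2" "j mod 3 = 0 \<or> j mod 3 = 1 \<or> j mod 3 = 2"
    by linarith+
  moreover have "of_nat q dvd \<omega> ^ (i mod 3) - \<omega> ^ (j mod 3)"
    using assms(3) omega_power_mod by metis
  ultimately show ?thesis using q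
    by (auto simp: cong_def of_nat_dvd_eis omega_2)
qed

hide_const (open) up_ring.monom up_ring.coeff

section \<open>Group rings of cyclic groups\<close>

lemma dvd_diff_swap: "a dvd x - y \<longleftrightarrow> a dvd y - (x :: 'a::comm_ring_1)"
  by (metis dvd_minus_iff minus_diff_eq)

lemma freshman_dvd:
  fixes x y :: "'a::comm_ring_1"
  assumes "prime q"
  shows "of_nat q dvd (x + y) ^ q - (x ^ q + y ^ q)"
proof -
  have q: "q > 0" using assms by (simp add: prime_gt_0_nat)
  have "(x + y) ^ q = (\<Sum>k\<le>q. of_nat (q choose k) * x ^ k * y ^ (q - k))"
    by (rule binomial_ring)
  also have "{..q} = insert 0 (insert q {0<..<q})" by auto
  also have "(\<Sum>k\<in>\<dots>. of_nat (q choose k) * x ^ k * y ^ (q - k)) =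
      y ^ q + (x ^ q + (\<Sum>k\<in>{0<..<q}. of_nat (q choose k) * x ^ k * y ^ (q - k)))"
    using q by (subst sum.insert; simp)+
  finally have "(x + y) ^ q - (x ^ q + y ^ q) =
      (\<Sum>k\<in>{0<..<q}. of_nat (q choose k) * x ^ k * y ^ (q - k))"
    by (simp add: algebra_simps)
  moreover have "of_nat q dvd (of_nat (q choose k) :: 'a)" if "k \<in> {0<..<q}" for k
  proof -
    have "q dvd q choose k" using that assms by (intro dvd_choose_prime) auto
    then show ?thesis by (metis dvd_def of_nat_mult)
  qed
  ultimately show ?thesis
    by (auto intro!: dvd_sum dvd_mult2)
qed

lemma freshman_dvd_sum:
  fixes f :: "'b \<Rightarrow> 'a::comm_ring_1"
  assumes "prime q"
  shows "of_nat q dvd (\<Sum>x\<in>A. f x) ^ q - (\<Sum>x\<in>A. f x ^ q)"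
proof (induction A rule: infinite_finite_induct)
  case (insert x A)
  have "of_nat q dvd ((f x + (\<Sum>x\<in>A. f x)) ^ q - (f x ^ q + (\<Sum>x\<in>A. f x) ^ q))
     + ((\<Sum>x\<in>A. f x) ^ q - (\<Sum>x\<in>A. f x ^ q))"
    by (intro dvd_add freshman_dvd insert assms)
  then show ?case using insert.hyps by (simp add: algebra_simps)
qed (use assms in \<open>auto simp: zero_power prime_gt_0_nat\<close>)

text \<open>For a function \<open>f\<close> on \<open>\<int>/p\<close>, \<open>gen p f\<close> represents \<open>\<Sum>x. f x [x]\<close> in the group ring
  \<open>R[X]/(X^p - 1)\<close> of \<open>\<int>/p\<close>.\<close>

definition gen :: "nat \<Rightarrow> (int \<Rightarrow> 'a::comm_ring_1) \<Rightarrow> 'a poly" where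
  "gen p f = (\<Sum>x\<in>{0..<int p}. monom (f x) (nat x))"

definition cyc :: "nat \<Rightarrow> 'a::comm_ring_1 poly" where "cyc p = monom 1 p - 1"

definition gcong :: "nat \<Rightarrow> 'a::comm_ring_1 poly \<Rightarrow> 'a poly \<Rightarrow> bool" where
  "gcong p F G \<longleftrightarrow> cyc p dvd F - G"

lemma gcong_refl [simp]: "gcong p F F"
  and gcong_sym: "gcong p F G \<Longrightarrow> gcong p G F"
  and gcong_trans [trans]: "gcong p F G \<Longrightarrow> gcong p G H \<Longrightarrow> gcong p F H"
  and gcong_add: "gcong p F G \<Longrightarrow> gcong p F' G' \<Longrightarrow> gcong p (F + F') (G + G')"
  and gcong_diff: "gcong p F G \<Longrightarrow> gcong p F' G' \<Longrightarrow> gcong p (F - F') (G - G')"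
  and gcong_mult: "gcong p F G \<Longrightarrow> gcong p F' G' \<Longrightarrow> gcong p (F * F') (G * G')"
proof -
  show "gcong p F G \<Longrightarrow> gcong p G F" by (simp add: gcong_def dvd_diff_swap)
  show "gcong p F G \<Longrightarrow> gcong p G H \<Longrightarrow> gcong p F H"
    unfolding gcong_def using dvd_add[of "cyc p" "F - G" "G - H"] by simp
  show "gcong p F G \<Longrightarrow> gcong p F' G' \<Longrightarrow> gcong p (F + F') (G + G')"
    unfolding gcong_def using dvd_add[of "cyc p" "F - G" "F' - G'"] by (simp add: algebra_simps)
  show "gcong p F G \<Longrightarrow> gcong p F' G' \<Longrightarrow> gcong p (F - F') (G - G')"
    unfolding gcong_def using dvd_diff[of "cyc p" "F - G" "F' - G'"] by (simp add: algebra_simps)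
  assume *: "gcong p F G" "gcong p F' G'"
  have "F * F' - G * G' = (F - G) * F' + G * (F' - G')" by (simp add: algebra_simps)
  with * show "gcong p (F * F') (G * G')" unfolding gcong_def by (metis dvd_add dvd_mult dvd_mult2)
qed (simp add: gcong_def)

lemma gcong_sum: "(\<And>x. x \<in> A \<Longrightarrow> gcong p (f x) (g x)) \<Longrightarrow> gcong p (sum f A) (sum g A)"
  by (induction A rule: infinite_finite_induct) (auto intro: gcong_add)

lemma gcong_monom:
  assumes "[i = j] (mod p)"
  shows "gcong p (monom c i) (monom (c::'a::comm_ring_1) j)"
proof -
  have *: "gcong p (monom c (p * k + r)) (monom c r)" for k r
  proof -
    have "cyc p dvd monom 1 (p * k) - (1 :: 'a poly)"
    proof (induction k)
      case (Suc k)
      have "monom 1 (p * Suc k) - (1 :: 'a poly) = monom 1 p * (monom 1 (p * k) - 1) + cyc p"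
        by (simp add: cyc_def algebra_simps mult_monom)
      then show ?case using Suc by (metis dvd_add dvd_mult dvd_refl)
    qed auto
    moreover have "monom c (p * k + r) - monom c r = monom c r * (monom 1 (p * k) - 1)"
      by (simp add: algebra_simps mult_monom)
    ultimately show ?thesis unfolding gcong_def by (metis dvd_mult)
  qed
  have "gcong p (monom c i) (monom c (i mod p))" using *[of "i div p" "i mod p"] by simp
  also have "gcong p (monom c (i mod p)) (monom c j)"
    using *[of "j div p" "j mod p"] assms by (simp add: cong_def gcong_sym)
  finally show ?thesis .
qed

lemma sum_reindex_affine:
  fixes f :: "int \<Rightarrow> 'a::comm_monoid_add"
  assumes "p > 0" "coprime a (int p)"
  shows "(\<Sum>x\<in>{0..<int p}. f ((a * x + b) mod int p)) = (\<Sum>x\<in>{0..<int p}. f x)"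
proof -
  let ?S = "{0..<int p}" and ?h = "\<lambda>x. (a * x + b) mod int p"
  have inj: "inj_on ?h ?S"
  proof (rule inj_onI)
    fix x y assume *: "x \<in> ?S" "y \<in> ?S" "?h x = ?h y"
    then have "[a * x + b = a * y + b] (mod int p)" by (simp add: cong_def)
    then have "[a * x = a * y] (mod int p)" by (simp add: cong_add_rcancel)
    then have "[x = y] (mod int p)" using assms(2) by (simp add: cong_mult_lcancel)
    with * show "x = y" by (simp add: cong_def)
  qed
  have "?h ` ?S = ?S"
    using inj assms(1) by (intro card_subset_eq) (auto simp: card_image)
  with inj show ?thesis using sum.reindex[of ?h ?S f] by simp
qed

lemma gen_add: "gen p f + gen p g = gen p (\<lambda>x. f x + g x)"
  and gen_diff: "gen p f - gen p g = gen p (\<lambda>x. f x - g x)"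
  and gen_smult: "[:c:] * gen p f = gen p (\<lambda>x. c * f x)"
  by (simp_all add: gen_def sum.distrib sum_subtractf sum_distrib_left smult_monom
      flip: add_monom diff_monom)

lemma gen_cong: "(\<And>x. 0 \<le> x \<Longrightarrow> x < int p \<Longrightarrow> f x = g x) \<Longrightarrow> gen p f = gen p g"
  by (auto simp: gen_def intro!: sum.cong)

lemma gen_mult:
  assumes "p > 0" and g: "\<And>x. g (x mod int p) = g x"
  shows "gcong p (gen p f * gen p g) (gen p (\<lambda>a. \<Sum>x\<in>{0..<int p}. f x * g (a - x)))"
proof -
  let ?S = "{0..<int p}"
  have "gen p f * gen p g = (\<Sum>x\<in>?S. \<Sum>y\<in>?S. monom (f x * g y) (nat x + nat y))"
    by (simp add: gen_def sum_product mult_monom)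
  also have "gcong p \<dots> (\<Sum>x\<in>?S. \<Sum>y\<in>?S. monom (f x * g y) (nat ((1 * y + x) mod int p)))"
    by (intro gcong_sum gcong_monom)
      (auto simp: nat_mod_distrib nat_add_distrib cong_def add.commute simp flip: nat_add_distrib)
  also have "(\<Sum>x\<in>?S. \<Sum>y\<in>?S. monom (f x * g y) (nat ((1 * y + x) mod int p))) =
     (\<Sum>x\<in>?S. \<Sum>y\<in>?S. (\<lambda>a. monom (f x * g (a - x)) (nat a)) ((1 * y + x) mod int p))"
  proof (intro sum.cong refl)
    fix x y
    have "g ((1 * y + x) mod int p - x) = g (((1 * y + x) mod int p - x) mod int p)" using g by simp
    also have "\<dots> = g y" using g by (simp add: mod_diff_left_eq)
    finally show "monom (f x * g y) (nat ((1 * y + x) mod int p)) =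
      (\<lambda>a. monom (f x * g (a - x)) (nat a)) ((1 * y + x) mod int p)" by simp
  qed
  also have "\<dots> = (\<Sum>x\<in>?S. \<Sum>a\<in>?S. monom (f x * g (a - x)) (nat a))"
    using assms(1) by (intro sum.cong refl sum_reindex_affine) auto
  also have "\<dots> = gen p (\<lambda>a. \<Sum>x\<in>?S. f x * g (a - x))"
    unfolding gen_def by (subst sum.swap) (simp add: monom_sum)
  finally show ?thesis .
qed

text \<open>Exponents may be reduced modulo p. This normal form is needed for the cofactor Q in
  \<open>gen_cong_mod\<close>.\<close>

lemma gcong_gen_exists:
  fixes Q :: "'a::comm_ring_1 poly"
  assumes p: "p > 0"
  shows "\<exists>h. gcong p Q (gen p h)"
proof -
  have *: "gcong p (monom c i) (gen p (\<lambda>x. if nat x = i mod p then c else 0))" for c :: 'a and i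
  proof -
    have "gcong p (monom c i) (monom c (i mod p))" by (rule gcong_monom) (simp add: cong_def)
    also have "monom c (i mod p) = gen p (\<lambda>x. if nat x = i mod p then c else 0)"
    proof -
      have "gen p (\<lambda>x. if nat x = i mod p then c else 0) =
        (\<Sum>x\<in>{int (i mod p)}. monom (if nat x = i mod p then c else 0) (nat x))"
        unfolding gen_def using p by (intro sum.mono_neutral_right) (auto simp flip: of_nat_mod)
      then show ?thesis by simp
    qed
    finally show ?thesis .
  qed
  have "\<exists>h. gcong p (\<Sum>i\<in>A. monom (coeff Q i) i) (gen p h)" if "finite A" for A
    using that
  proof (induction A)
    case empty
    show ?case by (rule exI[of _ "\<lambda>_. 0"]) (simp add: gen_def)
  next
    case (insert i A)
    then obtain h where h: "gcong p (\<Sum>i\<in>A. monom (coeff Q i) i) (gen p h)" by blast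
    show ?case using gcong_add[OF *[of "coeff Q i" i] h] insert.hyps unfolding gen_add by auto
  qed
  from this[of "{..degree Q}"] show ?thesis by (simp add: poly_as_sum_of_monoms)
qed

lemma coeff_gen: "0 \<le> x \<Longrightarrow> x < int p \<Longrightarrow> coeff (gen p f) (nat x) = f x"
proof -
  assume x: "0 \<le> x" "x < int p"
  have "coeff (gen p f) (nat x) = (\<Sum>y\<in>{0..<int p}. if y = x then f y else 0)"
    unfolding gen_def coeff_sum using x by (intro sum.cong) (auto simp: eq_nat_nat_iff)
  then show ?thesis using x by simp
qed

text \<open>\<open>gen p h\<close> has degree below p, the degree of X^p - 1, so it can only be a
  multiple of it by vanishing.\<close>

lemma gen_eq_0:
  fixes h :: "int \<Rightarrow> 'a::idom"
  assumes "p > 0" "gcong p (gen p h) 0" "0 \<le> x" "x < int p"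
  shows "h x = 0"
proof (rule ccontr)
  assume "h x \<noteq> 0"
  then have nz: "gen p h \<noteq> 0" using coeff_gen[OF assms(3,4), of h] by auto
  have "degree (gen p h) \<le> p - 1"
    unfolding gen_def
    by (intro degree_sum_le) (auto intro!: order_trans[OF degree_monom_le])
  moreover have "degree (cyc p :: 'a poly) \<ge> p"
    using assms(1) by (intro le_degree) (simp add: cyc_def)
  moreover have "degree (cyc p :: 'a poly) \<le> degree (gen p h)"
    using assms(2) nz by (intro dvd_imp_degree_le) (auto simp: gcong_def)
  ultimately show False using assms(1) by linarith
qed

text \<open>A congruence modulo q between group ring elements descends to each coefficient, that is,
  to Z[omega]. The arguments with Gauss sums below all end with this comparison, at the coefficient
  of [1].\<close>

lemma gen_cong_mod:
  fixes f g :: "int \<Rightarrow> 'a::idom"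
  assumes p: "p > 0" and "gcong p (gen p f) F" "gcong p (gen p g) G" "of_nat q dvd F - G"
    and x: "0 \<le> x" "x < int p"
  shows "of_nat q dvd f x - g x"
proof -
  from assms obtain Q where Q: "F - G = of_nat q * Q" by blast
  obtain h where h: "gcong p Q (gen p h)" using gcong_gen_exists[OF p] by blast
  have "gcong p (gen p f - gen p g) (F - G)" using assms by (intro gcong_diff)
  also have "gcong p (F - G) (of_nat q * gen p h)" unfolding Q using h by (intro gcong_mult) auto
  also have "of_nat q * gen p h = gen p (\<lambda>x. of_nat q * h x)"
    using gen_smult[of "of_nat q" p h] by (simp add: of_nat_poly)
  finally have "gcong p (gen p f - gen p g - gen p (\<lambda>x. of_nat q * h x)) 0"
    by (simp add: gcong_def)
  then have "gcong p (gen p (\<lambda>x. f x - g x - of_nat q * h x)) 0" by (simp only: gen_diff)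
  from gen_eq_0[OF p this x] have "f x - g x - of_nat q * h x = 0" .
  then show ?thesis by simp
qed

text \<open>Modulo q, the q-th power of the sum of f x [x] is the sum of f x ^ q [q x]; substituting
  q' x for x gives the stated coefficients. \<open>F\<close> is named because one congruence is
  modulo X^p - 1 and the other modulo q.\<close>

lemma gen_frobenius:
  fixes f :: "int \<Rightarrow> 'a::comm_ring_1"
  assumes "p > 0" "prime q" "[int q * q' = 1] (mod int p)" and f: "\<And>x. f (x mod int p) = f x"
  obtains F where "gcong p (gen p (\<lambda>x. f (q' * x) ^ q)) F" "of_nat q dvd gen p f ^ q - F"
proof
  let ?S = "{0..<int p}"
  define F where "F = (\<Sum>x\<in>?S. monom (f x ^ q) (nat x * q))"
  have pw: "monom c n ^ k = monom (c ^ k) (n * k)" for c :: 'a and n k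
    by (induction k) (auto simp: mult_monom monom_0)
  show "of_nat q dvd gen p f ^ q - F"
    using freshman_dvd_sum[OF assms(2), of "\<lambda>x. monom (f x) (nat x)" ?S]
    by (simp add: gen_def F_def pw)
  have cop: "coprime q' (int p)"
    unfolding coprime_iff_invertible_int using assms(3) by (auto simp: mult.commute)
  have "gen p (\<lambda>x. f (q' * x) ^ q) =
      (\<Sum>x\<in>?S. monom (f (q' * x) ^ q) (nat x))" by (simp add: gen_def)
  also have "gcong p \<dots> (\<Sum>x\<in>?S. (\<lambda>y. monom (f y ^ q) (nat y * q)) ((q' * x + 0) mod int p))"
  proof (intro gcong_sum)
    fix x assume x: "x \<in> ?S"
    have "[int (nat x) = int (nat ((q' * x + 0) mod int p) * q)] (mod int p)"
    proof -
      have "int (nat ((q' * x + 0) mod int p) * q) = (q' * x) mod int p * int q"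
        using assms(1) by simp
      also have "[\<dots> = q' * x * int q] (mod int p)" by (simp add: cong_def mod_mult_left_eq)
      also have "q' * x * int q = int q * q' * x" by simp
      also have "[\<dots> = 1 * x] (mod int p)" using assms(3) by (rule cong_scalar_right)
      finally show ?thesis using x by (simp add: cong_sym_eq)
    qed
    then have "[nat x = nat ((q' * x + 0) mod int p) * q] (mod p)" by (simp only: cong_int_iff)
    then show "gcong p (monom (f (q' * x) ^ q) (nat x))
      ((\<lambda>y. monom (f y ^ q) (nat y * q)) ((q' * x + 0) mod int p))"
      using f by (simp add: gcong_monom)
  qed
  also have "\<dots> = F" unfolding F_def by (rule sum_reindex_affine) (use assms cop in auto)
  finally show "gcong p (gen p (\<lambda>x. f (q' * x) ^ q)) F" .
qed

section \<open>Cubic characters and Jacobi sums\<close>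

text \<open>For \<open>z\<close> coprime to a prime \<open>q \<noteq> 3\<close>, the cubic residue symbol \<open>(z/q)\<close> is the cube root of
  unity congruent to \<open>(z / ecnj z) ^ ((q - \<epsilon>) / 3)\<close>, to the power \<open>\<epsilon> = \<plusminus>1 \<equiv> q (mod 3)\<close>. Here the
  denominators are cleared by a power of the norm of \<open>z\<close> that is \<open>1\<close> modulo \<open>q\<close>.\<close>

definition cubic_power :: "nat \<Rightarrow> eis \<Rightarrow> eis" where
  "cubic_power q z = (if q mod 3 = 1 then z ^ (q div 3) * ecnj z ^ (2 * (q div 3))
     else z ^ (2 * (q div 3) + 1) * ecnj z ^ (q div 3))"

lemma cubic_power_mult: "cubic_power q (z * w) = cubic_power q z * cubic_power q w"
  by (simp add: cubic_power_def power_mult_distrib mult_ac)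

locale cubic_character =
  fixes p :: nat and \<chi> :: "int \<Rightarrow> eis"
  assumes prime: "prime p" and p_gt: "p > 3"
    and mod: "\<chi> (x mod int p) = \<chi> x"
    and mult: "\<chi> (x * y) = \<chi> x * \<chi> y"
    and zero: "\<chi> 0 = 0"
    and cases: "\<not> int p dvd x \<Longrightarrow> \<chi> x = 1 \<or> \<chi> x = \<omega> \<or> \<chi> x = \<omega>\<^sup>2"
    and nontrivial: "\<exists>x. \<not> int p dvd x \<and> \<chi> x \<noteq> 1"
begin

abbreviation S where "S \<equiv> {0..<int p}"

definition jacobi :: eis where "jacobi = (\<Sum>x\<in>S. \<chi> x * \<chi> (1 - x))"

lemma cong: "[x = y] (mod int p) \<Longrightarrow> \<chi> x = \<chi> y"
  unfolding cong_def by (metis mod)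

lemma dvd: "int p dvd x \<Longrightarrow> \<chi> x = 0"
  using mod[of x] zero by simp

lemma cube: "\<not> int p dvd x \<Longrightarrow> \<chi> x ^ 3 = 1"
  using cases[of x] by (auto simp: eis_eq_iff eval_nat_numeral)

lemma ecnj_chi: "ecnj (\<chi> x) = \<chi> x ^ 2"
proof (cases "int p dvd x")
  case True
  then show ?thesis using dvd by simp
next
  case False
  from cases[OF this] show ?thesis
    by (elim disjE) (simp_all add: eis_eq_iff eval_nat_numeral)
qed

lemma not_dvd_1: "\<not> int p dvd 1"
  using prime by (metis not_prime_unit prime_nat_int_transfer)

lemma one [simp]: "\<chi> 1 = 1"
proof -
  have "\<chi> 1 * \<chi> 1 = \<chi> 1" using mult[of 1 1] by simp
  moreover have "\<chi> 1 \<noteq> 0" using cube[OF not_dvd_1] by (metis power_zero_numeral zero_neq_one)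
  ultimately show ?thesis by simp
qed

lemma power: "\<chi> (x ^ n) = \<chi> x ^ n"
  by (induction n) (auto simp: mult)

lemma minus_one [simp]: "\<chi> (-1) = 1"
proof -
  have "\<chi> (-1) ^ 3 = 1" using not_dvd_1 by (intro cube) simp
  moreover have "\<chi> (-1) ^ 2 = 1" using power[of "-1" 2] by simp
  ultimately show ?thesis by (simp add: power3_eq_cube power2_eq_square)
qed

lemma minus: "\<chi> (- x) = \<chi> x"
  using mult[of "-1" x] by simp

lemma pow4: "(\<chi> x ^ 2) ^ 2 = \<chi> x"
proof (cases "int p dvd x")
  case False
  have "(\<chi> x ^ 2) ^ 2 = \<chi> x ^ 3 * \<chi> x" by (simp add: eval_nat_numeral mult.assoc)
  then show ?thesis using cube[OF False] by simp
qed (simp add: dvd)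

lemma square: "cubic_character p (\<lambda>x. \<chi> x ^ 2)"
proof
  show "\<exists>x. \<not> int p dvd x \<and> (\<chi> x)\<^sup>2 \<noteq> 1"
    using nontrivial pow4 by (metis power_one)
  show "(\<chi> x)\<^sup>2 = 1 \<or> (\<chi> x)\<^sup>2 = \<omega> \<or> (\<chi> x)\<^sup>2 = \<omega>\<^sup>2" if "\<not> int p dvd x" for x
    using cases[OF that] by (elim disjE) (simp_all add: eis_eq_iff eval_nat_numeral)
qed (auto simp: prime p_gt mod mult zero power_mult_distrib)

lemma p_pos: "p > 0" using p_gt by simp

lemma coprime_iff: "coprime x (int p) \<longleftrightarrow> \<not> int p dvd x"
  using prime by (metis coprime_commute prime_imp_coprime_int prime_nat_int_transfer
      coprime_absorb_left not_prime_unit)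

lemma sum_chi: "(\<Sum>x\<in>S. \<chi> x) = 0"
proof -
  obtain y where y: "\<not> int p dvd y" "\<chi> y \<noteq> 1" using nontrivial by blast
  have "(\<Sum>x\<in>S. \<chi> x) = (\<Sum>x\<in>S. \<chi> ((y * x + 0) mod int p))"
    by (rule sum_reindex_affine[symmetric]) (use y p_pos coprime_iff in auto)
  also have "\<dots> = \<chi> y * (\<Sum>x\<in>S. \<chi> x)" by (simp add: mod mult sum_distrib_left)
  finally have "(\<chi> y - 1) * (\<Sum>x\<in>S. \<chi> x) = 0" by (simp add: algebra_simps)
  then show ?thesis using y by simp
qed

lemma sum_chi_shift: "(\<Sum>x\<in>S. \<chi> (x - c)) = 0"
proof -
  have "(\<Sum>x\<in>S. \<chi> (x - c)) = (\<Sum>x\<in>S. \<chi> ((1 * x + (- c)) mod int p))" by (simp add: mod)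
  also have "\<dots> = (\<Sum>x\<in>S. \<chi> x)" by (rule sum_reindex_affine) (use p_pos in auto)
  finally show ?thesis by (simp add: sum_chi)
qed

text \<open>Substitute a x for x. A convolution of powers of the character is thus known at all
  units once it is known at 1.\<close>

lemma conv_scale:
  assumes a: "\<not> int p dvd a"
  shows "(\<Sum>x\<in>S. \<chi> x ^ i * \<chi> (a - x) ^ j) =
    \<chi> a ^ (i + j) * (\<Sum>x\<in>S. \<chi> x ^ i * \<chi> (1 - x) ^ j)"
proof -
  let ?f = "\<lambda>x. \<chi> x ^ i * \<chi> (a - x) ^ j"
  have "(\<Sum>x\<in>S. ?f x) = (\<Sum>x\<in>S. ?f ((a * x + 0) mod int p))"
    by (rule sum_reindex_affine[symmetric]) (use a p_pos coprime_iff in auto)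
  also have "\<dots> = (\<Sum>x\<in>S. \<chi> a ^ (i + j) * (\<chi> x ^ i * \<chi> (1 - x) ^ j))"
  proof (intro sum.cong refl)
    fix x
    have "\<chi> (a - (a * x + 0) mod int p) = \<chi> (a * (1 - x))"
      by (rule cong) (simp add: cong_def mod_diff_right_eq algebra_simps)
    then show "?f ((a * x + 0) mod int p) = \<chi> a ^ (i + j) * (\<chi> x ^ i * \<chi> (1 - x) ^ j)"
      by (simp add: mod mult power_mult_distrib power_add mult_ac)
  qed
  finally show ?thesis by (simp add: sum_distrib_left)
qed

text \<open>Sending X to a primitive p-th root of unity turns \<open>P\<close> and \<open>P2\<close>
  into the Gauss sums of the character and its square, and \<open>gen p \<tau>\<close>, which is p
  [0] minus the sum of all [x], into p. So \<open>PP\<close>, \<open>PP2\<close> and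
  \<open>PT\<close> lift the classical product formulas to the group ring.\<close>

abbreviation P where "P \<equiv> gen p \<chi>"
abbreviation P2 where "P2 \<equiv> gen p (\<lambda>x. \<chi> x ^ 2)"
abbreviation \<tau> :: "int \<Rightarrow> eis" where "\<tau> x \<equiv> (if int p dvd x then of_nat p else 0) - 1"

lemma sum_chi2: "(\<Sum>x\<in>S. \<chi> x ^ 2) = 0"
  using sum_chi by (simp flip: ecnj_chi ecnj_sum)

lemma PP: "gcong p (P * P) ([:jacobi:] * P2)"
proof -
  have "gcong p (P * P) (gen p (\<lambda>a. \<Sum>x\<in>S. \<chi> x * \<chi> (a - x)))"
    by (rule gen_mult) (auto simp: p_pos mod)
  also have "(\<lambda>a. \<Sum>x\<in>S. \<chi> x * \<chi> (a - x)) = (\<lambda>a. jacobi * \<chi> a ^ 2)"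
  proof
    fix a
    show "(\<Sum>x\<in>S. \<chi> x * \<chi> (a - x)) = jacobi * \<chi> a ^ 2"
    proof (cases "int p dvd a")
      case True
      have "\<chi> (a - x) = \<chi> x" for x
        using True cong[of "a - x" "-x"] minus[of x] by (simp add: cong_iff_dvd_diff)
      then have "(\<Sum>x\<in>S. \<chi> x * \<chi> (a - x)) = (\<Sum>x\<in>S. \<chi> x ^ 2)" by (simp add: power2_eq_square)
      then show ?thesis using sum_chi2 dvd[OF True] by simp
    next
      case False
      then show ?thesis using conv_scale[OF False, of 1 1] by (simp add: jacobi_def mult.commute power2_eq_square)
    qed
  qed
  finally show ?thesis by (simp only: gen_smult)
qed

lemma PP2: "gcong p (P * P2) (gen p \<tau>)"
proof -
  let ?c = "\<lambda>a. \<Sum>x\<in>S. \<chi> x * \<chi> (a - x) ^ 2"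
  have "gcong p (P * P2) (gen p ?c)"
    by (rule gen_mult) (auto simp: p_pos mod)
  also have "gen p ?c = gen p \<tau>"
  proof (rule gen_cong)
    have c: "?c a = ?c 1" if "\<not> int p dvd a" for a
      using conv_scale[OF that, of 1 2] cube[OF that] by (simp add: power3_eq_cube mult.assoc)
    have S: "S = insert 0 {1..<int p}" using p_pos by auto
    have nd: "\<not> int p dvd x" if "x \<in> {1..<int p}" for x
      using that zdvd_not_zless by auto
    have c0: "?c 0 = of_nat p - 1"
    proof -
      have "?c 0 = (\<Sum>x\<in>{1..<int p}. \<chi> x ^ 3)"
        unfolding S by (simp add: zero minus power3_eq_cube power2_eq_square mult.assoc)
      also have "\<dots> = (\<Sum>x\<in>{1..<int p}. 1)" using nd cube by (intro sum.cong) auto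
      finally show ?thesis using p_pos by (simp add: of_nat_diff)
    qed
    \<comment> \<open>The coefficients of the product add up to 0. The one at 0 is p - 1 and the
      other p - 1 are equal, so each of these is -1.\<close>
    have "(\<Sum>a\<in>S. ?c a) = (\<Sum>x\<in>S. \<chi> x * (\<Sum>a\<in>S. \<chi> (a - x) ^ 2))"
      by (subst sum.swap) (simp add: sum_distrib_left)
    also have "\<dots> = 0"
      using cubic_character.sum_chi_shift[OF square] by simp
    finally have "?c 0 + (\<Sum>a\<in>{1..<int p}. ?c a) = 0" unfolding S by simp
    also have "(\<Sum>a\<in>{1..<int p}. ?c a) = (\<Sum>a\<in>{1..<int p}. ?c 1)"
      by (intro sum.cong refl c nd)
    also have "\<dots> = (of_nat p - 1) * ?c 1" using p_pos by (simp add: of_nat_diff)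
    finally have "(of_nat p - 1) * (1 + ?c 1) = 0"
      unfolding c0 distrib_left mult_1_right .
    moreover have "of_nat p - (1::eis) \<noteq> 0" using p_gt by (simp add: eis_eq_iff)
    ultimately have "1 + ?c 1 = 0" by simp
    then have c1: "?c 1 = -1" by (simp add: eq_neg_iff_add_eq_0 add.commute)
    fix a :: int assume a: "0 \<le> a" "a < int p"
    show "?c a = \<tau> a"
    proof (cases "a = 0")
      case True
      then show ?thesis using c0 by simp
    next
      case False
      then have "\<not> int p dvd a" using nd[of a] a by auto
      then show ?thesis using c[of a] c1 by simp
    qed
  qed
  finally show ?thesis .
qed

text \<open>The sum of all [x] annihilates \<open>P\<close>, because the values of the character add
  up to 0; only p [0] acts.\<close>

lemma PT: "gcong p (P * gen p \<tau>) ([:of_nat p:] * P)"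
proof -
  let ?c = "\<lambda>a. \<Sum>x\<in>S. \<chi> x * \<tau> (a - x)"
  have "gcong p (P * gen p \<tau>) (gen p ?c)"
    by (rule gen_mult) (auto simp: p_pos dvd_mod_iff)
  also have "gen p ?c = gen p (\<lambda>a. of_nat p * \<chi> a)"
  proof (rule gen_cong)
    fix a :: int assume a: "0 \<le> a" "a < int p"
    have "?c a = (\<Sum>x\<in>S. (if x = a then of_nat p * \<chi> a else 0) - \<chi> x)"
    proof (intro sum.cong refl)
      fix x assume "x \<in> S"
      then have "int p dvd a - x \<longleftrightarrow> x = a"
        using a by (auto simp: mod_eq_dvd_iff[symmetric])
      then show "\<chi> x * \<tau> (a - x) = (if x = a then of_nat p * \<chi> a else 0) - \<chi> x"
        by (simp add: algebra_simps)
    qed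
    also have "\<dots> = of_nat p * \<chi> a" using a by (simp add: sum_subtractf sum_chi)
    finally show "?c a = of_nat p * \<chi> a" .
  qed
  finally show ?thesis by (simp only: gen_smult)
qed

lemma P3: "gcong p (P ^ 3) ([:jacobi:] * gen p \<tau>)"
proof -
  have "gcong p (P ^ 3) (P * ([:jacobi:] * P2))"
    unfolding power3_eq_cube mult.assoc by (intro gcong_mult PP gcong_refl)
  also have "P * ([:jacobi:] * P2) = [:jacobi:] * (P * P2)" by (rule mult.left_commute)
  also have "gcong p \<dots> ([:jacobi:] * gen p \<tau>)" by (intro gcong_mult PP2 gcong_refl)
  finally show ?thesis .
qed

text \<open>Cubing \<open>P\<close> produces \<open>\<tau>\<close> and not p. The spare factor
  \<open>P\<close> absorbs \<open>\<tau>\<close> as p, whence the exponent 3 a + 1.\<close>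

lemma P_power: "gcong p (P ^ (3 * a + 1)) ([:(of_nat p * jacobi) ^ a:] * P)"
proof (induction a)
  case (Suc a)
  have "P ^ (3 * Suc a + 1) = P ^ 3 * P ^ (3 * a + 1)"
    unfolding power_add[symmetric] by (rule arg_cong[of _ _ "power P"]) simp
  also have "gcong p \<dots> (([:jacobi:] * gen p \<tau>) * ([:(of_nat p * jacobi) ^ a:] * P))"
    by (intro gcong_mult Suc P3)
  also have "\<dots> = [:jacobi * (of_nat p * jacobi) ^ a:] * (P * gen p \<tau>)" by (simp add: mult_ac)
  also have "gcong p \<dots> ([:jacobi * (of_nat p * jacobi) ^ a:] * ([:of_nat p:] * P))"
    by (intro gcong_mult PT gcong_refl)
  also have "\<dots> = [:(of_nat p * jacobi) ^ Suc a:] * P" by (simp add: mult_ac)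
  finally show ?case .
qed simp

lemma jacobi_square: "cubic_character.jacobi p (\<lambda>x. \<chi> x ^ 2) = ecnj jacobi"
  by (simp add: cubic_character.jacobi_def[OF square] jacobi_def ecnj_chi)

lemma one_in: "(0::int) \<le> 1" "1 < int p" using p_gt by auto

text \<open>Associate the product P P2 P2 in two ways: once P P2 acts as p on \<open>P2\<close>,
  once P2 P2 gives the conjugate Jacobi sum times \<open>P\<close>. Then compare coefficients at
  [1].\<close>

lemma enorm_jacobi: "enorm jacobi = int p"
proof -
  interpret sq: cubic_character p "\<lambda>x. \<chi> x ^ 2" by (rule square)
  have s: "(\<lambda>x. (\<chi> x ^ 2) ^ 2) = \<chi>" using pow4 by auto
  have "gcong p (P * P2 * P2) (gen p \<tau> * P2)" by (intro gcong_mult PP2 gcong_refl)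
  also have "gen p \<tau> * P2 = P2 * gen p \<tau>" by (rule mult.commute)
  also have "gcong p \<dots> ([:of_nat p:] * P2)" by (rule sq.PT)
  finally have 1: "gcong p (P * P2 * P2) ([:of_nat p:] * P2)" .
  have "P * P2 * P2 = P * (P2 * P2)" by (rule mult.assoc)
  also have "gcong p \<dots> (P * ([:ecnj jacobi:] * P))"
    by (rule gcong_mult[OF gcong_refl]) (use sq.PP in \<open>simp only: s jacobi_square\<close>)
  also have "\<dots> = [:ecnj jacobi:] * (P * P)" by (rule mult.left_commute)
  also have "gcong p \<dots> ([:ecnj jacobi:] * ([:jacobi:] * P2))"
    by (intro gcong_mult PP gcong_refl)
  finally have "gcong p (P * P2 * P2) ([:ecnj jacobi * jacobi:] * P2)"
    by (simp add: mult.commute)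
  from gcong_trans[OF gcong_sym[OF this] 1]
  have "gcong p (gen p (\<lambda>x. ecnj jacobi * jacobi * \<chi> x ^ 2) - gen p (\<lambda>x. of_nat p * \<chi> x ^ 2)) 0"
    unfolding gen_smult by (simp add: gcong_def)
  from gen_eq_0[OF p_pos this[unfolded gen_diff] one_in]
  have "of_int (enorm jacobi) = (of_int (int p) :: eis)" by (simp add: mult_ecnj[symmetric] mult.commute)
  then show ?thesis by (metis eis_of_simps(3))
qed

lemma inverse_exists:
  assumes "prime q" "q \<noteq> p"
  obtains q' where "[int q * q' = 1] (mod int p)"
proof -
  have "coprime (int q) (int p)"
    using assms prime by (simp add: primes_coprime)
  then show ?thesis using coprime_iff_invertible_int that by blast
qed

text \<open>Compute the coefficient of P^3 at [1] twice: \<open>P3\<close> gives minus the Jacobi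
  sum, and Frobenius at 3 gives 1 modulo 3, since the character has cube 1 on units.\<close>

lemma jacobi_primary: "of_nat 3 dvd jacobi + 1"
proof -
  obtain q' where q': "[int 3 * q' = 1] (mod int p)" using inverse_exists[of 3] p_gt by auto
  obtain F where F: "gcong p (gen p (\<lambda>x. \<chi> (q' * x) ^ 3)) F" "of_nat 3 dvd P ^ 3 - F"
    using gen_frobenius[where f = \<chi> and q = 3, OF p_pos _ q' mod] by auto
  have "of_nat 3 dvd \<chi> (q' * 1) ^ 3 - jacobi * \<tau> 1"
    by (rule gen_cong_mod[OF p_pos F(1) gcong_sym[OF P3[unfolded gen_smult]] _ one_in])
      (subst dvd_diff_swap, rule F(2))
  moreover have "\<not> int p dvd q'"
    using q' coprime_iff coprime_iff_invertible_int by (metis mult.commute)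
  ultimately show ?thesis using cube not_dvd_1 by (simp add: add.commute)
qed

text \<open>Compute the coefficient of P^q at [1] twice. Frobenius gives the q-th power of the
  character at the inverse of q; \<open>P_power\<close> gives a power of p times the Jacobi sum,
  which becomes \<open>cubic_power\<close> once p is written as the Jacobi sum times its
  conjugate.\<close>

lemma jacobi_reciprocity:
  assumes q: "prime q" "q \<noteq> p" "q \<noteq> 3"
  shows "of_nat q dvd cubic_power q jacobi - \<chi> (int q)"
proof -
  obtain q' where q': "[int q * q' = 1] (mod int p)" using inverse_exists q by blast
  have inv: "\<chi> (int q) * \<chi> q' = 1" using cong[OF q'] by (simp add: mult)
  have nd: "\<not> int p dvd int q"
    using q prime by (auto dest: primes_dvd_imp_eq)
  have q'_eq: "\<chi> q' = \<chi> (int q) ^ 2"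
  proof -
    have "\<chi> (int q) ^ 2 = \<chi> (int q) ^ 2 * (\<chi> (int q) * \<chi> q')" using inv by simp
    also have "\<dots> = \<chi> (int q) ^ 3 * \<chi> q'" by (simp add: eval_nat_numeral mult_ac)
    finally show ?thesis using cube[OF nd] by simp
  qed
  obtain F where F: "gcong p (gen p (\<lambda>x. \<chi> (q' * x) ^ q)) F" "of_nat q dvd P ^ q - F"
    using gen_frobenius[where f = \<chi>, OF p_pos q(1) q' mod] by blast
  define a where "a = q div 3"
  have nd': "\<not> int p dvd q'" using inv dvd by fastforce
  have chi_pow: "\<chi> q' ^ (3 * a + r) = \<chi> q' ^ r" for r
    using cube[OF nd'] by (simp add: power_add power_mult)
  have pj: "of_nat p = jacobi * ecnj jacobi" by (simp add: mult_ecnj enorm_jacobi)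
  have "q mod 3 \<noteq> 0" using q using primes_dvd_imp_eq[of 3 q] by (auto simp: dvd_eq_mod_eq_0)
  then consider "q mod 3 = 1" | "q mod 3 = 2" by linarith
  then show ?thesis
  proof cases
    case 1
    then have qa: "q = 3 * a + 1" unfolding a_def using div_mult_mod_eq[of q 3] by linarith
    have "of_nat q dvd \<chi> (q' * 1) ^ q - (of_nat p * jacobi) ^ a * \<chi> 1"
      by (rule gen_cong_mod[OF p_pos F(1) gcong_sym[OF P_power[unfolded gen_smult]] _ one_in])
        (use F(2) in \<open>simp only: qa dvd_diff_swap[of _ F]\<close>)
    moreover have "\<chi> (q' * 1) ^ q = \<chi> (int q) ^ 2"
      using chi_pow[of 1] qa q'_eq by (metis mult_1_right power_one_right)
    ultimately have "of_nat q dvd \<chi> (int q) ^ 2 - (of_nat p * jacobi) ^ a" by simp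
    \<comment> \<open>For q = 1 mod 3 Frobenius yields the square of the character at q, so both
      sides are conjugated.\<close>
    then have "of_nat q dvd ecnj (\<chi> (int q) ^ 2 - (of_nat p * jacobi) ^ a)"
      by (metis ecnj_dvd ecnj_hom(7))
    also have "ecnj (\<chi> (int q) ^ 2 - (of_nat p * jacobi) ^ a) = \<chi> (int q) - cubic_power q jacobi"
    proof -
      have "ecnj ((of_nat p * jacobi) ^ a) = cubic_power q jacobi"
        using 1 by (simp add: cubic_power_def a_def[symmetric] pj power_mult_distrib
            mult_2 power_add)
      then show ?thesis unfolding ecnj_hom(3) ecnj_power ecnj_chi pow4 by simp
    qed
    finally show ?thesis by (simp add: dvd_diff_swap)
  next
    case 2
    then have qa: "q = 3 * a + 2" unfolding a_def using div_mult_mod_eq[of q 3] by linarith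
    have "P ^ (3 * a + 2) = P * P ^ (3 * a + 1)" by simp
    also have "gcong p \<dots> (P * ([:(of_nat p * jacobi) ^ a:] * P))"
      by (intro gcong_mult gcong_refl P_power)
    also have "\<dots> = [:(of_nat p * jacobi) ^ a:] * (P * P)" by (rule mult.left_commute)
    also have "gcong p \<dots> ([:(of_nat p * jacobi) ^ a:] * ([:jacobi:] * P2))"
      by (intro gcong_mult PP gcong_refl)
    also have "\<dots> = [:(of_nat p * jacobi) ^ a * jacobi:] * P2" by (simp add: mult.commute)
    finally have P: "gcong p (P ^ (3 * a + 2)) ([:(of_nat p * jacobi) ^ a * jacobi:] * P2)" .
    have "of_nat q dvd \<chi> (q' * 1) ^ q - (of_nat p * jacobi) ^ a * jacobi * \<chi> 1 ^ 2"
      by (rule gen_cong_mod[OF p_pos F(1) gcong_sym[OF P[unfolded gen_smult]] _ one_in])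
        (use F(2) in \<open>simp only: qa dvd_diff_swap[of _ F]\<close>)
    moreover have "\<chi> (q' * 1) ^ q = \<chi> (int q)"
      using chi_pow[of 2] qa q'_eq by (metis mult_1_right pow4)
    ultimately have "of_nat q dvd \<chi> (int q) - (of_nat p * jacobi) ^ a * jacobi" by simp
    also have "(of_nat p * jacobi) ^ a * jacobi = cubic_power q jacobi"
      using 2 by (simp add: cubic_power_def a_def[symmetric] pj power_mult_distrib
          mult_2 power_add)
    finally show ?thesis by (simp add: dvd_diff_swap)
  qed
qed

end

section \<open>Cubic reciprocity\<close>

text \<open>The character is omega to the discrete logarithm with respect to a primitive root. The
  logarithm is determined modulo p - 1, and 3 divides p - 1.\<close>

lemma cubic_character_exists:
  assumes p: "prime p" and p1: "p mod 3 = 1"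
  obtains \<chi> where "cubic_character p \<chi>"
proof -
  obtain g where g: "residue_primroot p g"
    using prime_primitive_root_exists[of p] p prime_gt_1_nat[of p] by auto
  have p_gt: "p > 3" using p1 prime_gt_1_nat[OF p] by (cases "p = 2 \<or> p = 3") auto
  have ord: "ord p g = p - 1" and cop: "coprime p g"
    using g p by (auto simp: residue_primroot_def totient_prime)
  have "3 dvd p - 1" using p1 p_gt by (metis dvd_minus_mod)
  have pow: "[i = j] (mod 3)" if "[int g ^ i = int g ^ j] (mod int p)" for i j
  proof -
    have "[g ^ i = g ^ j] (mod p)" using that by (simp flip: of_nat_power add: cong_int_iff)
    then have "[i = j] (mod p - 1)" using order_divides_expdiff[OF cop] ord by simp
    then show ?thesis using \<open>3 dvd p - 1\<close> cong_dvd_modulus_nat by blast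
  qed
  have log: "\<exists>i. [x = int g ^ i] (mod int p)" if x: "\<not> int p dvd x" for x
  proof -
    define y where "y = nat (x mod int p)"
    have y: "int y = x mod int p" using p_gt by (simp add: y_def)
    have "y \<noteq> 0"
    proof
      assume "y = 0"
      then show False using x y by (simp add: dvd_eq_mod_eq_0)
    qed
    moreover have "y < p" using y p_gt by (metis of_nat_less_iff of_nat_0_less_iff pos_mod_bound prime_gt_0_nat[OF p])
    ultimately have "y \<in> totatives p" using p by (simp add: totatives_prime)
    then obtain i where "y = g ^ i mod p"
      using residue_primroot_is_generator[OF _ g] p_gt by (auto simp: bij_betw_def)
    then have "x mod int p = int g ^ i mod int p" using y by (simp add: of_nat_mod)
    then show ?thesis by (auto simp: cong_def)
  qed
  define l where "l x = (SOME i. [x = int g ^ i] (mod int p))" for x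
  have l: "[x = int g ^ l x] (mod int p)" if "\<not> int p dvd x" for x
    unfolding l_def using someI_ex[OF log[OF that]] .
  define \<chi> where "\<chi> x = (if int p dvd x then 0 else \<omega> ^ l x)" for x
  have chi: "\<chi> x = \<omega> ^ i" if "[x = int g ^ i] (mod int p)" "\<not> int p dvd x" for x i
    using pow[of "l x" i] that l cong_trans cong_sym
    unfolding \<chi>_def by (metis omega_power_cong)
  have prime_dvd: "int p dvd x * y \<longleftrightarrow> int p dvd x \<or> int p dvd y" for x y
    using p by (simp add: prime_dvd_mult_iff)
  have "cubic_character p \<chi>"
  proof
    show "\<chi> (x mod int p) = \<chi> x" for x
    proof (cases "int p dvd x")
      case False
      then show ?thesis using chi[of "x mod int p" "l x"] l[OF False]
        by (simp add: \<chi>_def dvd_mod_iff)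
    qed (simp add: \<chi>_def)
    show "\<chi> (x * y) = \<chi> x * \<chi> y" for x y
    proof (cases "int p dvd x * y")
      case False
      then have xy: "\<not> int p dvd x" "\<not> int p dvd y" by (auto simp: prime_dvd)
      have "[x * y = int g ^ (l x + l y)] (mod int p)"
        unfolding power_add by (intro cong_mult l xy)
      from chi[OF this False] show ?thesis using xy by (simp add: \<chi>_def power_add)
    qed (use prime_dvd in \<open>auto simp: \<chi>_def\<close>)
    show "\<chi> x = 1 \<or> \<chi> x = \<omega> \<or> \<chi> x = \<omega>\<^sup>2" if "\<not> int p dvd x" for x
      using omega_power_cases[of "l x"] that by (simp add: \<chi>_def)
    have "\<not> int p dvd int g" using cop p
      by (metis coprime_absorb_left not_prime_unit int_dvd_int_iff)
    moreover from this have "\<chi> (int g) = \<omega>" using chi[of "int g" 1] by simp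
    moreover have "\<omega> \<noteq> 1" by (simp add: eis_eq_iff)
    ultimately show "\<exists>x. \<not> int p dvd x \<and> \<chi> x \<noteq> 1" by metis
  qed (use p p_gt in \<open>auto simp: \<chi>_def\<close>)
  then show ?thesis by (rule that)
qed

section \<open>Cubic symbols with rational modulus, and reciprocity for products\<close>

definition has_cubic_symbol :: "nat \<Rightarrow> eis \<Rightarrow> bool" where
  "has_cubic_symbol q z \<longleftrightarrow> (\<exists>l. of_nat q dvd cubic_power q z - \<omega> ^ l)"

text \<open>The symbol is an arbitrary cube root of unity unless \<open>has_cubic_symbol q z\<close>.\<close>

definition prime_cubic_symbol :: "nat \<Rightarrow> eis \<Rightarrow> eis" where
  "prime_cubic_symbol q z = \<omega> ^ (SOME l. of_nat q dvd cubic_power q z - \<omega> ^ l)"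

definition cubic_symbol :: "nat \<Rightarrow> eis \<Rightarrow> eis" where
  "cubic_symbol r z = (\<Prod>q\<in>#prime_factorization r. prime_cubic_symbol q z)"

lemma prime_cubic_symbol_eqI:
  assumes "prime q" "q \<noteq> 3" "of_nat q dvd cubic_power q z - \<omega> ^ l"
  shows "prime_cubic_symbol q z = \<omega> ^ l" "has_cubic_symbol q z"
proof -
  let ?k = "SOME l. of_nat q dvd cubic_power q z - \<omega> ^ l"
  have "of_nat q dvd cubic_power q z - \<omega> ^ ?k" using someI[of _ l] assms(3) .
  then have "of_nat q dvd (cubic_power q z - \<omega> ^ l) - (cubic_power q z - \<omega> ^ ?k)"
    using assms(3) by (rule dvd_diff[rotated])
  then have "of_nat q dvd \<omega> ^ ?k - \<omega> ^ l" by simp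
  from omega_power_cong_mod[OF assms(1,2) this] show "prime_cubic_symbol q z = \<omega> ^ l"
    unfolding prime_cubic_symbol_def by (rule omega_power_cong)
  show "has_cubic_symbol q z" using assms(3) by (auto simp: has_cubic_symbol_def)
qed

text \<open>That \<open>cubic_power\<close> is congruent to a cube root of unity is not shown for
  general arguments; it is passed from factors to products together with multiplicativity.\<close>

lemma prime_cubic_symbol_mult:
  assumes q: "prime q" "q \<noteq> 3" and "has_cubic_symbol q z" "has_cubic_symbol q w"
  shows "prime_cubic_symbol q (z * w) = prime_cubic_symbol q z * prime_cubic_symbol q w"
    "has_cubic_symbol q (z * w)"
proof -
  from assms obtain i j where ij: "of_nat q dvd cubic_power q z - \<omega> ^ i"
    "of_nat q dvd cubic_power q w - \<omega> ^ j" by (auto simp: has_cubic_symbol_def)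
  have "cubic_power q (z * w) - \<omega> ^ (i + j) = (cubic_power q z - \<omega> ^ i) * cubic_power q w
      + \<omega> ^ i * (cubic_power q w - \<omega> ^ j)"
    by (simp add: cubic_power_mult power_add algebra_simps)
  then have "of_nat q dvd cubic_power q (z * w) - \<omega> ^ (i + j)" using ij by simp
  from prime_cubic_symbol_eqI[OF q this] prime_cubic_symbol_eqI(1)[OF q ij(1)]
    prime_cubic_symbol_eqI(1)[OF q ij(2)]
  show "prime_cubic_symbol q (z * w) = prime_cubic_symbol q z * prime_cubic_symbol q w"
    "has_cubic_symbol q (z * w)" by (simp_all add: power_add)
qed

lemma cubic_symbol_mult_left:
  assumes "r > 0" "s > 0"
  shows "cubic_symbol (r * s) z = cubic_symbol r z * cubic_symbol s z"
  using assms by (simp add: cubic_symbol_def prime_factorization_mult)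

lemma cubic_symbol_prime: "prime q \<Longrightarrow> cubic_symbol q z = prime_cubic_symbol q z"
  by (simp add: cubic_symbol_def prime_factorization_prime)

lemma cubic_symbol_one [simp]: "cubic_symbol 1 z = 1"
  by (simp add: cubic_symbol_def)

lemma cubic_symbol_power: "r > 0 \<Longrightarrow> cubic_symbol (r ^ n) z = cubic_symbol r z ^ n"
  by (induction n) (auto simp: cubic_symbol_mult_left simp del: One_nat_def)

text \<open>Conjugation fixes rational integers, so the two exponents in \<open>cubic_power\<close>
  add up to q - 1 and Fermat's theorem applies.\<close>

lemma cubic_power_of_int:
  assumes q: "prime q" "q \<noteq> 3" and n: "\<not> int q dvd n"
  shows "of_nat q dvd cubic_power q (of_int n) - \<omega> ^ 0"
proof -
  have "q mod 3 \<noteq> 0" using q primes_dvd_imp_eq[of 3 q] by (auto simp: dvd_eq_mod_eq_0)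
  then have "q mod 3 = 1 \<or> q mod 3 = 2" by linarith
  then have e: "cubic_power q (of_int n) = of_int (n ^ (q - 1))"
  proof
    assume *: "q mod 3 = 1"
    have "q - 1 = q div 3 + 2 * (q div 3)" using div_mult_mod_eq[of q 3] * by linarith
    then show ?thesis using * by (simp add: cubic_power_def flip: power_add)
  next
    assume *: "q mod 3 = 2"
    have "q - 1 = 2 * (q div 3) + 1 + q div 3" using div_mult_mod_eq[of q 3] * by linarith
    then show ?thesis using * by (simp add: cubic_power_def flip: power_add)
  qed
  have "[n ^ (q - 1) = 1] (mod int q)"
  proof -
    define y where "y = nat (n mod int q)"
    have y: "int y = n mod int q" using q prime_gt_0_nat by (simp add: y_def)
    have "\<not> q dvd y" using n y by (metis dvd_mod_iff dvd_refl int_dvd_int_iff)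
    then have "[y ^ (q - 1) = 1] (mod q)" using q fermat_theorem by blast
    then have "[int y ^ (q - 1) = 1] (mod int q)" by (metis cong_int_iff of_nat_1 of_nat_power)
    moreover have "[int y ^ (q - 1) = n ^ (q - 1)] (mod int q)"
      using y by (intro cong_pow) (simp add: cong_def)
    ultimately show ?thesis using cong_sym cong_trans by blast
  qed
  then have "int q dvd n ^ (q - 1) - 1" by (simp add: cong_iff_dvd_diff)
  moreover have "cubic_power q (of_int n) - \<omega> ^ 0 = of_int (n ^ (q - 1) - 1)"
    unfolding e by simp
  ultimately show ?thesis by (simp only: of_nat_dvd_eis eis_of_simps dvd_0_right simp_thms)
qed

definition admissible :: "nat \<Rightarrow> eis \<Rightarrow> bool" where
  "admissible r z \<longleftrightarrow> r > 0 \<and> (\<forall>q. prime q \<and> q dvd r \<longrightarrow> q \<noteq> 3 \<and> \<not> int q dvd enorm z)"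

text \<open>Reciprocity without prime factorizations in \<open>\<int>[\<omega>]\<close>: the symbol \<open>(z/r)\<close> depends only on the
  residue of \<open>r\<close> modulo \<open>z\<close> and cubes. In this form it is inherited by products.\<close>

definition reciprocal :: "eis \<Rightarrow> bool" where
  "reciprocal z \<longleftrightarrow>
    (\<forall>q. prime q \<and> q \<noteq> 3 \<and> \<not> int q dvd enorm z \<longrightarrow> has_cubic_symbol q z) \<and>
    (\<forall>r s c. admissible r z \<and> admissible s z \<and> z dvd of_int (int r - c ^ 3 * int s) \<longrightarrow>
       cubic_symbol r z = cubic_symbol s z)"

lemma cubic_symbol_mult_right:
  assumes "\<And>q. prime q \<Longrightarrow> q dvd r \<Longrightarrow> q \<noteq> 3 \<and> has_cubic_symbol q z \<and> has_cubic_symbol q w"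
  shows "cubic_symbol r (z * w) = cubic_symbol r z * cubic_symbol r w"
proof -
  have "cubic_symbol r (z * w) =
      (\<Prod>q\<in>#prime_factorization r. prime_cubic_symbol q z * prime_cubic_symbol q w)"
    unfolding cubic_symbol_def using assms
    by (intro arg_cong[of _ _ prod_mset] image_mset_cong prime_cubic_symbol_mult)
      (auto simp: in_prime_factors_iff)
  then show ?thesis by (simp add: cubic_symbol_def prod_mset.distrib)
qed

lemma reciprocal_mult:
  assumes z: "reciprocal z" and w: "reciprocal w"
  shows "reciprocal (z * w)"
  unfolding reciprocal_def
proof (intro conjI allI impI; elim conjE)
  fix q :: nat assume q: "prime q" "q \<noteq> 3" "\<not> int q dvd enorm (z * w)"
  then have "has_cubic_symbol q z" "has_cubic_symbol q w"
    using z w by (auto simp: reciprocal_def)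
  then show "has_cubic_symbol q (z * w)" using q prime_cubic_symbol_mult by blast
next
  fix r s :: nat and c :: int
  assume *: "admissible r (z * w)" "admissible s (z * w)" "z * w dvd of_int (int r - c ^ 3 * int s)"
  have eq: "cubic_symbol r (z * w) = cubic_symbol r z * cubic_symbol r w"
    if "admissible r (z * w)" for r
  proof (rule cubic_symbol_mult_right)
    fix q assume q: "prime q" "q dvd r"
    then have "q \<noteq> 3" "\<not> int q dvd enorm z" "\<not> int q dvd enorm w"
      using that by (auto simp: admissible_def)
    then show "q \<noteq> 3 \<and> has_cubic_symbol q z \<and> has_cubic_symbol q w"
      using z w q unfolding reciprocal_def by blast
  qed
  have "admissible r z" "admissible r w" "admissible s z" "admissible s w"
    using * by (auto simp: admissible_def)
  moreover have "z dvd of_int (int r - c ^ 3 * int s)" "w dvd of_int (int r - c ^ 3 * int s)"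
    using * by (auto dest: dvd_mult_left dvd_mult_right)
  ultimately have "cubic_symbol r z = cubic_symbol s z" "cubic_symbol r w = cubic_symbol s w"
    using z w unfolding reciprocal_def by blast+
  then show "cubic_symbol r (z * w) = cubic_symbol s (z * w)" using eq * by simp
qed

lemma reciprocal_of_int: "reciprocal (of_int n)"
proof -
  have s: "prime_cubic_symbol q (of_int n) = 1 \<and> has_cubic_symbol q (of_int n)"
    if "prime q" "q \<noteq> 3" "\<not> int q dvd enorm (of_int n)" for q
  proof -
    have "\<not> int q dvd n" using that(3) by (auto simp: power2_eq_square)
    then show ?thesis using prime_cubic_symbol_eqI[OF that(1,2) cubic_power_of_int] that by simp
  qed
  have "cubic_symbol r (of_int n) = 1" if "admissible r (of_int n)" for r
  proof -
    have "cubic_symbol r (of_int n) = (\<Prod>q\<in>#prime_factorization r. 1)"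
      unfolding cubic_symbol_def using that s
      by (intro arg_cong[of _ _ prod_mset] image_mset_cong)
        (auto simp: in_prime_factors_iff admissible_def)
    then show ?thesis by simp
  qed
  with s show ?thesis by (auto simp: reciprocal_def)
qed

context cubic_character
begin

lemma prime_cubic_symbol_jacobi:
  assumes q: "prime q" "q \<noteq> p" "q \<noteq> 3"
  shows "prime_cubic_symbol q jacobi = \<chi> (int q)" "has_cubic_symbol q jacobi"
proof -
  have "\<not> int p dvd int q" using q prime by (auto dest: primes_dvd_imp_eq)
  from cases[OF this] obtain l where l: "\<chi> (int q) = \<omega> ^ l"
    by (metis power_0 power_one_right)
  from prime_cubic_symbol_eqI[OF q(1,3) jacobi_reciprocity[OF q, unfolded l]]
  show "prime_cubic_symbol q jacobi = \<chi> (int q)" "has_cubic_symbol q jacobi" by (simp_all add: l)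
qed

lemma cubic_symbol_jacobi:
  assumes "admissible r jacobi"
  shows "cubic_symbol r jacobi = \<chi> (int r)"
proof -
  have r: "r > 0" using assms by (simp add: admissible_def)
  have "cubic_symbol r jacobi = (\<Prod>q\<in>#prime_factorization r. \<chi> (int q))"
    unfolding cubic_symbol_def using assms
    by (intro arg_cong[of _ _ prod_mset] image_mset_cong prime_cubic_symbol_jacobi)
      (auto simp: in_prime_factors_iff admissible_def enorm_jacobi)
  also have "(\<Prod>q\<in>#M. \<chi> (int q)) = \<chi> (int (\<Prod>q\<in>#M. q))" for M
    by (induction M) (auto simp: mult)
  finally show ?thesis using r by (simp add: prod_mset_prime_factorization_nat)
qed

text \<open>The symbol is the character at r, a function of r modulo p and up to cubes. A rational
  integer divisible by \<open>jacobi\<close> has its square divisible by p, on taking norms, and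
  hence is divisible by p.\<close>

lemma reciprocal_jacobi: "reciprocal jacobi"
  unfolding reciprocal_def
proof (intro conjI allI impI; elim conjE)
  fix q :: nat assume "prime q" "q \<noteq> 3" "\<not> int q dvd enorm jacobi"
  moreover from this have "q \<noteq> p" by (auto simp: enorm_jacobi)
  ultimately show "has_cubic_symbol q jacobi"
    using prime_cubic_symbol_jacobi(2) by blast
next
  fix r s :: nat and c :: int
  assume *: "admissible r jacobi" "admissible s jacobi"
    "jacobi dvd of_int (int r - c ^ 3 * int s)"
  from *(3) obtain w where "of_int (int r - c ^ 3 * int s) = jacobi * w" by blast
  then have "(int r - c ^ 3 * int s)\<^sup>2 = int p * enorm w"
    by (metis enorm_jacobi enorm_mult enorm_of(1))
  then have "int p dvd int r - c ^ 3 * int s"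
    using prime by (metis dvd_triv_left prime_dvd_power prime_nat_int_transfer)
  then have "\<chi> (int r) = \<chi> (c ^ 3 * int s)" by (intro cong) (simp add: cong_iff_dvd_diff)
  then have eq: "\<chi> (int r) = \<chi> c ^ 3 * \<chi> (int s)" by (simp add: mult power)
  have "\<not> p dvd r" using *(1) prime by (auto simp: admissible_def enorm_jacobi)
  then have "\<chi> (int r) \<noteq> 0" using cube[of "int r"] by (auto simp: int_dvd_int_iff)
  then have "\<not> int p dvd c" using eq dvd[of c] by auto
  then show "cubic_symbol r jacobi = cubic_symbol s jacobi"
    using eq cube[of c] * by (simp add: cubic_symbol_jacobi)
qed

end

section \<open>Primary elements and their reduction to Jacobi sums\<close>

definition primary :: "eis \<Rightarrow> bool" where
  "primary z \<longleftrightarrow> 3 dvd om z \<and> \<not> 3 dvd re z"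

lemma primary_ecnj: "primary (ecnj z) \<longleftrightarrow> primary z"
  unfolding primary_def by (auto simp: dvd_diff_right_iff) presburger+

lemma primary_cancel:
  assumes "primary (z * w)" "primary z"
  shows "primary w"
proof -
  obtain b where b: "om z = 3 * b" using assms(2) by (auto simp: primary_def)
  have "3 dvd re z * om w + 3 * (b * re w - b * om w)"
    using assms(1) b by (simp add: primary_def algebra_simps)
  then have "3 dvd re z * om w" by presburger
  then have om: "3 dvd om w" using assms(2) by (simp add: primary_def prime_dvd_mult_iff)
  have "\<not> 3 dvd re z * re w - 3 * (b * om w)" using assms(1) b by (simp add: primary_def mult.assoc)
  then have "\<not> 3 dvd re w" by auto
  with om show ?thesis by (simp add: primary_def)
qed

lemma primary_not_dvd_enorm: "primary z \<Longrightarrow> \<not> 3 dvd enorm z"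
proof
  assume z: "primary z" "3 dvd enorm z"
  then obtain b where b: "om z = 3 * b" by (auto simp: primary_def)
  have "enorm z = re z * re z + 3 * (- re z * b + 3 * b * b)"
    by (simp add: enorm_def b power2_eq_square algebra_simps)
  then have "3 dvd re z * re z" using z(2) by presburger
  then show False using z(1) by (simp add: primary_def prime_dvd_mult_iff)
qed

text \<open>With z = c + d omega, the norm divides c^3 + d^3, so c and -d have the same cube modulo
  p. By Fermat cubing is injective on units modulo p = 3 a + 2, so c = -d modulo p, and then p
  divides 3 d^2.\<close>

lemma inert_prime_dvd:
  assumes p: "prime p" "p mod 3 = 2" and dvd: "int p dvd enorm z"
  shows "of_nat p dvd z"
proof -
  define c d where "c = re z" and "d = om z"
  have N: "int p dvd c\<^sup>2 - c * d + d\<^sup>2" using dvd by (simp add: enorm_def c_def d_def)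
  have pp: "prime (int p)" using p by simp
  have "int p dvd d"
  proof (rule ccontr)
    assume d: "\<not> int p dvd d"
    have c: "\<not> int p dvd c"
    proof
      assume "int p dvd c"
      then have "int p dvd c * (c - d)" by simp
      moreover have "d\<^sup>2 = (c\<^sup>2 - c * d + d\<^sup>2) - c * (c - d)"
        by (simp add: algebra_simps power2_eq_square)
      ultimately have "int p dvd d\<^sup>2" using N by (metis dvd_diff)
      then show False using d pp prime_dvd_power by blast
    qed
    define a where "a = p div 3"
    have pa: "p - 1 = 3 * a + 1" unfolding a_def using p(2) div_mult_mod_eq[of p 3] by linarith
    have fermat: "[x ^ (p - 1) = 1] (mod int p)" if "\<not> int p dvd x" for x
    proof -
      have "int p dvd x ^ (p - 1) - 1"
      proof -
        have "p \<noteq> 3" using p by auto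
        from cubic_power_of_int[OF p(1) this that] have
          "of_nat p dvd cubic_power p (of_int x) - 1" by simp
        moreover have "cubic_power p (of_int x) = of_int (x ^ (p - 1))"
          using p(2) pa by (simp add: cubic_power_def a_def[symmetric] flip: power_add)
        ultimately have "of_nat p dvd (of_int (x ^ (p - 1) - 1) :: eis)" by simp
        then show ?thesis by (simp only: of_nat_dvd_eis eis_of_simps)
      qed
      then show ?thesis by (simp add: cong_iff_dvd_diff)
    qed
    have "c ^ 3 - (- d) ^ 3 = (c + d) * (c\<^sup>2 - c * d + d\<^sup>2)"
      by (simp add: power2_eq_square power3_eq_cube algebra_simps)
    then have "[c ^ 3 = (- d) ^ 3] (mod int p)" using N by (simp add: cong_iff_dvd_diff)
    then have c3: "[c ^ (3 * a) = (- d) ^ (3 * a)] (mod int p)"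
      unfolding power_mult by (rule cong_pow)
    have "[c ^ (3 * a + 1) = (- d) ^ (3 * a + 1)] (mod int p)"
      using fermat[OF c] fermat[of "- d"] d unfolding pa by (metis cong_sym cong_trans dvd_minus_iff)
    then have "[c ^ (3 * a) * c = c ^ (3 * a) * (- d)] (mod int p)"
      using cong_scalar_right[OF c3, of "- d"] cong_sym cong_trans
      by (metis (no_types) power_add power_one_right)
    moreover have "coprime (c ^ (3 * a)) (int p)"
      using c pp by (metis coprime_commute coprime_power_left_iff prime_imp_coprime)
    ultimately have "[c = - d] (mod int p)" using cong_mult_lcancel by blast
    then have cd: "int p dvd c + d" by (simp add: cong_iff_dvd_diff)
    have "3 * d\<^sup>2 = (c\<^sup>2 - c * d + d\<^sup>2) - (c + d) * (c - 2 * d)"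
      by (simp add: power2_eq_square algebra_simps)
    then have "int p dvd 3 * d\<^sup>2" using N cd by (metis dvd_diff dvd_mult2)
    then have "int p dvd 3" using d pp prime_dvd_mult_iff prime_dvd_power by blast
    then have "p dvd 3" by presburger
    then have "p = 3" using p(1) primes_dvd_imp_eq[of p 3] by simp
    then show False using p(2) by simp
  qed
  moreover from this have "int p dvd c\<^sup>2"
    using N dvd_add[of "int p" "c\<^sup>2 - c * d + d\<^sup>2" "d * (c - d)"]
    by (simp add: algebra_simps power2_eq_square)
  then have "int p dvd c" using pp prime_dvd_power by blast
  ultimately show ?thesis by (simp add: of_nat_dvd_eis c_def d_def)
qed

text \<open>This stands in for unique factorization. The omega-coordinates of z times the conjugate
  of J and of z times J multiply to a combination of the two norms, so p divides one of them. As p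
  divides the norm of that product, it divides the other coordinate too, and one factor of p = J
  \<open>ecnj J\<close> cancels.\<close>

lemma prime_norm_dvd:
  assumes p: "prime p" and J: "enorm J = int p" and dvd: "int p dvd enorm z"
  shows "J dvd z \<or> ecnj J dvd z"
proof -
  define a b c d where "a = re J" and "b = om J" and "c = re z" and "d = om z"
  have pp: "prime (int p)" using p by simp
  have J': "a\<^sup>2 - a * b + b\<^sup>2 = int p" using J by (simp add: enorm_def a_def b_def)
  have z': "int p dvd c\<^sup>2 - c * d + d\<^sup>2" using dvd by (simp add: enorm_def c_def d_def)
  have dvd_if: "J dvd z" if J: "enorm J = int p" and om: "int p dvd om (z * ecnj J)" for J
  proof -
    have "(int p)\<^sup>2 dvd enorm (z * ecnj J)"
      using dvd J by (simp add: power2_eq_square mult_dvd_mono)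
    then have "int p dvd enorm (z * ecnj J)" by (metis dvd_mult_left power2_eq_square)
    then have "int p dvd (re (z * ecnj J))\<^sup>2 + om (z * ecnj J) * (om (z * ecnj J) - re (z * ecnj J))"
      by (simp only: enorm_def) (simp add: algebra_simps power2_eq_square)
    then have "int p dvd (re (z * ecnj J))\<^sup>2" using om by (meson dvd_add_left_iff dvd_mult2)
    then have "int p dvd re (z * ecnj J)" using pp prime_dvd_power by blast
    then have "of_int (int p) dvd z * ecnj J" using om of_int_dvd_eis by blast
    then have "J * ecnj J dvd z * ecnj J" using J by (simp add: mult_ecnj)
    moreover have "ecnj J \<noteq> 0" using J p by (metis enorm_ecnj enorm_of(3) of_nat_eq_0_iff not_prime_0)
    ultimately show ?thesis by simp
  qed
  have "(a * d - b * c) * (b * c + a * d - b * d) =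
      d\<^sup>2 * (a\<^sup>2 - a * b + b\<^sup>2) - b\<^sup>2 * (c\<^sup>2 - c * d + d\<^sup>2)"
    by (simp add: power2_eq_square algebra_simps)
  then have "int p dvd (a * d - b * c) * (b * c + a * d - b * d)" using z' J' by simp
  then consider "int p dvd a * d - b * c" | "int p dvd b * c + a * d - b * d"
    using pp prime_dvd_mult_iff by blast
  then show ?thesis
  proof cases
    case 1
    then have "int p dvd om (z * ecnj J)" by (simp add: a_def b_def c_def d_def algebra_simps)
    then show ?thesis using dvd_if[OF J] by blast
  next
    case 2
    then have "int p dvd om (z * ecnj (ecnj J))" by (simp add: a_def b_def c_def d_def algebra_simps)
    then show ?thesis using dvd_if[of "ecnj J"] J by simp
  qed
qed

lemma enorm_eq_1_primary:
  assumes "enorm z = 1" "primary z"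
  shows "om z = 0"
proof (rule ccontr)
  assume "om z \<noteq> 0"
  then have "\<bar>om z\<bar> \<ge> 3" using assms(2) by (auto simp: primary_def elim!: dvdE)
  then have "(om z)\<^sup>2 \<ge> 9" using abs_le_square_iff[of 3 "om z"] by simp
  then show False using four_enorm[of z] assms(1) zero_le_power2[of "2 * re z - om z"] by linarith
qed

text \<open>A rational prime p dividing the norm yields a primary divisor with known reciprocity: p
  itself if p = 2 mod 3, otherwise a Jacobi sum modulo p or its conjugate. The cofactor is again
  primary and has smaller norm. At norm 1 the only primary units are 1 and -1, which are
  rational.\<close>

theorem reciprocal_primary: "primary z \<Longrightarrow> reciprocal z"
proof (induction "nat (enorm z)" arbitrary: z rule: less_induct)
  case less
  show ?case
  proof (cases "enorm z = 1")
    case True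
    then have "z = of_int (re z)" using enorm_eq_1_primary less.prems by (simp add: eis_eq_iff)
    then show ?thesis using reciprocal_of_int by metis
  next
    case False
    have z0: "enorm z > 0"
      using less.prems by (metis enorm_nonneg enorm_eq_0_iff dvd_0_right primary_def eis_simps(1) order_le_less)
    have "nat (enorm z) \<noteq> 1" using False z0 by linarith
    then obtain p where p: "prime p" "p dvd nat (enorm z)" using prime_factor_nat by blast
    then have pz: "int p dvd enorm z" using z0 by (metis int_dvd_int_iff int_nat_eq enorm_nonneg)
    have "p \<noteq> 3" using pz primary_not_dvd_enorm[OF less.prems] by auto
    then have "p mod 3 \<noteq> 0" using p primes_dvd_imp_eq[of 3 p] by (auto simp: dvd_eq_mod_eq_0)
    then consider "p mod 3 = 1" | "p mod 3 = 2" by linarith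
    then obtain w where w: "w dvd z" "primary w" "reciprocal w" "enorm w > 1"
    proof cases
      case 1
      obtain \<chi> where "cubic_character p \<chi>" using cubic_character_exists p 1 by blast
      then interpret cubic_character p \<chi> .
      interpret sq: cubic_character p "\<lambda>x. \<chi> x ^ 2" by (rule square)
      have "3 dvd re (jacobi + 1)" "3 dvd om (jacobi + 1)"
        using jacobi_primary of_nat_dvd_eis[of 3 "jacobi + 1"] by auto
      then have pr: "primary jacobi" unfolding primary_def by (simp; presburger)
      \<comment> \<open>The conjugate is the Jacobi sum of the squared character.\<close>
      have "reciprocal (ecnj jacobi)" using sq.reciprocal_jacobi by (simp only: jacobi_square)
      then show ?thesis
        using that prime_norm_dvd[OF p(1) enorm_jacobi pz] pr reciprocal_jacobi primary_ecnj
          enorm_jacobi p_gt by (metis enorm_ecnj of_nat_1 of_nat_less_iff less_trans one_less_numeral_iff semiring_norm(77))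
    next
      case 2
      have "of_int (int p) dvd z" using inert_prime_dvd[OF p(1) 2 pz] by simp
      moreover have "primary (of_int (int p))" using 2 by (auto simp: primary_def) presburger
      moreover have "enorm (of_int (int p)) > 1" using prime_gt_1_nat[OF p(1)]
        by (simp add: one_less_power)
      ultimately show ?thesis using that reciprocal_of_int by blast
    qed
    then obtain v where v: "z = w * v" by blast
    then have "primary v" using primary_cancel w less.prems by blast
    moreover have "nat (enorm v) < nat (enorm z)"
    proof -
      have "enorm v > 0" using z0 v by (metis enorm_mult enorm_nonneg mult_zero_right order_le_less)
      then show ?thesis using w(4) v by simp
    qed
    ultimately have "reciprocal v" using less.hyps by blast
    then show ?thesis using v w reciprocal_mult by blast
  qed
qed

section \<open>Powers of two as norms\<close>

lemma square_mod_3: "\<not> 3 dvd (x::int) \<Longrightarrow> \<exists>u. x\<^sup>2 = 3 * u + 1"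
proof -
  assume x: "\<not> 3 dvd x"
  define q where "q = x div 3"
  from x have "x = 3 * q + 1 \<or> x = 3 * q + 2" unfolding q_def by presburger
  then show ?thesis
  proof
    assume "x = 3 * q + 1"
    then have "x\<^sup>2 = 3 * (3 * q\<^sup>2 + 2 * q) + 1" by (simp add: power2_eq_square algebra_simps)
    then show ?thesis by blast
  next
    assume "x = 3 * q + 2"
    then have "x\<^sup>2 = 3 * (3 * q\<^sup>2 + 4 * q + 1) + 1" by (simp add: power2_eq_square algebra_simps)
    then show ?thesis by blast
  qed
qed

lemma square_mod_3_nat: "\<not> 3 dvd (n::nat) \<Longrightarrow> \<exists>u. n\<^sup>2 = 3 * u + 1"
proof -
  assume "\<not> 3 dvd n"
  then have "\<not> 3 dvd int n" by presburger
  then obtain u where u: "(int n)\<^sup>2 = 3 * u + 1" using square_mod_3 by blast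
  have "u \<ge> 0" using u zero_le_power2[of "int n"] by linarith
  then have "int (n\<^sup>2) = int (3 * nat u + 1)" using u by simp
  then show ?thesis using of_nat_eq_iff by blast
qed

lemma cubic_power_cong:
  assumes "of_nat q dvd u - v"
  shows "of_nat q dvd cubic_power q u - cubic_power q v"
proof -
  have pow: "of_nat q dvd x ^ n - y ^ n" if "of_nat q dvd x - y" for x y :: eis and n
    using that by (metis dvd_mult2 power_diff_sumr2)
  have mult: "of_nat q dvd x * x' - y * y'" if "of_nat q dvd x - y" "of_nat q dvd x' - y'"
    for x y x' y' :: eis
  proof -
    have "x * x' - y * y' = (x - y) * x' + y * (x' - y')" by (simp add: algebra_simps)
    then show ?thesis using that by simp
  qed
  have "of_nat q dvd ecnj u - ecnj v" using assms ecnj_dvd[of "of_nat q" "u - v"] by simp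
  then show ?thesis unfolding cubic_power_def using assms by (auto intro!: mult pow)
qed

text \<open>The exponent (q^2 - 1) / 3 serves both classes of q modulo 3, and modulo 3 it is
  additive under multiplication of moduli.\<close>

lemma cubic_power_omega:
  assumes "prime q" "q \<noteq> 3"
  shows "cubic_power q \<omega> = \<omega> ^ ((q\<^sup>2 - 1) div 3)"
proof -
  define a where "a = q div 3"
  have "q mod 3 \<noteq> 0" using assms primes_dvd_imp_eq[of 3 q] by (auto simp: dvd_eq_mod_eq_0)
  then consider "q mod 3 = 1" | "q mod 3 = 2" by linarith
  moreover have cong: "[i = j] (mod 3)" if "i + 3 * u = j + 3 * v" for i j u v :: nat
    using arg_cong[OF that, of "\<lambda>n. n mod 3"] by (simp add: cong_def)
  ultimately show ?thesis
  proof cases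
    case 1
    have q: "q = 3 * a + 1" unfolding a_def using 1 div_mult_mod_eq[of q 3] by linarith
    have "cubic_power q \<omega> = \<omega> ^ (a + 2 * (2 * a))"
      using 1 by (simp add: cubic_power_def ecnj_omega a_def[symmetric] flip: power_add power_mult)
    also have "\<dots> = \<omega> ^ ((q\<^sup>2 - 1) div 3)"
    proof (rule omega_power_cong)
      have "q\<^sup>2 - 1 = 3 * (3 * a\<^sup>2 + 2 * a)" by (simp add: q power2_eq_square algebra_simps)
      then have "(q\<^sup>2 - 1) div 3 = 3 * a\<^sup>2 + 2 * a" by simp
      then show "[a + 2 * (2 * a) = (q\<^sup>2 - 1) div 3] (mod 3)"
        by (intro cong[of _ "a\<^sup>2" _ a]) simp
    qed
    finally show ?thesis .
  next
    case 2
    have q: "q = 3 * a + 2" unfolding a_def using 2 div_mult_mod_eq[of q 3] by linarith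
    have "cubic_power q \<omega> = \<omega> ^ (2 * a + 1 + 2 * a)"
      using 2 by (simp add: cubic_power_def ecnj_omega a_def[symmetric] flip: power_add power_mult power_Suc)
    also have "\<dots> = \<omega> ^ ((q\<^sup>2 - 1) div 3)"
    proof (rule omega_power_cong)
      have "q\<^sup>2 - 1 = 3 * (3 * a\<^sup>2 + 4 * a + 1)" by (simp add: q power2_eq_square algebra_simps)
      then have "(q\<^sup>2 - 1) div 3 = 3 * a\<^sup>2 + 4 * a + 1" by simp
      then show "[2 * a + 1 + 2 * a = (q\<^sup>2 - 1) div 3] (mod 3)"
        by (intro cong[of _ "a\<^sup>2" _ 0]) simp
    qed
    finally show ?thesis .
  qed
qed

lemma prime_cubic_symbol_omega_power:
  assumes "prime q" "q \<noteq> 3"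
  shows "prime_cubic_symbol q (\<omega> ^ i) = \<omega> ^ (i * ((q\<^sup>2 - 1) div 3))"
    "has_cubic_symbol q (\<omega> ^ i)"
proof -
  have "cubic_power q (\<omega> ^ i) = \<omega> ^ (i * ((q\<^sup>2 - 1) div 3))"
  proof (induction i)
    case 0
    show ?case by (simp add: cubic_power_def)
  next
    case (Suc i)
    then show ?case using assms by (simp add: cubic_power_mult cubic_power_omega power_add)
  qed
  then have "of_nat q dvd cubic_power q (\<omega> ^ i) - \<omega> ^ (i * ((q\<^sup>2 - 1) div 3))" by simp
  from prime_cubic_symbol_eqI[OF assms this]
  show "prime_cubic_symbol q (\<omega> ^ i) = \<omega> ^ (i * ((q\<^sup>2 - 1) div 3))"
    "has_cubic_symbol q (\<omega> ^ i)" by simp_all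
qed

text \<open>Rational integers have trivial symbol, so the square of the symbol of z is 1, and a cube
  root of unity with square 1 is 1. The square lets the lemma cover both z rational and z rational
  times sqrt(-3) modulo q.\<close>

lemma prime_cubic_symbol_eq_1:
  assumes q: "prime q" "q \<noteq> 3" "q \<noteq> 2" and n: "\<not> int q dvd n"
    and sq: "of_nat q dvd 4 * z\<^sup>2 - of_int n" and has: "has_cubic_symbol q z"
  shows "prime_cubic_symbol q z = 1"
proof -
  obtain l where l: "of_nat q dvd cubic_power q z - \<omega> ^ l" using has by (auto simp: has_cubic_symbol_def)
  have z: "prime_cubic_symbol q z = \<omega> ^ l" by (rule prime_cubic_symbol_eqI[OF q(1,2) l])
  have "\<not> q dvd 2" using q primes_dvd_imp_eq[of q 2] by auto
  then have "\<not> int q dvd 2" by presburger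
  then have "\<not> int q dvd 2 ^ 2" using q(1) prime_dvd_power by (metis prime_nat_int_transfer)
  then have 4: "\<not> int q dvd 4" by simp
  note s4 = prime_cubic_symbol_eqI[OF q(1,2) cubic_power_of_int[OF q(1,2) 4]]
  note zz = prime_cubic_symbol_mult[OF q(1,2) has has]
  have "prime_cubic_symbol q (4 * (z * z)) = \<omega> ^ (2 * l)"
    using prime_cubic_symbol_mult(1)[OF q(1,2) s4(2) zz(2)] zz(1) s4(1) z
    by (simp add: mult_2 power_add)
  moreover have "prime_cubic_symbol q (4 * (z * z)) = \<omega> ^ 0"
  proof (rule prime_cubic_symbol_eqI(1)[OF q(1,2)])
    have "of_nat q dvd cubic_power q (4 * z\<^sup>2) - cubic_power q (of_int n)"
      by (rule cubic_power_cong[OF sq])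
    from dvd_add[OF this cubic_power_of_int[OF q(1,2) n]]
    show "of_nat q dvd cubic_power q (4 * (z * z)) - \<omega> ^ 0" by (simp add: power2_eq_square)
  qed
  ultimately have "of_nat q dvd \<omega> ^ (2 * l) - \<omega> ^ 0" by simp
  from omega_power_cong_mod[OF q(1,2) this] have "l mod 3 = 0" unfolding cong_def by presburger
  then show ?thesis using z omega_power_mod[of l] by simp
qed

text \<open>Because (1 + 3 u) (1 + 3 v) = 1 + 3 (u + v) modulo 9, the exponents at the prime factors
  add up to the same expression in n.\<close>

lemma cubic_symbol_eq_omega_power:
  assumes "n > 0"
    and "\<And>q. prime q \<Longrightarrow> q dvd n \<Longrightarrow> q \<noteq> 3 \<and> prime_cubic_symbol q z = \<omega> ^ (i * ((q\<^sup>2 - 1) div 3))"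
  shows "cubic_symbol n z = \<omega> ^ (i * ((n\<^sup>2 - 1) div 3)) \<and> \<not> 3 dvd n"
  using assms
proof (induction n rule: prime_divisors_induct)
  case (factor p n)
  then have n: "n > 0" and p0: "p > 0" by (auto simp: prime_gt_0_nat)
  have IH: "cubic_symbol n z = \<omega> ^ (i * ((n\<^sup>2 - 1) div 3))" "\<not> 3 dvd n"
    using factor n by auto
  have p: "p \<noteq> 3" "prime_cubic_symbol p z = \<omega> ^ (i * ((p\<^sup>2 - 1) div 3))"
    using factor by auto
  then have p3: "\<not> 3 dvd p" using factor primes_dvd_imp_eq[of 3 p] by auto
  obtain u where u: "p\<^sup>2 = 3 * u + 1" using square_mod_3_nat[OF p3] by blast
  obtain v where v: "n\<^sup>2 = 3 * v + 1" using square_mod_3_nat[OF IH(2)] by blast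
  have "(p * n)\<^sup>2 - 1 = 3 * (3 * (u * v) + u + v)"
    by (simp add: power_mult_distrib u v algebra_simps)
  then have e: "((p * n)\<^sup>2 - 1) div 3 = 3 * (u * v) + u + v" by simp
  have "cubic_symbol (p * n) z = \<omega> ^ (i * u + i * v)"
    using IH p u v factor n p0
    by (simp add: cubic_symbol_mult_left cubic_symbol_prime power_add)
  also have "\<dots> = \<omega> ^ (i * (((p * n)\<^sup>2 - 1) div 3))"
  proof (rule omega_power_cong)
    have "i * (((p * n)\<^sup>2 - 1) div 3) = 3 * (i * (u * v)) + (i * u + i * v)"
      unfolding e by (simp add: algebra_simps)
    then show "[i * u + i * v = i * (((p * n)\<^sup>2 - 1) div 3)] (mod 3)"
      by (simp add: cong_def)
  qed
  finally show ?case using p3 IH(2) by (simp add: prime_dvd_mult_iff)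
qed (auto simp del: One_nat_def simp: cubic_symbol_one[unfolded One_nat_def])

text \<open>Here \<open>Eis A K\<close> is a unit modulo 3 because T is prime to 3, and every such
  unit is plus or minus a power of omega. The untwisted case 3 | K is recorded because it is the one
  that \<open>norm_exponent_mod_3\<close> leaves out.\<close>

lemma primary_twist:
  assumes "\<not> 3 dvd T" "K - T = 2 * A"
  obtains i where "primary (\<omega> ^ i * Eis A K)" "3 dvd K \<Longrightarrow> i = 0"
proof -
  have "3 dvd K \<or> 3 dvd A - K \<or> 3 dvd A" using assms by presburger
  then consider "3 dvd K" | "\<not> 3 dvd K" "3 dvd A - K" | "\<not> 3 dvd K" "3 dvd A" by blast
  then show ?thesis
  proof cases
    case 1
    then have "\<not> 3 dvd A" using assms by presburger
    with 1 show ?thesis using that[of 0] by (simp add: primary_def)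
  next
    case 2
    then show ?thesis using that[of 1] by (simp add: primary_def)
  next
    case 3
    then have "\<not> 3 dvd K - A" by presburger
    with 3 show ?thesis using that[of 2] by (simp add: primary_def omega_2)
  qed
qed

lemma four_power_mod_9: "[4 ^ j = 1 + 3 * int j] (mod 9)"
proof (induction j)
  case (Suc j)
  have "[4 * 4 ^ j = 4 * (1 + 3 * int j)] (mod 9)" using Suc by (rule cong_scalar_left)
  also have "[4 * (1 + 3 * int j) = 1 + 3 * int (Suc j)] (mod 9)"
    by (simp add: cong_iff_dvd_diff algebra_simps)
  finally show ?case by simp
qed simp

text \<open>This is the exponent that a twist by omega contributes to the comparison of symbols.
  With h^2 = 1 + 3 eta, the condition on k gives eta = -kappa modulo 3, and the norm equation modulo
  9 gives j = 2 (eta + xi) modulo 3.\<close>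

lemma norm_exponent_mod_3:
  fixes x k k1 x1 h D y e \<kappa> \<xi> :: int
  assumes "[k\<^sup>2 = 1] (mod 9)" "k = h * k1" "x = h * x1" "k1\<^sup>2 = 3 * \<kappa> + 1" "x1\<^sup>2 = 3 * \<xi> + 1"
    and h: "\<not> 3 dvd h" and D: "D mod 3 = 1" and y: "\<not> 3 dvd y"
    and e: "e\<^sup>2 = 1" and N: "x\<^sup>2 + 3 * D * y\<^sup>2 = e * 2 ^ (j + 2)"
  shows "3 dvd int j + 2 * \<kappa> - 2 * \<xi>"
proof -
  obtain \<eta> where \<eta>: "h\<^sup>2 = 3 * \<eta> + 1" using square_mod_3[OF h] by blast
  obtain v where v: "y\<^sup>2 = 3 * v + 1" using square_mod_3[OF y] by blast
  obtain w where w: "D = 3 * w + 1" using D by (metis div_mult_mod_eq mult.commute)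
  have "k\<^sup>2 = 9 * (\<eta> * \<kappa>) + 3 * (\<eta> + \<kappa>) + 1"
    unfolding assms(2) power_mult_distrib \<eta> assms(4) by (simp add: algebra_simps)
  moreover have "3 dvd s" if "(9 * c + 3 * s + 1) mod 9 = 1" for c s :: int
    using that by presburger
  ultimately have 1: "3 dvd \<eta> + \<kappa>" using assms(1) unfolding cong_def by simp
  have x2: "x\<^sup>2 = 9 * (\<eta> * \<xi>) + 3 * (\<eta> + \<xi>) + 1"
    unfolding assms(3) power_mult_distrib \<eta> assms(5) by (simp add: algebra_simps)
  have "x\<^sup>2 + 3 * D * y\<^sup>2 = 4 + 3 * (\<eta> + \<xi>) + 9 * (\<eta> * \<xi> + 3 * (w * v) + w + v)"
    unfolding x2 w v by (simp add: algebra_simps)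
  then obtain c where c: "e * 2 ^ (j + 2) = 4 + 3 * (\<eta> + \<xi>) + 9 * c" using N by metis
  have "((2::int) ^ j)\<^sup>2 = 4 ^ j" by (simp add: power2_eq_square flip: power_mult_distrib)
  \<comment> \<open>Squaring removes the sign e and replaces 2^j by 4^j, which is linear in j modulo
    9.\<close>
  then have "16 * 4 ^ j = (e * 2 ^ (j + 2))\<^sup>2"
    using e by (simp add: power_mult_distrib power_add)
  also have "\<dots> = 16 + 24 * (\<eta> + \<xi>) + 9 * ((\<eta> + \<xi>)\<^sup>2 + 8 * c + 6 * (\<eta> + \<xi>) * c + 9 * c\<^sup>2)"
    unfolding c by (simp add: power2_eq_square algebra_simps)
  finally have "(16 * 4 ^ j) mod 9 = (16 + 24 * (\<eta> + \<xi>)) mod (9::int)"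
    by (metis mod_mult_self2)
  moreover have "(16 * 4 ^ j) mod 9 = (16 * (1 + 3 * int j)) mod (9::int)"
    using cong_scalar_left[OF four_power_mod_9, of 16] by (simp add: cong_def)
  ultimately have "(16 + 24 * (\<eta> + \<xi>)) mod 9 = (16 * (1 + 3 * int j)) mod 9" by simp
  then have "9 dvd 24 * (\<eta> + \<xi>) - 48 * int j" by (simp add: mod_eq_dvd_iff algebra_simps)
  then have "3 dvd 8 * (\<eta> + \<xi>) - 16 * int j" by presburger
  with 1 show ?thesis by presburger
qed

lemma enorm_omega_power [simp]: "enorm (\<omega> ^ i) = 1"
  by (induction i) auto

theorem power_of_two_norm:
  fixes D t k M x y e :: int
  assumes D: "D * t\<^sup>2 = k\<^sup>2 - 4 * M ^ 3" and M: "odd M" "3 dvd M"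
    and k: "odd k" "[k\<^sup>2 = 1] (mod 9)" "coprime M k"
    and xy: "odd x" "odd y" and e: "e\<^sup>2 = 1"
    and N: "x\<^sup>2 + 3 * D * y\<^sup>2 = e * 2 ^ (j + 2)"
  shows "3 dvd j"
proof (cases "j = 0")
  case j: False
  have t: "odd t"
  proof
    assume "even t"
    then have "even (k\<^sup>2 - 4 * M ^ 3)" unfolding D[symmetric] by simp
    then show False using k by simp
  qed
  have k3: "\<not> 3 dvd k"
  proof
    assume "3 dvd k"
    then have "3 dvd k\<^sup>2" by (simp add: power2_eq_square)
    then show False using k(2) unfolding cong_def by presburger
  qed
  obtain M' where M': "M = 3 * M'" using M by blast
  obtain u where u: "k\<^sup>2 = 3 * u + 1" using square_mod_3[OF k3] by blast
  have Dt: "D * t\<^sup>2 = 3 * (u - 4 * (9 * M' ^ 3)) + 1"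
    unfolding D M' u by (simp add: power_mult_distrib)
  have t3: "\<not> 3 dvd t"
  proof
    assume "3 dvd t"
    then have "3 dvd D * t\<^sup>2" by (simp add: power2_eq_square)
    then show False using Dt by presburger
  qed
  have D3: "D mod 3 = 1"
  proof -
    obtain v where "t\<^sup>2 = 3 * v + 1" using square_mod_3[OF t3] by blast
    then have "D = 3 * (u - 4 * (9 * M' ^ 3) - D * v) + 1" using Dt by (simp add: algebra_simps)
    then show ?thesis by presburger
  qed
  have e': "e = 1 \<or> e = -1" using e by (simp add: power2_eq_1_iff)
  have x3: "\<not> 3 dvd x"
  proof
    assume "3 dvd x"
    then have "3 dvd x\<^sup>2 + 3 * D * y\<^sup>2" by (simp add: power2_eq_square)
    then have "3 dvd (2::int) ^ (j + 2)" unfolding N using e' by auto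
    then show False using prime_dvd_power[of "3::int" 2 "j + 2"] by simp
  qed
  have cop_xy: "coprime x y"
  proof (rule coprimeI)
    fix c assume c: "c dvd x" "c dvd y"
    then have "c dvd x\<^sup>2 + 3 * D * y\<^sup>2" by (simp add: power2_eq_square)
    then have "c dvd 2 ^ (j + 2)" unfolding N using e' by auto
    moreover have "odd c" using c xy by auto
    then have "coprime c (2 ^ (j + 2))" unfolding coprime_power_right_iff by simp
    ultimately show "is_unit c" by (metis coprime_common_divisor dvd_refl)
  qed
  have cop_kt: "coprime k t"
  proof (rule coprimeI)
    fix c assume c: "c dvd k" "c dvd t"
    have "4 * M ^ 3 = k\<^sup>2 - D * t\<^sup>2" using D by simp
    then have "c dvd (2 * 2) * M ^ 3" using c by (simp add: power2_eq_square)
    moreover have "odd c" using c k by auto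
    then have "coprime c (2 * 2)" unfolding coprime_mult_right_iff by simp
    moreover have "coprime c M" using c k(3) by (meson coprime_commute coprime_divisors dvd_refl)
    ultimately show "is_unit c"
      by (metis coprime_common_divisor coprime_mult_right_iff coprime_power_right_iff dvd_refl)
  qed
  have nz: "k \<noteq> 0" "t \<noteq> 0" using k t by auto
  \<comment> \<open>Removing both gcds makes K and T coprime, so a prime dividing k1 or x1 cannot
    divide the norm (T^2 + 3 K^2) / 4 and has a symbol.\<close>
  define g where "g = gcd t y"
  define h where "h = gcd k x"
  obtain t1 y1 where ty: "t = t1 * g" "y = y1 * g" "coprime t1 y1"
    using gcd_coprime_exists[of t y] nz unfolding g_def by auto
  obtain k1 x1 where kx: "k = k1 * h" "x = x1 * h" "coprime k1 x1"
    using gcd_coprime_exists[of k x] nz unfolding h_def by auto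
  have h0: "h \<noteq> 0" using kx nz by auto
  define K where "K = k1 * y1"
  define T where "T = t1 * x1"
  have "coprime k1 t1" using cop_kt ty kx by auto
  moreover have "coprime y1 x1" using cop_xy ty kx by (auto simp: coprime_commute)
  ultimately have cop_KT: "coprime K T"
    unfolding K_def T_def using ty kx by (auto simp: coprime_commute)
  have odds: "odd k1" "odd x1" "odd y1" "odd t1" "odd h" "odd g" using k t xy ty kx by auto
  have not3: "\<not> 3 dvd k1" "\<not> 3 dvd x1" "\<not> 3 dvd t1" "\<not> 3 dvd h" "\<not> 3 dvd g"
    using k3 x3 t3 ty kx by auto
  have T3: "\<not> 3 dvd T" using not3 by (simp add: T_def prime_dvd_mult_iff)
  have "even (K - T)" using odds by (simp add: K_def T_def)
  then obtain A where A: "K - T = 2 * A" by blast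
  \<comment> \<open>Since 1 + 2 omega = sqrt(-3), this is (K sqrt(-3) - T) / 2, the gamma of the
    overview divided by g h.\<close>
  define z where "z = Eis A K"
  obtain i where i: "primary (\<omega> ^ i * z)" "3 dvd K \<Longrightarrow> i = 0"
    using primary_twist[OF T3 A] unfolding z_def by blast
  define w where "w = \<omega> ^ i * z"
  have enorm_w: "enorm w = enorm z" by (simp add: w_def)
  have norm4: "4 * enorm z = T\<^sup>2 + 3 * K\<^sup>2"
  proof -
    have "2 * A - K = - T" using A by simp
    then show ?thesis unfolding four_enorm z_def by simp
  qed
  \<comment> \<open>Substituting \<open>D\<close> and \<open>N\<close> and cancelling 4 h^2 leaves a
    right side in which only k1, x1, M, e and the power of 2 remain.\<close>
  have norm: "D * g\<^sup>2 * enorm z = e * k1\<^sup>2 * 2 ^ j - M ^ 3 * x1\<^sup>2"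
  proof -
    have "h\<^sup>2 * (4 * (D * g\<^sup>2 * enorm z)) = h\<^sup>2 * D * g\<^sup>2 * (T\<^sup>2 + 3 * K\<^sup>2)"
      unfolding norm4[symmetric] by simp
    also have "\<dots> = D * t\<^sup>2 * x\<^sup>2 + 3 * D * y\<^sup>2 * k\<^sup>2"
      unfolding K_def T_def ty(1,2) kx(1,2) by (simp add: power2_eq_square algebra_simps)
    also have "\<dots> = k\<^sup>2 * (x\<^sup>2 + 3 * D * y\<^sup>2) - 4 * M ^ 3 * x\<^sup>2"
      unfolding D by (simp add: algebra_simps)
    also have "\<dots> = h\<^sup>2 * (4 * (e * k1\<^sup>2 * 2 ^ j - M ^ 3 * x1\<^sup>2))"
      unfolding N by (simp add: kx(1,2) power_mult_distrib algebra_simps)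
    finally show ?thesis using h0 by simp
  qed
  \<comment> \<open>Here j > 0 enters: on the right of \<open>norm\<close> the first term is even
    and the second odd. So 2 is an admissible modulus.\<close>
  have enorm_odd: "odd (enorm z)"
  proof
    assume "even (enorm z)"
    then have "even (e * k1\<^sup>2 * 2 ^ j - M ^ 3 * x1\<^sup>2)" unfolding norm[symmetric] by simp
    then show False using j M odds by simp
  qed
  have not_norm: "\<not> int q dvd enorm z \<and> \<not> int q dvd T \<and> q \<noteq> 2 \<and> q \<noteq> 3"
    if q: "prime q" "int q dvd k1" for q
  proof -
    have qK: "int q dvd K" using q by (simp add: K_def)
    then have T: "\<not> int q dvd T" using cop_KT q(1)
      by (metis coprime_common_divisor not_prime_unit prime_nat_int_transfer)
    have "\<not> int q dvd enorm z"
    proof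
      assume "int q dvd enorm z"
      then have "int q dvd T\<^sup>2 + 3 * K\<^sup>2" unfolding norm4[symmetric] by simp
      then have "int q dvd T\<^sup>2" using qK by (simp add: power2_eq_square dvd_add_left_iff)
      then show False using T q(1) prime_dvd_power by (metis prime_nat_int_transfer)
    qed
    moreover have "q \<noteq> 2" "q \<noteq> 3" using q odds not3 by auto
    ultimately show ?thesis using T by blast
  qed
  have not_norm': "\<not> int q dvd enorm z \<and> \<not> int q dvd - 3 * K\<^sup>2 \<and> q \<noteq> 2 \<and> q \<noteq> 3"
    if q: "prime q" "int q dvd x1" for q
  proof -
    have pq: "prime (int q)" using q by simp
    have qT: "int q dvd T" using q by (simp add: T_def)
    then have K: "\<not> int q dvd K" using cop_KT pq
      by (metis coprime_common_divisor not_prime_unit)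
    have q23: "q \<noteq> 2" "q \<noteq> 3" using q odds not3 by auto
    have "\<not> q dvd 3" using q q23 primes_dvd_imp_eq[of q 3] by auto
    then have "\<not> int q dvd 3" by presburger
    then have K3: "\<not> int q dvd 3 * K\<^sup>2" using K pq
      by (metis prime_dvd_mult_iff prime_dvd_power)
    have "\<not> int q dvd enorm z"
    proof
      assume "int q dvd enorm z"
      then have "int q dvd T\<^sup>2 + 3 * K\<^sup>2" unfolding norm4[symmetric] by simp
      then show False using qT K3 by (simp add: power2_eq_square dvd_add_right_iff)
    qed
    then show ?thesis using K3 q23 by simp
  qed
  have rec: "reciprocal w" using reciprocal_primary i(1) by (simp add: w_def)
  have has_z: "has_cubic_symbol q z" if "prime q" "q \<noteq> 3" "\<not> int q dvd enorm z" for q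
  proof -
    have "has_cubic_symbol q w" using rec that unfolding reciprocal_def enorm_w by blast
    then have "has_cubic_symbol q (\<omega> ^ (2 * i) * w)"
      using that prime_cubic_symbol_omega_power prime_cubic_symbol_mult by blast
    \<comment> \<open>The factor omega^(2 i) completes the twist to omega^(3 i) = 1.\<close>
    moreover have "\<omega> ^ (2 * i) * w = \<omega> ^ (3 * i) * z" by (simp add: w_def flip: power_add mult.assoc)
    ultimately show ?thesis by (simp add: power_mult)
  qed
  \<comment> \<open>Modulo K this reads 4 z^2 = T^2, modulo T it reads 4 z^2 = -3 K^2; both values
    are rational, as \<open>prime_cubic_symbol_eq_1\<close> requires.\<close>
  have two_z: "4 * z\<^sup>2 = of_int (T\<^sup>2) - of_int K * (2 * of_int T * (1 + 2 * \<omega>) + 3 * of_int K)"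
  proof -
    have "2 * z = of_int K * (1 + 2 * \<omega>) - of_int T"
      using A by (simp add: eis_eq_iff z_def)
    then have "(2 * z)\<^sup>2 = (of_int K * (1 + 2 * \<omega>) - of_int T)\<^sup>2" by simp
    then show ?thesis by (simp add: eis_eq_iff power2_eq_square algebra_simps)
  qed
  have symbol_z: "prime_cubic_symbol q z = 1" if q: "prime q" "int q dvd k1 \<or> int q dvd x1" for q
    using q(2)
  proof
    assume "int q dvd k1"
    note nn = not_norm[OF q(1) this]
    have "int q dvd K" using \<open>int q dvd k1\<close> by (simp add: K_def)
    then have "of_nat q dvd (of_int K :: eis)" by (simp add: of_nat_dvd_eis)
    moreover have "4 * z\<^sup>2 - of_int (T\<^sup>2) = of_int K * - (2 * of_int T * (1 + 2 * \<omega>) + 3 * of_int K)"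
      unfolding two_z by (simp add: algebra_simps)
    ultimately have "of_nat q dvd 4 * z\<^sup>2 - of_int (T\<^sup>2)" by (metis dvd_mult2)
    moreover have "\<not> int q dvd T\<^sup>2" using nn q(1) prime_dvd_power by (metis prime_nat_int_transfer)
    ultimately show ?thesis using prime_cubic_symbol_eq_1 q nn has_z by blast
  next
    assume "int q dvd x1"
    note nn = not_norm'[OF q(1) this]
    have "int q dvd T" using \<open>int q dvd x1\<close> by (simp add: T_def)
    then have "of_nat q dvd (of_int T :: eis)" by (simp add: of_nat_dvd_eis)
    moreover have "4 * z\<^sup>2 - of_int (- 3 * K\<^sup>2) = of_int T * (of_int T - of_int K * 2 * (1 + 2 * \<omega>))"
      unfolding two_z by (simp add: power2_eq_square algebra_simps)
    ultimately have "of_nat q dvd 4 * z\<^sup>2 - of_int (- 3 * K\<^sup>2)" by (metis dvd_mult2)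
    then show ?thesis using prime_cubic_symbol_eq_1 q nn has_z by blast
  qed
  have symbol_w: "prime_cubic_symbol q w = \<omega> ^ (i * ((q\<^sup>2 - 1) div 3))"
    if q: "prime q" "int q dvd k1 \<or> int q dvd x1" for q
  proof -
    have "q \<noteq> 3" "\<not> int q dvd enorm z" using not_norm not_norm' q by blast+
    then show ?thesis unfolding w_def
      using prime_cubic_symbol_mult(1)[OF q(1)] prime_cubic_symbol_omega_power[OF q(1)] has_z q(1)
        symbol_z[OF q] by simp
  qed
  define k2 where "k2 = nat \<bar>k1\<bar>"
  define x2 where "x2 = nat \<bar>x1\<bar>"
  have k2: "k2 > 0" "int k2 ^ 2 = k1\<^sup>2" and x2: "x2 > 0" "int x2 ^ 2 = x1\<^sup>2"
    using odds by (auto simp: k2_def x2_def)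
  have dvd_k2: "q dvd k2 \<longleftrightarrow> int q dvd k1" and dvd_x2: "q dvd x2 \<longleftrightarrow> int q dvd x1" for q
    by (auto simp: k2_def x2_def nat_dvd_iff dvd_nat_abs_iff simp flip: int_dvd_int_iff)
  have sk: "cubic_symbol k2 w = \<omega> ^ (i * ((k2\<^sup>2 - 1) div 3)) \<and> \<not> 3 dvd k2"
    using symbol_w not_norm k2 by (intro cubic_symbol_eq_omega_power) (auto simp: dvd_k2)
  have sx: "cubic_symbol x2 w = \<omega> ^ (i * ((x2\<^sup>2 - 1) div 3)) \<and> \<not> 3 dvd x2"
    using symbol_w not_norm' x2 by (intro cubic_symbol_eq_omega_power) (auto simp: dvd_x2)
  \<comment> \<open>K is odd, so modulo 2 z is omega or 1 + omega, and the latter is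
    omega^2.\<close>
  obtain l where l: "l = 1 \<or> l = 2" "of_nat 2 dvd z - \<omega> ^ l"
  proof (cases "even A")
    case True
    then have "of_nat 2 dvd z - \<omega> ^ 1" using odds
      unfolding of_nat_dvd_eis by (simp add: z_def K_def)
    then show ?thesis using that by blast
  next
    case False
    then have "of_nat 2 dvd z - \<omega> ^ 2" using odds
      unfolding of_nat_dvd_eis by (simp add: z_def K_def omega_2)
    then show ?thesis using that by blast
  qed
  have s2: "cubic_symbol 2 w = \<omega> ^ (i + l)"
  proof -
    \<comment> \<open>For q = 2 the exponents in \<open>cubic_power\<close> are 1 and 0, so the
      symbol is the residue of w itself.\<close>
    have "cubic_power 2 w - \<omega> ^ (i + l) = \<omega> ^ i * (z - \<omega> ^ l)"
      by (simp add: cubic_power_def w_def power_add algebra_simps)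
    then have "of_nat 2 dvd cubic_power 2 w - \<omega> ^ (i + l)" using l(2) by (metis dvd_mult)
    from prime_cubic_symbol_eqI(1)[OF _ _ this] show ?thesis by (simp add: cubic_symbol_prime)
  qed
  have adm_r: "admissible (2 ^ j * k2\<^sup>2) w"
    unfolding admissible_def
  proof (intro conjI allI impI; (elim conjE)?)
    show "0 < 2 ^ j * k2\<^sup>2" using k2 by simp
    fix q :: nat assume q: "prime q" "q dvd 2 ^ j * k2\<^sup>2"
    then have "q dvd 2 \<or> q dvd k2" by (metis prime_dvd_mult_iff prime_dvd_power)
    then have "q = 2 \<or> int q dvd k1" using q(1) primes_dvd_imp_eq[of q 2] dvd_k2 by auto
    then have "q \<noteq> 3 \<and> \<not> int q dvd enorm w" unfolding enorm_w using not_norm[OF q(1)] enorm_odd by auto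
    then show "q \<noteq> 3" "\<not> int q dvd enorm w" by blast+
  qed
  have adm_s: "admissible (x2\<^sup>2) w"
    unfolding admissible_def
  proof (intro conjI allI impI; (elim conjE)?)
    show "0 < x2\<^sup>2" using x2 by simp
    fix q :: nat assume q: "prime q" "q dvd x2\<^sup>2"
    then have "int q dvd x1" using prime_dvd_power dvd_x2 by blast
    from not_norm'[OF q(1) this] show "q \<noteq> 3" "\<not> int q dvd enorm w" unfolding enorm_w by blast+
  qed
  \<comment> \<open>Multiplying \<open>norm\<close> by e moves the sign into the cube, as e^2 = 1
    and e^3 = e.\<close>
  have "w dvd of_int (int (2 ^ j * k2\<^sup>2) - (e * M) ^ 3 * int (x2\<^sup>2))"
  proof -
    have "w dvd of_int (enorm w)" by (metis dvd_triv_left mult_ecnj)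
    then have "w dvd of_int (e * (D * g\<^sup>2)) * of_int (enorm w)" by (rule dvd_mult)
    then have "w dvd of_int (e * (D * g\<^sup>2 * enorm z))" by (simp add: enorm_w mult.assoc)
    also have "e * (D * g\<^sup>2 * enorm z) = int (2 ^ j * k2\<^sup>2) - (e * M) ^ 3 * int (x2\<^sup>2)"
      unfolding norm using e' by (auto simp: k2 x2 algebra_simps)
    finally show ?thesis .
  qed
  then have "cubic_symbol (2 ^ j * k2\<^sup>2) w = cubic_symbol (x2\<^sup>2) w"
    using rec adm_r adm_s unfolding reciprocal_def by blast
  then have eq: "\<omega> ^ ((i + l) * j + i * ((k2\<^sup>2 - 1) div 3) * 2) = \<omega> ^ (i * ((x2\<^sup>2 - 1) div 3) * 2)"
    using k2 x2 sk sx s2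
    by (simp add: cubic_symbol_mult_left cubic_symbol_power power_add power_mult)
  obtain \<kappa> where \<kappa>: "k2\<^sup>2 = 3 * \<kappa> + 1" using square_mod_3_nat sk by blast
  obtain \<xi> where \<xi>: "x2\<^sup>2 = 3 * \<xi> + 1" using square_mod_3_nat sx by blast
  have "[(i + l) * j + i * \<kappa> * 2 = i * \<xi> * 2] (mod 3)"
    using omega_power_cong_mod[of 2 "(i + l) * j + i * \<kappa> * 2" "i * \<xi> * 2"] eq by (simp add: \<kappa> \<xi>)
  then have "[int ((i + l) * j + i * \<kappa> * 2) = int (i * \<xi> * 2)] (mod int 3)"
    by (simp only: cong_int_iff)
  then have dvd: "3 dvd int l * int j + int i * (int j + 2 * int \<kappa> - 2 * int \<xi>)"
    by (simp add: cong_iff_dvd_diff algebra_simps)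
  \<comment> \<open>Either there is no twist and i = 0, or y is prime to 3 and the coefficient of i
    is a multiple of 3.\<close>
  have "3 dvd int l * int j"
  proof (cases "3 dvd K")
    case True
    then show ?thesis using dvd i(2) by simp
  next
    case False
    have "\<not> 3 dvd y" using False not3 by (auto simp: ty K_def prime_dvd_mult_iff)
    have "k1\<^sup>2 = 3 * int \<kappa> + 1" "x1\<^sup>2 = 3 * int \<xi> + 1"
      using k2(2) x2(2) arg_cong[OF \<kappa>, of int] arg_cong[OF \<xi>, of int] by simp_all
    from norm_exponent_mod_3[OF k(2) _ _ this not3(4) D3 \<open>\<not> 3 dvd y\<close> e N]
    have "3 dvd int j + 2 * int \<kappa> - 2 * int \<xi>" using kx by (simp add: mult.commute)
    then show ?thesis using dvd by (meson dvd_add_left_iff dvd_mult)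
  qed
  then show ?thesis using l(1) by auto presburger+
qed simp

section \<open>Integers of the quadratic field\<close>

lemma unit_if_powers_dvd:
  fixes s e :: int
  assumes "e \<noteq> 0" "\<And>i. s ^ i dvd e"
  shows "is_unit s"
proof (rule ccontr)
  assume "\<not> is_unit s"
  then have "finite {n. s ^ n dvd e}" using assms(1) by (intro finite_divisor_powers)
  moreover have "{n. s ^ n dvd e} = UNIV" using assms(2) by auto
  ultimately show False by simp
qed

lemma Rats_coprime_fraction:
  fixes q :: rat
  obtains r s :: int where "q = of_int r / of_int s" "s > 0" "coprime r s"
  by (cases q) (auto simp: Fract_of_int_quotient)

text \<open>In lowest terms n^i has denominator s^i, so every power of s divides the fixed
  e.\<close>

lemma Ints_if_bounded_powers:
  fixes n :: rat and e :: int
  assumes "e \<noteq> 0" "\<And>i. of_int e * n ^ i \<in> \<int>"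
  shows "n \<in> \<int>"
proof -
  obtain r s where n: "n = of_int r / of_int s" "s > 0" "coprime r s" by (rule Rats_coprime_fraction)
  have "s ^ i dvd e" for i
  proof -
    obtain c where "of_int e * n ^ i = of_int c" using assms(2) by (auto elim: Ints_cases)
    then have "(of_int (e * r ^ i) :: rat) = of_int (c * s ^ i)"
      using n by (simp add: power_divide field_simps)
    then have "e * r ^ i = c * s ^ i" by (simp only: of_int_eq_iff)
    then have "s ^ i dvd e * r ^ i" by simp
    moreover have "coprime (s ^ i) (r ^ i)" using n(3) by (simp add: coprime_commute)
    ultimately show ?thesis by (simp add: coprime_dvd_mult_left_iff)
  qed
  then have "is_unit s" using unit_if_powers_dvd assms(1) by blast
  then have "s = 1" using n(2) by simp
  then show ?thesis using n(1) by simp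
qed

text \<open>\<open>v i\<close> is the sequence of traces of the powers of an element with trace \<open>v 1\<close> and norm \<open>n\<close>.\<close>

lemma Ints_if_bounded_traces:
  fixes v :: "nat \<Rightarrow> rat" and n e :: int
  assumes e: "e \<noteq> 0" "\<And>i. of_int e * v i \<in> \<int>" and v0: "v 0 = 2"
    and rec: "\<And>i. v (Suc (Suc i)) = v 1 * v (Suc i) - of_int n * v i"
  shows "v 1 \<in> \<int>"
proof -
  obtain r s where v1: "v 1 = of_int r / of_int s" "s > 0" "coprime r s" by (rule Rats_coprime_fraction)
  \<comment> \<open>The numbers s^i v i are integers congruent to r^i modulo s, hence prime to s, so
    nothing cancels in the denominator. The congruence starts at index 1, because v 0 is 2.\<close>
  have "(\<exists>w. of_int s ^ i * v i = of_int w) \<and>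
      (\<exists>w. of_int s ^ Suc i * v (Suc i) = of_int w \<and> [w = r ^ Suc i] (mod s))" for i
  proof (induction i)
    case 0
    have "of_int s ^ 0 * v 0 = of_int 2" "of_int s ^ Suc 0 * v (Suc 0) = of_int r"
      using v0 v1 by simp_all
    then show ?case by (metis cong_refl power_one_right One_nat_def)
  next
    case (Suc i)
    then obtain w w' where w: "of_int s ^ i * v i = of_int w" "of_int s ^ Suc i * v (Suc i) = of_int w'"
      "[w' = r ^ Suc i] (mod s)" by blast
    have "of_int s ^ Suc (Suc i) * v (Suc (Suc i)) =
        (of_int s * v 1) * (of_int s ^ Suc i * v (Suc i)) - of_int (n * s * s) * (of_int s ^ i * v i)"
      unfolding rec by (simp add: algebra_simps)
    also have "\<dots> = of_int (r * w' - n * s * s * w)"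
      unfolding w(1,2) using v1 by simp
    finally have 1: "of_int s ^ Suc (Suc i) * v (Suc (Suc i)) = of_int (r * w' - n * s * s * w)" .
    have "[r * w' - s * (n * s * w) = r * r ^ Suc i - 0] (mod s)"
      by (intro cong_diff cong_scalar_left w(3)) (simp add: cong_def)
    then have "[r * w' - n * s * s * w = r ^ Suc (Suc i)] (mod s)" by (simp add: mult_ac)
    with 1 w(2) show ?case by blast
  qed
  then have s: "\<exists>w. of_int s ^ Suc i * v (Suc i) = of_int w \<and> [w = r ^ Suc i] (mod s)" for i by blast
  have "s ^ i dvd e" for i
  proof (cases i)
    case (Suc k)
    obtain w where w: "of_int s ^ i * v i = of_int w" "[w = r ^ i] (mod s)" using s[of k] Suc by blast
    obtain c where c: "of_int e * v i = of_int c" using e(2) by (auto elim: Ints_cases)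
    have "of_int (e * w) = of_int s ^ i * (of_int e * v i)" using w(1) by (simp flip: w(1))
    also have "\<dots> = of_int (s ^ i * c)" unfolding c by simp
    finally have "s ^ i dvd e * w" by (metis dvd_triv_left of_int_eq_iff)
    moreover have "coprime (r ^ i) s" using v1(3) by simp
    then have "coprime w s" using w(2) by (metis cong_imp_coprime cong_sym)
    then have "coprime (s ^ i) w" by (simp add: coprime_commute)
    ultimately show ?thesis by (simp add: coprime_dvd_mult_left_iff)
  qed simp
  then have "is_unit s" using unit_if_powers_dvd e(1) by blast
  then have "s = 1" using v1(2) by simp
  then show ?thesis using v1(1) by simp
qed

text \<open>The condition modulo 8 gives the integers their form (x + y sqrt(d)) / 2 and makes 2
  split. Exact divisibility of d by 3 makes sqrt(d) irrational.\<close>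

locale quadratic =
  fixes d :: int
  assumes sqf: "squarefree d" and d_mod: "d mod 8 = 1" and d3: "3 dvd d"
begin

definition \<delta> :: complex where "\<delta> = csqrt (of_int d)"

definition elt :: "int \<Rightarrow> int \<Rightarrow> complex" where "elt x y = (of_int x + of_int y * \<delta>) / 2"

abbreviation R where "R \<equiv> quadratic_integers d"
abbreviation \<O> where "\<O> \<equiv> carrier R"

lemma delta_square: "\<delta> * \<delta> = of_int d"
  unfolding \<delta>_def by (metis power2_csqrt power2_eq_square)

lemma delta_irrational: "\<delta> \<noteq> of_rat q"
proof
  assume q: "\<delta> = of_rat q"
  obtain r s where rs: "q = of_int r / of_int s" "s > 0" "coprime r s" by (rule Rats_coprime_fraction)
  have "of_rat (q * q) = (of_rat (of_int d) :: complex)"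
    using delta_square q by (simp add: of_rat_mult)
  then have "q * q = of_int d" by (simp only: of_rat_eq_iff)
  then have "of_int (r * r) = (of_int (d * s * s) :: rat)" using rs by (simp add: field_simps)
  then have eq: "r * r = d * s * s" by (simp only: of_int_eq_iff)
  then have "3 dvd r * r" using d3 by simp
  then have r3: "3 dvd r" by (simp add: prime_dvd_mult_iff)
  then obtain r' where r': "r = 3 * r'" by blast
  obtain d' where d': "d = 3 * d'" using d3 by blast
  have "\<not> 3 dvd d'"
  proof
    assume "3 dvd d'"
    then have "3\<^sup>2 dvd d" unfolding d' by auto
    then show False using squarefreeD[OF sqf, of 3] by simp
  qed
  moreover have "3 * (r' * r') = d' * s * s" using eq unfolding r' d' by simp
  then have "3 dvd d' * s * s" by (metis dvd_triv_left)
  ultimately have "3 dvd s" by (simp add: prime_dvd_mult_iff)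
  then show False using r3 rs(3) coprime_common_divisor[of r s 3] by simp
qed

lemma rational_coords_unique:
  assumes "of_rat a + of_rat b * \<delta> = of_rat a' + of_rat b' * \<delta>"
  shows "a = a' \<and> b = b'"
proof -
  have eq: "of_rat (b - b') * \<delta> = of_rat (a' - a)"
    using assms by (simp add: of_rat_diff algebra_simps)
  have "b = b'"
  proof (rule ccontr)
    assume "b \<noteq> b'"
    then have "\<delta> = of_rat ((a' - a) / (b - b'))"
      using eq by (simp add: of_rat_divide field_simps)
    then show False using delta_irrational by blast
  qed
  then show ?thesis using eq by simp
qed

lemma elt_rat: "elt x y = of_rat (of_int x / 2) + of_rat (of_int y / 2) * \<delta>"
  by (simp add: elt_def of_rat_divide field_simps)

lemma elt_eq_iff: "elt x y = elt x' y' \<longleftrightarrow> x = x' \<and> y = y'"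
  unfolding elt_rat using rational_coords_unique by fastforce

lemma elt_add: "elt x y + elt x' y' = elt (x + x') (y + y')"
  by (simp add: elt_def field_simps)

lemma elt_mult:
  assumes "2 * X = x * x' + d * (y * y')" "2 * Y = x * y' + y * x'"
  shows "elt x y * elt x' y' = elt X Y"
proof -
  have "4 * (elt x y * elt x' y') =
      of_int (x * x') + of_int (y * y') * (\<delta> * \<delta>) + of_int (x * y' + y * x') * \<delta>"
    unfolding elt_def by (simp add: field_simps)
  also have "\<dots> = of_int (x * x' + d * (y * y')) + of_int (x * y' + y * x') * \<delta>"
    unfolding delta_square by simp
  also have "\<dots> = 4 * elt X Y" unfolding assms[symmetric] by (simp add: elt_def field_simps)
  finally show ?thesis by simp
qed

lemma of_int_elt: "of_int n = elt (2 * n) 0"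
  by (simp add: elt_def)

lemma elt_norm: "4 * (elt x y * elt x (- y)) = of_int (x\<^sup>2 - d * y\<^sup>2)"
  unfolding elt_def using delta_square by (simp add: power2_eq_square field_simps)

text \<open>This subgroup Z + Z sqrt(d) measures denominators: z is integral exactly when some fixed
  nonzero integer carries all its powers into it.\<close>

definition lattice :: "complex set" where
  "lattice = {of_int x + of_int y * \<delta> | x y :: int. True}"

lemma lattice_add: "u \<in> lattice \<Longrightarrow> v \<in> lattice \<Longrightarrow> u + v \<in> lattice"
  unfolding lattice_def
  by clarsimp (metis (no_types, opaque_lifting) add.assoc add.left_commute distrib_right of_int_add)

lemma lattice_scale: "u \<in> lattice \<Longrightarrow> of_int c * u \<in> lattice"
  unfolding lattice_def
  by clarsimp (metis (no_types, opaque_lifting) distrib_left mult.assoc of_int_mult)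

lemma lattice_0: "0 \<in> lattice"
  unfolding lattice_def by (auto intro!: exI[of _ 0])

lemma lattice_sum: "(\<And>i. i \<in> A \<Longrightarrow> f i \<in> lattice) \<Longrightarrow> sum f A \<in> lattice"
  by (induction A rule: infinite_finite_induct) (auto simp: lattice_0 lattice_add)

lemma rat_in_lattice: "\<exists>e. e > 0 \<and> of_int e * (of_rat a + of_rat b * \<delta>) \<in> lattice"
proof -
  obtain r s where a: "a = of_int r / of_int s" "s > 0" by (rule Rats_coprime_fraction)
  obtain r' s' where b: "b = of_int r' / of_int s'" "s' > 0" by (rule Rats_coprime_fraction)
  have a': "of_rat a * of_int s = (of_int r :: complex)" and b': "of_rat b * of_int s' = (of_int r' :: complex)"
    using a b by (simp_all add: of_rat_divide)
  have "of_int (s * s') * (of_rat a + of_rat b * \<delta>) =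
      of_rat a * of_int s * of_int s' + of_rat b * of_int s' * of_int s * \<delta>"
    by (simp add: algebra_simps)
  also have "\<dots> = of_int (r * s') + of_int (r' * s) * \<delta>" unfolding a' b' by simp
  finally have "of_int (s * s') * (of_rat a + of_rat b * \<delta>) = of_int (r * s') + of_int (r' * s) * \<delta>" .
  then have "of_int (s * s') * (of_rat a + of_rat b * \<delta>) \<in> lattice" unfolding lattice_def by blast
  then show ?thesis using a(2) b(2) by (metis mult_pos_pos)
qed

lemma quadratic_field_mult:
  "(of_rat a + of_rat b * \<delta>) * (of_rat a' + of_rat b' * \<delta>) =
   of_rat (a * a' + of_int d * (b * b')) + of_rat (a * b' + b * a') * \<delta>"
proof -
  have "(of_rat a + of_rat b * \<delta>) * (of_rat a' + of_rat b' * \<delta>) =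
     of_rat a * of_rat a' + of_rat b * of_rat b' * (\<delta> * \<delta>) +
     (of_rat a * of_rat b' + of_rat b * of_rat a') * \<delta>" by (simp add: algebra_simps)
  then show ?thesis unfolding delta_square by (simp add: of_rat_add of_rat_mult mult_ac)
qed

lemma quadratic_field_iff: "z \<in> quadratic_field d \<longleftrightarrow> (\<exists>a b. z = of_rat a + of_rat b * \<delta>)"
  by (auto simp: quadratic_field_def \<delta>_def)

lemma quadratic_field_power: "z \<in> quadratic_field d \<Longrightarrow> z ^ n \<in> quadratic_field d"
proof (induction n)
  case 0
  have "(1::complex) = of_rat 1 + of_rat 0 * \<delta>" by simp
  then show ?case unfolding quadratic_field_iff by (metis power_0)
next
  case (Suc n)
  then show ?case unfolding quadratic_field_iff power_Suc using quadratic_field_mult by metis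
qed

text \<open>Bounded denominators of the powers of z bound those of their norms and traces, so norm
  and trace of z are integers, and square-freeness of d controls the remaining coordinate. Stated
  for denominators, it serves both algebraic integers and multipliers of ideals.\<close>

lemma bounded_powers_imp_elt:
  assumes z: "z \<in> quadratic_field d" and e: "e \<noteq> 0" "\<And>i. of_int e * z ^ i \<in> lattice"
  shows "\<exists>x y. z = elt x y \<and> even (x - y)"
proof -
  obtain a b where ab: "z = of_rat a + of_rat b * \<delta>" using z quadratic_field_iff by blast
  \<comment> \<open>\<open>A i\<close> and \<open>B i\<close> are the coordinates of z^i; its trace
    is 2 \<open>A i\<close>.\<close>
  define f where "f = rec_nat (1, 0) (\<lambda>i (u, v). (a * u + of_int d * (b * v), a * v + b * u))"
  define A where "A i = fst (f i)" for i
  define B where "B i = snd (f i)" for i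
  have A0: "A 0 = 1" "B 0 = 0" by (simp_all add: A_def B_def f_def)
  have AS: "A (Suc i) = a * A i + of_int d * (b * B i)" "B (Suc i) = a * B i + b * A i" for i
    by (simp_all add: A_def B_def f_def split: prod.split)
  have zi: "z ^ i = of_rat (A i) + of_rat (B i) * \<delta>" for i
  proof (induction i)
    case (Suc i)
    then show ?case unfolding power_Suc AS by (simp add: ab quadratic_field_mult)
  qed (simp add: A0)
  have int: "of_int e * A i \<in> \<int> \<and> of_int e * B i \<in> \<int>" for i
  proof -
    obtain x y :: int where "of_int e * z ^ i = of_int x + of_int y * \<delta>"
      using e(2)[of i] unfolding lattice_def by blast
    then have "of_rat (of_int e * A i) + of_rat (of_int e * B i) * \<delta> =
        of_rat (of_int x) + of_rat (of_int y) * \<delta>"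
      unfolding zi by (simp add: of_rat_mult algebra_simps)
    from rational_coords_unique[OF this] show ?thesis by simp
  qed
  define N where "N = a * a - of_int d * (b * b)"
  have norm: "A i * A i - of_int d * (B i * B i) = N ^ i" for i
  proof (induction i)
    case (Suc i)
    have "A (Suc i) * A (Suc i) - of_int d * (B (Suc i) * B (Suc i)) =
      N * (A i * A i - of_int d * (B i * B i))"
      unfolding AS N_def by (simp add: algebra_simps)
    then show ?case using Suc by simp
  qed (simp add: A0)
  have "of_int (e * e) * N ^ i \<in> \<int>" for i
  proof -
    have "of_int (e * e) * N ^ i = (of_int e * A i) * (of_int e * A i)
        - of_int d * ((of_int e * B i) * (of_int e * B i))"
      unfolding norm[symmetric] by (simp add: algebra_simps)
    then show ?thesis using int by (metis Ints_diff Ints_mult Ints_of_int)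
  qed
  then have "N \<in> \<int>" using Ints_if_bounded_powers[of "e * e" N] e(1) by simp
  then obtain n where n: "N = of_int n" by (auto elim: Ints_cases)
  have "2 * A 1 \<in> \<int>"
  proof (rule Ints_if_bounded_traces[of e "\<lambda>i. 2 * A i" n])
    show "of_int e * (2 * A i) \<in> \<int>" for i
      using int[of i] Ints_mult[of 2 "of_int e * A i"] by (simp add: mult.left_commute)
    show "2 * A (Suc (Suc i)) = 2 * A 1 * (2 * A (Suc i)) - of_int n * (2 * A i)" for i
      unfolding n[symmetric] N_def One_nat_def AS A0 by (simp add: algebra_simps)
  qed (use e(1) A0 in auto)
  then obtain x where x: "2 * a = of_int x" using A0 AS[of 0] by (auto elim: Ints_cases)
  obtain r s where b: "2 * b = of_int r / of_int s" "s > 0" "coprime r s" by (rule Rats_coprime_fraction)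
  \<comment> \<open>The integer d (2 b)^2 has a square denominator dividing the square-free d, so 2
    b is an integer.\<close>
  have "of_int d * (2 * b) * (2 * b) = of_int (x * x - 4 * n)"
    using x n unfolding N_def by (simp add: algebra_simps flip: x)
  then have "of_int (d * r * r) = (of_int ((x * x - 4 * n) * (s * s)) :: rat)"
    unfolding b(1) using b(2) by (simp add: field_simps)
  then have eq: "d * r * r = (x * x - 4 * n) * (s * s)" by (simp only: of_int_eq_iff)
  then have "s * s dvd d * (r * r)" by (simp add: mult.assoc)
  moreover have "coprime (s * s) (r * r)" using b(3) by (simp add: coprime_commute)
  ultimately have "s\<^sup>2 dvd d" by (simp add: coprime_dvd_mult_left_iff power2_eq_square)
  then have "s = 1" using squarefreeD[OF sqf, of s] b(2) by simp
  then have y: "2 * b = of_int r" and xr: "x * x - d * (r * r) = 4 * n" using b(1) eq by simp_all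
  have "z = elt x r" unfolding elt_rat ab using x y by (simp flip: x y)
  moreover have "even (x - r)"
  proof -
    have "even (x * x - d * (r * r))" using xr by simp
    moreover have "odd d" using d_mod by presburger
    ultimately show ?thesis by simp
  qed
  ultimately show ?thesis by blast
qed

text \<open>It is a root of X^2 - x X + n with n = (x^2 - d y^2) / 4, an integer because d = 1 mod
  4.\<close>

lemma algebraic_int_elt:
  assumes "even (x - y)"
  shows "algebraic_int (elt x y)"
proof -
  have "4 dvd x\<^sup>2 - d * y\<^sup>2"
  proof -
    obtain c where "x - y = 2 * c" using assms by blast
    then have c: "x = y + 2 * c" by simp
    define d' where "d' = 2 * (d div 8)"
    have d': "d = 4 * d' + 1" unfolding d'_def using d_mod by presburger
    have "x\<^sup>2 - d * y\<^sup>2 = 4 * (y * c + c * c - d' * (y * y))"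
      unfolding c d' by (simp add: power2_eq_square algebra_simps)
    then show ?thesis by simp
  qed
  then obtain n where n: "x\<^sup>2 - d * y\<^sup>2 = 4 * n" by blast
  let ?p = "[:of_int n, - of_int x, 1:] :: complex poly"
  have "poly ?p (elt x y) = 0"
  proof -
    have "elt x y * elt x (- y) = of_int n" using elt_norm[of x y] unfolding n by simp
    moreover have "elt x y + elt x (- y) = of_int x" by (simp add: elt_def field_simps)
    then have "of_int x = elt x y + elt x (- y)" by simp
    ultimately show ?thesis by (simp add: algebra_simps)
  qed
  moreover have "lead_coeff ?p = 1" by simp
  moreover have "\<forall>i. coeff ?p i \<in> \<int>"
    by (auto simp: coeff_pCons split: nat.split)
  ultimately show ?thesis unfolding algebraic_int.simps by blast
qed

text \<open>The monic equation expresses high powers through those below its degree, so a common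
  denominator of these finitely many serves for all.\<close>

lemma algebraic_int_bounded_powers:
  assumes "z \<in> quadratic_field d" "algebraic_int z"
  shows "\<exists>e. e > 0 \<and> (\<forall>i. of_int e * z ^ i \<in> lattice)"
proof -
  obtain p where p: "lead_coeff p = 1" "\<And>i. coeff p i \<in> \<int>" "poly p z = 0"
    using assms(2) unfolding algebraic_int.simps by blast
  define n where "n = degree p"
  have "\<exists>c. coeff p i = of_int c" for i using p(2) by (auto elim: Ints_cases)
  then obtain c where c: "\<And>i. coeff p i = of_int (c i)" by metis
  have "\<exists>e. e > 0 \<and> (\<forall>i<m. of_int e * z ^ i \<in> lattice)" for m
  proof (induction m)
    case 0
    show ?case by (intro exI[of _ 1]) simp
  next
    case (Suc m)
    then obtain e where e: "e > 0" "\<forall>i<m. of_int e * z ^ i \<in> lattice" by blast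
    obtain a b where "z ^ m = of_rat a + of_rat b * \<delta>"
      using quadratic_field_power[OF assms(1)] quadratic_field_iff by blast
    then obtain e' where e': "e' > 0" "of_int e' * z ^ m \<in> lattice" using rat_in_lattice by metis
    have "of_int (e * e') * z ^ i \<in> lattice" if "i < Suc m" for i
      using that e(2) e'(2) lattice_scale[of "of_int e * z ^ i" e'] lattice_scale[of "of_int e' * z ^ m" e]
      by (cases "i = m") (auto simp: mult_ac)
    then show ?case using e(1) e'(1) by (metis mult_pos_pos)
  qed
  then obtain e where e: "e > 0" "\<forall>i<n. of_int e * z ^ i \<in> lattice" by blast
  have "of_int e * z ^ i \<in> lattice" for i
  proof (induction i rule: less_induct)
    case (less i)
    show ?case
    proof (cases "i < n")
      case False
      have "0 = (\<Sum>j\<le>n. of_int (c j) * z ^ j)" using p(3) by (simp add: poly_altdef n_def c)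
      also have "\<dots> = z ^ n + (\<Sum>j<n. of_int (c j) * z ^ j)"
        using p(1) c[of n] by (simp add: lessThan_Suc_atMost[symmetric] n_def)
      finally have "z ^ n = - (\<Sum>j<n. of_int (c j) * z ^ j)"
        by (simp add: eq_neg_iff_add_eq_0)
      then have "of_int e * z ^ i = of_int e * z ^ (i - n) * - (\<Sum>j<n. of_int (c j) * z ^ j)"
        using False by (metis le_add_diff_inverse2 linorder_not_less mult.assoc power_add)
      also have "\<dots> = (\<Sum>j<n. of_int (- c j) * (of_int e * z ^ (i - n + j)))"
        by (simp add: sum_distrib_left sum_negf power_add mult_ac)
      also have "\<dots> \<in> lattice"
        using False by (intro lattice_sum lattice_scale less) auto
      finally show ?thesis .
    qed (use e in auto)
  qed
  then show ?thesis using e(1) by blast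
qed

lemma integers_iff: "z \<in> \<O> \<longleftrightarrow> (\<exists>x y. z = elt x y \<and> even (x - y))"
proof
  assume "z \<in> \<O>"
  then have z: "z \<in> quadratic_field d" "algebraic_int z" by (auto simp: quadratic_integers_def)
  from algebraic_int_bounded_powers[OF z] bounded_powers_imp_elt[OF z(1)]
  show "\<exists>x y. z = elt x y \<and> even (x - y)" by (metis less_irrefl)
next
  assume "\<exists>x y. z = elt x y \<and> even (x - y)"
  then show "z \<in> \<O>" using algebraic_int_elt
    by (auto simp: quadratic_integers_def quadratic_field_iff elt_rat)
qed

end

section \<open>Ideal classes and the primes above 2\<close>

text \<open>S is exhausted by cycles of g, and the length of each cycle is itself an exponent j to
  which the last assumption applies.\<close>

lemma card_dvd_if_cycle_lengths_dvd:
  assumes "inj g" "finite S" "g ` S \<subseteq> S"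
    and "\<And>x j. x \<in> S \<Longrightarrow> (g ^^ j) x = x \<Longrightarrow> m dvd j"
  shows "m dvd card S"
  using assms(2-)
proof (induction S rule: finite_psubset_induct)
  case (psubset S)
  show ?case
  proof (cases "S = {}")
    case False
    then obtain x where x: "x \<in> S" by blast
    have orb: "(g ^^ i) x \<in> S" for i using x psubset.prems(1) by (induction i) auto
    define r where "r = (LEAST n. n > 0 \<and> (g ^^ n) x = x)"
    have "finite {y. \<exists>n. y = (g ^^ n) x}" by (rule finite_subset[OF _ psubset.hyps]) (use orb in auto)
    then obtain n where "n > 0" "(g ^^ n) x = x" using funpow_inj_finite[OF assms(1)] by blast
    then have r: "r > 0" "(g ^^ r) x = x"
      unfolding r_def using LeastI[of "\<lambda>n. n > 0 \<and> (g ^^ n) x = x" n] by blast+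
    have min: "\<not> (n > 0 \<and> (g ^^ n) x = x)" if "n < r" for n
      using that not_less_Least unfolding r_def by blast
    have ne: "(g ^^ i) x \<noteq> (g ^^ j) x" if "i < j" "j < r" for i j
    proof
      assume "(g ^^ i) x = (g ^^ j) x"
      also have "\<dots> = (g ^^ i) ((g ^^ (j - i)) x)"
        using that by (metis add_diff_inverse_nat comp_apply funpow_add less_imp_not_less)
      finally have "(g ^^ (j - i)) x = x" using inj_fn[OF assms(1), of i] by (simp add: inj_eq)
      then show False using min[of "j - i"] that by (simp add: less_imp_diff_less)
    qed
    define C where "C = (\<lambda>i. (g ^^ i) x) ` {..<r}"
    have "inj_on (\<lambda>i. (g ^^ i) x) {..<r}"
      by (rule linorder_inj_onI) (use ne in auto)
    then have card_C: "card C = r" by (simp add: C_def card_image)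
    have C: "C \<subseteq> S" "x \<in> C" "finite C" using orb r(1) by (auto simp: C_def intro: image_eqI[of _ _ 0])
    have "g ` (S - C) \<subseteq> S - C"
    proof
      fix z assume "z \<in> g ` (S - C)"
      then obtain y where y: "y \<in> S" "y \<notin> C" "z = g y" by blast
      have "z \<notin> C"
      proof
        assume "z \<in> C"
        then obtain i where i: "i < r" "g y = (g ^^ i) x" using y by (auto simp: C_def)
        \<comment> \<open>The predecessor of the starting point x is the last point of the cycle,
          hence the two cases.\<close>
        obtain i' where i': "i' < r" "g y = (g ^^ Suc i') x"
        proof (cases i)
          case 0
          then show ?thesis using that[of "r - 1"] i r by auto
        next
          case (Suc i')
          then show ?thesis using that[of i'] i by auto
        qed
        then have "y = (g ^^ i') x" using assms(1) by (simp add: inj_eq)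
        then show False using y i' by (auto simp: C_def)
      qed
      then show "z \<in> S - C" using y psubset.prems(1) by blast
    qed
    then have "m dvd card (S - C)"
      using C x psubset.prems(2) by (intro psubset.IH) auto
    moreover have "m dvd card C" using psubset.prems(2)[OF x r(2)] card_C by simp
    moreover have "card S = card (S - C) + card C"
      using C psubset.hyps by (simp add: card_Diff_subset card_mono)
    ultimately show ?thesis by simp
  qed simp
qed

text \<open>This plays the part of the order of a group element dividing the group order: f acts on
  representatives and only has to permute the classes, without a product of classes.\<close>

lemma card_quotient_dvd:
  assumes eq: "equiv X r" and f: "f ` X \<subseteq> X"
    and iff: "\<And>x y. x \<in> X \<Longrightarrow> y \<in> X \<Longrightarrow> (f x, f y) \<in> r \<longleftrightarrow> (x, y) \<in> r"
    and cyc: "\<And>x j. x \<in> X \<Longrightarrow> ((f ^^ j) x, x) \<in> r \<Longrightarrow> m dvd j"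
  shows "m dvd card (X // r)"
proof (cases "finite (X // r)")
  case True
  \<comment> \<open>The identity outside the quotient makes g injective on the whole type.\<close>
  define g where "g C = (if C \<in> X // r then r `` {f (SOME x. x \<in> C)} else C)" for C
  have some: "(SOME y. y \<in> r `` {x}) \<in> X \<and> (x, SOME y. y \<in> r `` {x}) \<in> r" if "x \<in> X" for x
  proof -
    have "x \<in> r `` {x}" by (rule equiv_class_self[OF eq that])
    then have "(SOME y. y \<in> r `` {x}) \<in> r `` {x}" by (rule someI)
    then show ?thesis using eq unfolding equiv_def refl_on_def by auto
  qed
  have class_eq: "r `` {x} = r `` {y} \<longleftrightarrow> (x, y) \<in> r" if "x \<in> X" "y \<in> X" for x y
    using eq_equiv_class_iff[OF eq] that by blast
  have g: "g (r `` {x}) = r `` {f x}" if x: "x \<in> X" for x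
  proof -
    have "r `` {x} \<in> X // r" using x by (rule quotientI)
    then have "g (r `` {x}) = r `` {f (SOME y. y \<in> r `` {x})}" by (simp add: g_def)
    also have "\<dots> = r `` {f x}"
      using some[OF x] iff class_eq f x by (metis image_subset_iff)
    finally show ?thesis .
  qed
  have gX: "g ` (X // r) \<subseteq> X // r"
  proof (rule image_subsetI)
    fix C assume "C \<in> X // r"
    then obtain x where "x \<in> X" "C = r `` {x}" by (auto elim!: quotientE)
    then show "g C \<in> X // r" using g f by (auto intro!: quotientI)
  qed
  have "inj g"
  proof (rule injI)
    fix C D assume CD: "g C = g D"
    have "g C \<in> X // r \<longleftrightarrow> C \<in> X // r" for C using gX by (auto simp: g_def)
    then have "C \<in> X // r \<longleftrightarrow> D \<in> X // r" using CD by metis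
    then show "C = D"
    proof (cases "C \<in> X // r")
      case True
      then obtain x y where "x \<in> X" "C = r `` {x}" "y \<in> X" "D = r `` {y}"
        using \<open>C \<in> X // r \<longleftrightarrow> D \<in> X // r\<close> by (auto elim!: quotientE)
      then show ?thesis using CD g iff class_eq f by (metis image_subset_iff)
    next
      case False
      then show ?thesis using CD \<open>C \<in> X // r \<longleftrightarrow> D \<in> X // r\<close> by (simp add: g_def)
    qed
  qed
  then show ?thesis
  proof (rule card_dvd_if_cycle_lengths_dvd[OF _ True gX])
    fix C j assume C: "C \<in> X // r" "(g ^^ j) C = C"
    then obtain x where x: "x \<in> X" "C = r `` {x}" by (auto elim!: quotientE)
    have "(f ^^ j) x \<in> X \<and> (g ^^ j) (r `` {x}) = r `` {(f ^^ j) x}"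
      using x g f by (induction j) auto
    then show "m dvd j" using C x class_eq cyc by metis
  qed
\<comment> \<open>An infinite quotient has \<open>card\<close> equal to 0, which m divides.\<close>
qed simp

context quadratic
begin

section \<open>The ring of integers, its ideals and their classes\<close>

lemma d_eq: obtains c where "d = 8 * c + 1"
  using d_mod by (metis div_mult_mod_eq mult.commute)

lemma elt_integers: "even (x - y) \<Longrightarrow> elt x y \<in> \<O>"
  unfolding integers_iff by blast

lemma integers_add: "u \<in> \<O> \<Longrightarrow> v \<in> \<O> \<Longrightarrow> u + v \<in> \<O>"
proof -
  assume "u \<in> \<O>" "v \<in> \<O>"
  then obtain x y x' y' where "u = elt x y" "even (x - y)" "v = elt x' y'" "even (x' - y')"
    unfolding integers_iff by blast
  then have "u + v = elt (x + x') (y + y')" "even (x + x' - (y + y'))" by (auto simp: elt_add)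
  then show ?thesis unfolding integers_iff by blast
qed

lemma integers_mult: "u \<in> \<O> \<Longrightarrow> v \<in> \<O> \<Longrightarrow> u * v \<in> \<O>"
proof -
  assume "u \<in> \<O>" "v \<in> \<O>"
  then obtain x y x' y' where uv: "u = elt x y" "even (x - y)" "v = elt x' y'" "even (x' - y')"
    unfolding integers_iff by blast
  obtain c where "x - y = 2 * c" using uv by blast
  then have c: "x = y + 2 * c" by simp
  obtain c' where "x' - y' = 2 * c'" using uv by blast
  then have c': "x' = y' + 2 * c'" by simp
  obtain b where b: "d = 8 * b + 1" by (rule d_eq)
  have "u * v = elt (y * y' + y * c' + c * y' + 2 * (c * c') + 8 * (b * (y * y')) div 2)
      (y * y' + c * y' + y * c')"
    unfolding uv by (rule elt_mult) (simp_all add: c c' b algebra_simps)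
  moreover have "even ((y * y' + y * c' + c * y' + 2 * (c * c') + 8 * (b * (y * y')) div 2) -
      (y * y' + c * y' + y * c'))" by simp
  ultimately show ?thesis unfolding integers_iff by blast
qed

lemma integers_of_int: "of_int n \<in> \<O>"
  unfolding of_int_elt by (rule elt_integers) simp

lemma integers_0: "0 \<in> \<O>" and integers_1: "1 \<in> \<O>" and integers_2: "2 \<in> \<O>"
  using integers_of_int[of 0] integers_of_int[of 1] integers_of_int[of 2] by simp_all

lemma integers_uminus: "u \<in> \<O> \<Longrightarrow> - u \<in> \<O>"
  using integers_mult[OF integers_of_int[of "-1"], of u] by simp

lemma integers_power: "u \<in> \<O> \<Longrightarrow> u ^ n \<in> \<O>"
  by (induction n) (auto intro: integers_mult integers_1)

lemma integers_field: "u \<in> \<O> \<Longrightarrow> u \<in> quadratic_field d"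
  by (simp add: quadratic_integers_def)

lemma ring_ops [simp]:
  "x \<otimes>\<^bsub>R\<^esub> y = x * y" "x \<oplus>\<^bsub>R\<^esub> y = x + y" "\<zero>\<^bsub>R\<^esub> = 0" "\<one>\<^bsub>R\<^esub> = 1"
  by (simp_all add: quadratic_integers_def)

lemma cring: "cring R"
proof (rule cringI)
  show "abelian_group R"
  proof (rule abelian_groupI)
    show "\<exists>y\<in>\<O>. y \<oplus>\<^bsub>R\<^esub> x = \<zero>\<^bsub>R\<^esub>" if "x \<in> \<O>" for x
      using integers_uminus[OF that] by (intro bexI[of _ "- x"]) auto
  qed (auto intro: integers_add simp: integers_0)
  show "comm_monoid R"
    by (rule comm_monoidI) (auto intro: integers_mult simp: integers_1)
qed (auto simp: algebra_simps)

interpretation cring R by (rule cring)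

lemma ideal_iff: "ideal I R \<longleftrightarrow> I \<subseteq> \<O> \<and> 0 \<in> I \<and> (\<forall>x\<in>I. \<forall>y\<in>I. x + y \<in> I) \<and>
    (\<forall>x\<in>\<O>. \<forall>y\<in>I. x * y \<in> I)"
proof
  assume "ideal I R"
  then interpret ideal I R .
  show "I \<subseteq> \<O> \<and> 0 \<in> I \<and> (\<forall>x\<in>I. \<forall>y\<in>I. x + y \<in> I) \<and> (\<forall>x\<in>\<O>. \<forall>y\<in>I. x * y \<in> I)"
    using a_subset zero_closed a_closed I_l_closed by auto
next
  assume I: "I \<subseteq> \<O> \<and> 0 \<in> I \<and> (\<forall>x\<in>I. \<forall>y\<in>I. x + y \<in> I) \<and> (\<forall>x\<in>\<O>. \<forall>y\<in>I. x * y \<in> I)"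
  have inv: "\<ominus>\<^bsub>R\<^esub> x = - x" if "x \<in> \<O>" for x
    using minus_equality[of "- x" x] that integers_uminus by simp
  show "ideal I R"
  proof (rule idealI)
    show "subgroup I (add_monoid R)"
    proof
      show "inv\<^bsub>add_monoid R\<^esub> x \<in> I" if "x \<in> I" for x
      proof -
        have "- 1 * x \<in> I" using I that integers_uminus[OF integers_1] by blast
        then show ?thesis using inv[of x] I that by (auto simp: a_inv_def)
      qed
    qed (use I in auto)
    show "a \<in> I \<Longrightarrow> x \<in> \<O> \<Longrightarrow> a \<otimes>\<^bsub>R\<^esub> x \<in> I" for a x
      using I by (metis mult.commute ring_ops(1))
  qed (use I in \<open>auto intro: ring_axioms\<close>)
qed

abbreviation X where "X \<equiv> nonzero_ideals R"

lemma X_iff: "I \<in> X \<longleftrightarrow> I \<subseteq> \<O> \<and> 0 \<in> I \<and> (\<forall>x\<in>I. \<forall>y\<in>I. x + y \<in> I) \<and>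
    (\<forall>x\<in>\<O>. \<forall>y\<in>I. x * y \<in> I) \<and> (\<exists>x\<in>I. x \<noteq> 0)"
  unfolding nonzero_ideals_def ideal_iff by auto

lemma X_D:
  assumes "I \<in> X"
  shows "I \<subseteq> \<O>" "0 \<in> I" "\<And>x y. x \<in> I \<Longrightarrow> y \<in> I \<Longrightarrow> x + y \<in> I"
    "\<And>x y. x \<in> \<O> \<Longrightarrow> y \<in> I \<Longrightarrow> x * y \<in> I" "\<exists>x\<in>I. x \<noteq> 0"
  using assms unfolding X_iff by auto

lemma class_rel_iff: "(I, J) \<in> ideal_class_rel R \<longleftrightarrow>
    I \<in> X \<and> J \<in> X \<and> (\<exists>a\<in>\<O> - {0}. \<exists>b\<in>\<O> - {0}. (*) a ` I = (*) b ` J)"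
proof -
  have "a <#\<^bsub>R\<^esub> I = (*) a ` I" for a I by (auto simp: l_coset_def)
  then show ?thesis by (simp add: ideal_class_rel_def)
qed

lemma class_relI:
  assumes "I \<in> X" "J \<in> X" "a \<in> \<O> - {0}" "b \<in> \<O> - {0}" "(*) a ` I = (*) b ` J"
  shows "(I, J) \<in> ideal_class_rel R"
proof -
  have "\<exists>b\<in>\<O> - {0}. (*) a ` I = (*) b ` J" using assms(5,4) by (rule bexI)
  then have "\<exists>a\<in>\<O> - {0}. \<exists>b\<in>\<O> - {0}. (*) a ` I = (*) b ` J" using assms(3) by (rule bexI)
  with assms(1,2) show ?thesis by (simp only: class_rel_iff simp_thms)
qed

lemma class_relE:
  assumes "(I, J) \<in> ideal_class_rel R"
  obtains a b where "I \<in> X" "J \<in> X" "a \<in> \<O> - {0}" "b \<in> \<O> - {0}" "(*) a ` I = (*) b ` J"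
  using assms unfolding class_rel_iff by (elim conjE bexE) rule

lemma image_mult: "(*) (a::complex) ` (*) b ` I = (*) (a * b) ` I"
  by (auto simp: image_image mult.assoc)

lemma equiv_class_rel: "equiv X (ideal_class_rel R)"
proof (rule equivI)
  show "ideal_class_rel R \<subseteq> X \<times> X" by (auto simp: class_rel_iff)
  show "refl_on X (ideal_class_rel R)"
  proof (rule refl_onI)
    have "1 \<in> \<O> - {0}" using integers_1 by simp
    then show "(I, I) \<in> ideal_class_rel R" if "I \<in> X" for I using that class_relI by blast
  qed
  show "sym (ideal_class_rel R)"
  proof (rule symI)
    fix I J assume "(I, J) \<in> ideal_class_rel R"
    then obtain a b where "I \<in> X" "J \<in> X" "a \<in> \<O> - {0}" "b \<in> \<O> - {0}" "(*) a ` I = (*) b ` J"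
      by (rule class_relE)
    then show "(J, I) \<in> ideal_class_rel R" by (intro class_relI[of J I b a]) simp_all
  qed
  show "trans (ideal_class_rel R)"
  proof (rule transI)
    fix I J L assume IJ: "(I, J) \<in> ideal_class_rel R" and JL: "(J, L) \<in> ideal_class_rel R"
    obtain a b where 1: "I \<in> X" "a \<in> \<O> - {0}" "b \<in> \<O> - {0}" "(*) a ` I = (*) b ` J"
      using IJ by (rule class_relE)
    obtain a' b' where 2: "L \<in> X" "a' \<in> \<O> - {0}" "b' \<in> \<O> - {0}" "(*) a' ` J = (*) b' ` L"
      using JL by (rule class_relE)
    have "(*) (a' * a) ` I = (*) (b * b') ` L"
    proof -
      have "(*) (a' * a) ` I = (*) a' ` (*) b ` J" unfolding 1(4)[symmetric] image_mult ..
      also have "\<dots> = (*) b ` (*) a' ` J" unfolding image_mult by (simp add: mult.commute)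
      finally show ?thesis unfolding 2(4) image_mult .
    qed
    moreover have "a' * a \<in> \<O> - {0}" "b * b' \<in> \<O> - {0}" using 1 2 integers_mult by auto
    ultimately show "(I, L) \<in> ideal_class_rel R" by (intro class_relI 1 2)
  qed
qed

text \<open>For a nonzero c in I all products w^i c stay in I, so four times the norm of c is a
  common denominator of the powers of w.\<close>

lemma multiplier_in_integers:
  assumes I: "I \<in> X" and w: "w \<in> quadratic_field d" "\<And>x. x \<in> I \<Longrightarrow> w * x \<in> I"
  shows "w \<in> \<O>"
proof -
  obtain c where c: "c \<in> I" "c \<noteq> 0" "c \<in> \<O>" using X_D(1,5)[OF I] by blast
  obtain x y where xy: "c = elt x y" "even (x - y)" using c(3) integers_iff by blast
  define c' where "c' = elt x (- y)"
  have c': "c' \<in> \<O>" unfolding c'_def using xy(2) by (intro elt_integers) simp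
  define n where "n = x\<^sup>2 - d * y\<^sup>2"
  have n: "4 * (c * c') = of_int n" unfolding n_def xy c'_def by (rule elt_norm)
  have "c' \<noteq> 0"
    using c(2) elt_eq_iff[of x "-y" 0 0] elt_eq_iff[of x y 0 0] unfolding xy c'_def
    by (auto simp: elt_def)
  then have n0: "n \<noteq> 0" using n c(2) by auto
  have "of_int n * w ^ i \<in> lattice" for i
  proof -
    have "w ^ i * c \<in> I" using w(2) c(1) by (induction i) (auto simp: mult.assoc)
    then have "c' * (w ^ i * c) \<in> \<O>" using c' X_D(1,4)[OF I] by blast
    then obtain X Y where XY: "c' * (w ^ i * c) = elt X Y" using integers_iff by blast
    have "of_int n * w ^ i = 4 * (c' * (w ^ i * c))" unfolding n[symmetric] by simp
    also have "\<dots> = of_int (2 * X) + of_int (2 * Y) * \<delta>" unfolding XY by (simp add: elt_def algebra_simps)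
    finally show ?thesis unfolding lattice_def by blast
  qed
  from bounded_powers_imp_elt[OF w(1) n0 this] show ?thesis unfolding integers_iff .
qed

lemma quadratic_field_closed:
  "u \<in> quadratic_field d \<Longrightarrow> v \<in> quadratic_field d \<Longrightarrow> u * v \<in> quadratic_field d"
  unfolding quadratic_field_iff using quadratic_field_mult by metis

lemma quadratic_field_divide:
  assumes "u \<in> \<O>" "v \<in> \<O>" "v \<noteq> 0"
  shows "u / v \<in> quadratic_field d"
proof -
  obtain x y where xy: "v = elt x y" "even (x - y)" using assms(2) integers_iff by blast
  define v' where "v' = elt x (- y)"
  have v': "v' \<in> \<O>" unfolding v'_def using xy(2) by (intro elt_integers) simp
  have "v' \<noteq> 0"
    using assms(3) elt_eq_iff[of x "-y" 0 0] elt_eq_iff[of x y 0 0] unfolding xy v'_def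
    by (auto simp: elt_def)
  define n where "n = x\<^sup>2 - d * y\<^sup>2"
  have n: "4 * (v * v') = of_int n" unfolding n_def xy v'_def by (rule elt_norm)
  have "u / v = (of_rat (4 / of_int n) + of_rat 0 * \<delta>) * (u * v')"
    using n \<open>v' \<noteq> 0\<close> assms(3) by (simp add: of_rat_divide flip: n)
  moreover have "of_rat (4 / of_int n) + of_rat 0 * \<delta> \<in> quadratic_field d"
    unfolding quadratic_field_iff by blast
  ultimately show ?thesis
    using quadratic_field_closed integers_field integers_mult assms(1) v' by metis
qed

section \<open>The action of the primes above 2 on ideals\<close>

definition \<pi> :: complex where "\<pi> = elt 1 1"
definition \<pi>' :: complex where "\<pi>' = elt 1 (- 1)"

lemma pi_integers: "\<pi> \<in> \<O>" "\<pi>' \<in> \<O>"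
  unfolding \<pi>_def \<pi>'_def by (intro elt_integers; simp)+

lemma pi_add: "\<pi> + \<pi>' = 1"
  by (simp add: \<pi>_def \<pi>'_def elt_add) (simp add: elt_def)

text \<open>The norm (1 - d) / 4 is even because d = 1 mod 8. With \<open>pi_add\<close> this makes
  (2, \<open>\<pi>\<close>) and (2, \<open>\<pi>'\<close>) comaximal ideals with product
  (2).\<close>

lemma pi_mult: obtains c where "\<pi> * \<pi>' = 2 * of_int c"
proof -
  obtain b where b: "d = 8 * b + 1" by (rule d_eq)
  have "\<pi> * \<pi>' = elt (- 4 * b) 0" unfolding \<pi>_def \<pi>'_def by (rule elt_mult) (auto simp: b)
  then show ?thesis using that[of "- b"] by (simp add: elt_def)
qed

text \<open>\<open>mix \<pi>\<close> is multiplication by the prime ideal \<open>(2, \<pi>)\<close> above \<open>2\<close>, and \<open>mix \<pi>'\<close> that by its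
  conjugate.\<close>

definition mix :: "complex \<Rightarrow> complex set \<Rightarrow> complex set" where
  "mix w I = {2 * a + w * b | a b. a \<in> I \<and> b \<in> I}"

lemma mix_scale: "mix w ((*) c ` I) = (*) c ` mix w I"
proof
  show "mix w ((*) c ` I) \<subseteq> (*) c ` mix w I"
  proof
    fix z assume "z \<in> mix w ((*) c ` I)"
    then obtain a b where ab: "a \<in> I" "b \<in> I" "z = 2 * (c * a) + w * (c * b)"
      unfolding mix_def by blast
    then have "z = c * (2 * a + w * b)" by (simp add: algebra_simps)
    then show "z \<in> (*) c ` mix w I" using ab unfolding mix_def by blast
  qed
  show "(*) c ` mix w I \<subseteq> mix w ((*) c ` I)"
  proof
    fix z assume "z \<in> (*) c ` mix w I"
    then obtain a b where ab: "a \<in> I" "b \<in> I" "z = c * (2 * a + w * b)"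
      unfolding mix_def by blast
    then have "z = 2 * (c * a) + w * (c * b)" by (simp add: algebra_simps)
    then show "z \<in> mix w ((*) c ` I)" using ab unfolding mix_def by blast
  qed
qed

lemma mixI: "a \<in> I \<Longrightarrow> b \<in> I \<Longrightarrow> z = 2 * a + w * b \<Longrightarrow> z \<in> mix w I"
  unfolding mix_def by blast

lemma mix_X:
  assumes I: "I \<in> X" and w: "w \<in> \<O>"
  shows "mix w I \<in> X"
  unfolding X_iff
proof (intro conjI ballI)
  show "mix w I \<subseteq> \<O>"
    using X_D(1)[OF I] w unfolding mix_def by (auto intro!: integers_add integers_mult integers_2)
  show "0 \<in> mix w I" by (rule mixI[of 0 _ 0]) (use X_D(2)[OF I] in auto)
  fix x assume "x \<in> mix w I"
  then obtain a b where ab: "a \<in> I" "b \<in> I" "x = 2 * a + w * b" unfolding mix_def by blast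
  show "x + y \<in> mix w I" if y: "y \<in> mix w I" for y
  proof -
    obtain a' b' where ab': "a' \<in> I" "b' \<in> I" "y = 2 * a' + w * b'" using y unfolding mix_def by blast
    show ?thesis
      by (rule mixI[of "a + a'" _ "b + b'"]) (use ab ab' X_D(3)[OF I] in \<open>auto simp: algebra_simps\<close>)
  qed
next
  fix x y assume x: "x \<in> \<O>" and "y \<in> mix w I"
  then obtain a b where ab: "a \<in> I" "b \<in> I" "y = 2 * a + w * b" unfolding mix_def by blast
  show "x * y \<in> mix w I"
    by (rule mixI[of "x * a" _ "x * b"]) (use x ab X_D(4)[OF I] in \<open>auto simp: distrib_left mult.left_commute\<close>)
next
  obtain x where "x \<in> I" "x \<noteq> 0" "0 \<in> I" using X_D(2,5)[OF I] by blast
  then show "\<exists>x\<in>mix w I. x \<noteq> 0" by (intro bexI[of _ "2 * x"] mixI[of x _ 0]) auto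
qed

text \<open>The products 4, 2 \<open>\<pi>\<close>, 2 \<open>\<pi>'\<close> and
  \<open>\<pi> * \<pi>'\<close> of generators are all multiples of 2, and 2 \<open>\<pi>\<close> + 2
  \<open>\<pi>'\<close> = 2 gives the converse inclusion.\<close>

lemma mix_mix:
  assumes I: "I \<in> X"
  shows "mix \<pi>' (mix \<pi> I) = (*) 2 ` I"
proof
  note I' = X_D(2-4)[OF I]
  obtain c where c: "\<pi> * \<pi>' = 2 * of_int c" by (rule pi_mult)
  show "mix \<pi>' (mix \<pi> I) \<subseteq> (*) 2 ` I"
  proof
    fix z assume "z \<in> mix \<pi>' (mix \<pi> I)"
    then obtain a b a' b' where *: "a \<in> I" "b \<in> I" "a' \<in> I" "b' \<in> I"
      "z = 2 * (2 * a + \<pi> * b) + \<pi>' * (2 * a' + \<pi> * b')" unfolding mix_def by blast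
    have "z = 2 * (2 * a + \<pi> * b + \<pi>' * a') + (\<pi> * \<pi>') * b'" unfolding *(5) by (simp add: algebra_simps)
    then have "z = 2 * (2 * a + \<pi> * b + \<pi>' * a' + of_int c * b')" unfolding c by (simp add: algebra_simps)
    moreover have "2 * a + \<pi> * b + \<pi>' * a' + of_int c * b' \<in> I"
      by (intro I' * pi_integers integers_2 integers_of_int)
    ultimately show "z \<in> (*) 2 ` I" by blast
  qed
  show "(*) 2 ` I \<subseteq> mix \<pi>' (mix \<pi> I)"
  proof
    fix z assume "z \<in> (*) 2 ` I"
    then obtain x where x: "x \<in> I" "z = 2 * x" by blast
    have "2 * (\<pi> * x) + \<pi>' * (2 * x) = (\<pi> + \<pi>') * (2 * x)" by (simp add: algebra_simps)
    then have "z = 2 * (\<pi> * x) + \<pi>' * (2 * x)" unfolding x(2) pi_add by simp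
    moreover have "\<pi> * x \<in> mix \<pi> I" by (rule mixI[OF I'(1) x(1)]) simp
    moreover have "2 * x \<in> mix \<pi> I" by (rule mixI[OF x(1) I'(1)]) simp
    ultimately show "z \<in> mix \<pi>' (mix \<pi> I)" using mixI by blast
  qed
qed

text \<open>Applying \<open>mix \<pi>'\<close> undoes \<open>mix \<pi>\<close> up to the scalar 2,
  which the class relation absorbs.\<close>

lemma mix_class_rel_iff:
  assumes "I \<in> X" "J \<in> X"
  shows "(mix \<pi> I, mix \<pi> J) \<in> ideal_class_rel R \<longleftrightarrow> (I, J) \<in> ideal_class_rel R"
proof
  assume "(mix \<pi> I, mix \<pi> J) \<in> ideal_class_rel R"
  then obtain a b where ab: "a \<in> \<O> - {0}" "b \<in> \<O> - {0}" "(*) a ` mix \<pi> I = (*) b ` mix \<pi> J"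
    by (rule class_relE)
  have "(*) a ` (*) 2 ` I = (*) b ` (*) 2 ` J"
    using arg_cong[OF ab(3), of "mix \<pi>'"] unfolding mix_scale mix_mix[OF assms(1)] mix_mix[OF assms(2)] .
  then have "(*) (a * 2) ` I = (*) (b * 2) ` J" unfolding image_mult .
  moreover have "a * 2 \<in> \<O> - {0}" "b * 2 \<in> \<O> - {0}" using ab integers_mult integers_2 by auto
  ultimately show "(I, J) \<in> ideal_class_rel R" by (intro class_relI assms)
next
  assume "(I, J) \<in> ideal_class_rel R"
  then obtain a b where ab: "a \<in> \<O> - {0}" "b \<in> \<O> - {0}" "(*) a ` I = (*) b ` J"
    by (rule class_relE)
  have eq: "(*) a ` mix \<pi> I = (*) b ` mix \<pi> J" using arg_cong[OF ab(3), of "mix \<pi>"] unfolding mix_scale .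
  show "(mix \<pi> I, mix \<pi> J) \<in> ideal_class_rel R"
    by (rule class_relI[OF _ _ ab(1,2) eq]) (intro mix_X pi_integers assms)+
qed

lemma mix_power_X: "I \<in> X \<Longrightarrow> w \<in> \<O> \<Longrightarrow> (mix w ^^ j) I \<in> X"
  by (induction j) (auto intro: mix_X)

lemma mix_power_scale: "(mix w ^^ j) ((*) c ` I) = (*) c ` (mix w ^^ j) I"
  by (induction j) (auto simp: mix_scale)

lemma mix_power_mem:
  assumes "I \<in> X" "w \<in> \<O>" "x \<in> I"
  shows "2 ^ j * x \<in> (mix w ^^ j) I" "w ^ j * x \<in> (mix w ^^ j) I"
proof -
  have "0 \<in> (mix w ^^ i) I" for i using mix_power_X[OF assms(1,2)] by (rule X_D(2))
  then show "2 ^ j * x \<in> (mix w ^^ j) I" "w ^ j * x \<in> (mix w ^^ j) I"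
    using assms(3) by (induction j)
      (auto intro: mixI[of "2 ^ i * x" _ 0 for i] mixI[of 0 _ "w ^ i * x" for i] simp: mult.assoc)
qed

lemma mix_power_mix_power: "I \<in> X \<Longrightarrow> (mix \<pi>' ^^ j) ((mix \<pi> ^^ j) I) = (*) (2 ^ j) ` I"
proof (induction j)
  case (Suc j)
  have "(mix \<pi>' ^^ Suc j) ((mix \<pi> ^^ Suc j) I) = (mix \<pi>' ^^ j) (mix \<pi>' (mix \<pi> ((mix \<pi> ^^ j) I)))"
    by (simp add: funpow_swap1)
  also have "\<dots> = (*) 2 ` (*) (2 ^ j) ` I"
    using Suc mix_power_X pi_integers by (simp add: mix_mix mix_power_scale)
  finally show ?case by (simp add: image_mult)
qed simp

text \<open>Modulo 2, w is idempotent, so its positive powers are congruent to w, and w is not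
  divisible by 2.\<close>

lemma power_pi_not_even:
  assumes "j > 0" "w = \<pi> \<or> w = \<pi>'" "x \<in> \<O>"
  shows "w ^ j \<noteq> 2 * x"
proof
  assume eq: "w ^ j = 2 * x"
  have w: "w \<in> \<O>" using assms(2) pi_integers by auto
  obtain c where c: "\<pi> * \<pi>' = 2 * of_int c" by (rule pi_mult)
  have "\<pi> * \<pi> = \<pi> * (\<pi> + \<pi>') - \<pi> * \<pi>'" "\<pi>' * \<pi>' = \<pi>' * (\<pi> + \<pi>') - \<pi> * \<pi>'"
    by (simp_all add: algebra_simps)
  then have ww: "w * w = w - 2 * of_int c" using assms(2) unfolding pi_add c by auto
  have pow: "\<exists>u\<in>\<O>. w ^ Suc i = w + 2 * u" for i
  proof (induction i)
    case 0
    then show ?case using integers_0 by (intro bexI[of _ 0]) auto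
  next
    case (Suc i)
    then obtain u where u: "u \<in> \<O>" "w ^ Suc i = w + 2 * u" by blast
    have "w ^ Suc (Suc i) = w + 2 * (w * u + of_int (- c))"
      using u(2) ww by (simp add: algebra_simps)
    then show ?case using integers_add[OF integers_mult[OF w u(1)] integers_of_int] by blast
  qed
  obtain i where "j = Suc i" using assms(1) gr0_conv_Suc by blast
  then obtain u where u: "u \<in> \<O>" "w ^ j = w + 2 * u" using pow[of i] by blast
  have "w = 2 * (x + - u)" using u eq by (simp add: algebra_simps)
  moreover have "x + - u \<in> \<O>" using integers_add[OF assms(3) integers_uminus[OF u(1)]] .
  then obtain p q where "x + - u = elt p q" using integers_iff by blast
  ultimately have "w = 2 * elt p q" by (simp only:)
  then have "w = elt (2 * p) (2 * q)" by (simp add: elt_def)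
  then have "1 = 2 * p" using assms(2) elt_eq_iff by (auto simp: \<pi>_def \<pi>'_def)
  then show False by presburger
qed

text \<open>In the application z and u generate the j-th powers of the two conjugate primes above 2.
  The last hypotheses keep both from being divisible by 2, which forces the norm of z to be plus or
  minus 2^j.\<close>

lemma norm_of_power_generator:
  assumes j: "j > 0" and z: "z \<in> \<O>" "u \<in> \<O>" "z * u = 2 ^ j"
    and v: "v \<in> \<O>" "\<pi> ^ j = z * v" "v' \<in> \<O>" "\<pi>' ^ j = u * v'"
  shows "\<exists>x y e. odd x \<and> odd y \<and> e\<^sup>2 = 1 \<and> x\<^sup>2 - d * y\<^sup>2 = e * 2 ^ (j + 2)"
proof -
  obtain x y where xy: "z = elt x y" "even (x - y)" using z(1) integers_iff by blast
  obtain x' y' where xy': "u = elt x' y'" "even (x' - y')" using z(2) integers_iff by blast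
  have norm4: "\<exists>N. x\<^sup>2 - d * y\<^sup>2 = 4 * N" if xy: "even (x - y)" for x y
  proof -
    obtain c where "x - y = 2 * c" using xy by blast
    then have c: "x = y + 2 * c" by simp
    obtain b where b: "d = 8 * b + 1" by (rule d_eq)
    have "x\<^sup>2 - d * y\<^sup>2 = 4 * (y * c + c * c - 2 * b * (y * y))"
      unfolding c b by (simp add: power2_eq_square algebra_simps)
    then show ?thesis by blast
  qed
  obtain N where N: "x\<^sup>2 - d * y\<^sup>2 = 4 * N" using norm4[OF xy(2)] by blast
  obtain N' where N': "x'\<^sup>2 - d * y'\<^sup>2 = 4 * N'" using norm4[OF xy'(2)] by blast
  define zc where "zc = elt x (- y)"
  define uc where "uc = elt x' (- y')"
  have zc: "zc \<in> \<O>" and uc: "uc \<in> \<O>"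
    unfolding zc_def uc_def using xy xy' by (intro elt_integers; simp)+
  have zN: "z * zc = of_int N" using elt_norm[of x y] N by (simp add: xy zc_def)
  have uN: "u * uc = of_int N'" using elt_norm[of x' y'] N' by (simp add: xy' uc_def)
  \<comment> \<open>The conjugation changing the sign of sqrt(d) is carried out in coordinates; it
    is complex conjugation only for d < 0.\<close>
  have prod: "zc * uc = 2 ^ j"
  proof -
    have eq4: "4 * (z * u) = of_int (x * x' + d * (y * y')) + of_int (x * y' + y * x') * \<delta>"
      "4 * (zc * uc) = of_int (x * x' + d * (y * y')) - of_int (x * y' + y * x') * \<delta>"
    proof -
      have "4 * (elt x y * elt x' y') =
        of_int (x * x') + of_int (y * y') * (\<delta> * \<delta>) + of_int (x * y' + y * x') * \<delta>" for x y x' y'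
        unfolding elt_def by (simp add: field_simps)
      note * = this[unfolded delta_square]
      show "4 * (z * u) = of_int (x * x' + d * (y * y')) + of_int (x * y' + y * x') * \<delta>"
        "4 * (zc * uc) = of_int (x * x' + d * (y * y')) - of_int (x * y' + y * x') * \<delta>"
        unfolding xy xy' zc_def uc_def * by (simp_all add: algebra_simps)
    qed
    have "elt (x * x' + d * (y * y')) (x * y' + y * x') = elt (4 * 2 ^ j) 0"
      using eq4(1) unfolding z(3) by (simp add: elt_def)
    then have "x * x' + d * (y * y') = 4 * 2 ^ j \<and> x * y' + y * x' = 0" unfolding elt_eq_iff .
    then have "4 * (zc * uc) = 4 * 2 ^ j" unfolding eq4(2) by simp
    then show ?thesis by simp
  qed
  have "(of_int (N * N') :: complex) = (z * u) * (zc * uc)" by (simp add: mult_ac flip: zN uN)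
  also have "\<dots> = of_int (2 ^ (2 * j))" unfolding z(3) prod by (simp add: mult_2 power_add)
  finally have NN: "N * N' = 2 ^ (2 * j)" by (simp only: of_int_eq_iff)
  then have "N dvd 2 ^ (2 * j)" by (metis dvd_triv_left)
  then obtain i where i: "i \<le> 2 * j" "normalize N = 2 ^ i"
    using divides_primepow[of "2::int" N "2 * j"] by auto
  define e where "e = sgn N"
  have N0: "N \<noteq> 0" using NN by auto
  then have e: "e\<^sup>2 = 1" "N = e * 2 ^ i"
    using i(2) by (auto simp: e_def sgn_if abs_if split: if_splits)
  have ee: "e * e = 1" using e by (simp add: power2_eq_square)
  have N'e: "N' = e * 2 ^ (2 * j - i)"
  proof -
    have "2 ^ i * (e * N') = 2 ^ i * 2 ^ (2 * j - i)" using NN e(2) i(1) by (simp add: mult_ac flip: power_add)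
    then have "e * N' = 2 ^ (2 * j - i)" by simp
    then have "e * e * N' = e * 2 ^ (2 * j - i)" by (simp add: mult.assoc)
    then show ?thesis using ee by simp
  qed
  have z_odd: "z \<noteq> 2 * t" if "t \<in> \<O>" for t
  proof
    assume "z = 2 * t"
    then have "\<pi> ^ j = 2 * (t * v)" using v(2) by simp
    then show False using power_pi_not_even[OF j _ integers_mult[OF that v(1)]] by blast
  qed
  have u_odd: "u \<noteq> 2 * t" if "t \<in> \<O>" for t
  proof
    assume "u = 2 * t"
    then have "\<pi>' ^ j = 2 * (t * v')" using v(4) by simp
    then show False using power_pi_not_even[OF j _ integers_mult[OF that v(3)]] by blast
  qed
  have conj_odd: "elt a b = 2 * elt (c::int) f \<Longrightarrow> elt a (- b) = 2 * elt c (- f)" for a b c f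
  proof -
    assume "elt a b = 2 * elt c f"
    then have "elt a b = elt (2 * c) (2 * f)" by (simp add: elt_def)
    then show ?thesis by (simp add: elt_eq_iff) (simp add: elt_def)
  qed
  have not_conj_odd: "elt a (- b) \<noteq> 2 * t" if "\<And>t. t \<in> \<O> \<Longrightarrow> elt a b \<noteq> 2 * t" "t \<in> \<O>" for a b t
  proof
    assume *: "elt a (- b) = 2 * t"
    obtain c f where cf: "t = elt c f" "even (c - f)" using \<open>t \<in> \<O>\<close> integers_iff by blast
    have "elt a b = 2 * elt c (- f)" using conj_odd[of a "- b" c f] * cf by simp
    moreover have "elt c (- f) \<in> \<O>" using cf by (intro elt_integers) simp
    ultimately show False using that(1) by blast
  qed
  \<comment> \<open>If i < j, then 2 divides the conjugate of u, and if j < i, that of z;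
    conjugating back contradicts \<open>u_odd\<close> or \<open>z_odd\<close>.\<close>
  have "i = j"
  proof (rule linorder_cases[of i j])
    assume ij: "i < j"
    have "2 ^ j * uc = z * of_int N'" using uN z(3) by (simp add: mult_ac flip: z(3))
    also have "of_int N' = (2::complex) ^ j * (2 * (2 ^ (j - i - 1) * of_int e))"
    proof -
      have "2 * j - i = j + (1 + (j - i - 1))" using ij by simp
      then have "(2::complex) ^ (2 * j - i) = 2 ^ j * (2 * 2 ^ (j - i - 1))"
        by (metis power_add power_one_right)
      then show ?thesis unfolding N'e by simp
    qed
    finally have "uc = 2 * (2 ^ (j - i - 1) * of_int e * z)" by (simp add: mult_ac)
    moreover have "2 ^ (j - i - 1) * of_int e * z \<in> \<O>"
      by (intro integers_mult integers_power integers_2 integers_of_int z)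
    ultimately show ?thesis using not_conj_odd u_odd unfolding uc_def xy' by blast
  next
    assume ij: "j < i"
    have "2 ^ j * zc = u * of_int N" using zN z(3) by (simp add: mult_ac flip: z(3))
    also have "of_int N = (2::complex) ^ j * (2 * (2 ^ (i - j - 1) * of_int e))"
    proof -
      have "i = j + (1 + (i - j - 1))" using ij by simp
      then have "(2::complex) ^ i = 2 ^ j * (2 * 2 ^ (i - j - 1))"
        by (metis power_add power_one_right)
      then show ?thesis unfolding e(2) by simp
    qed
    finally have "zc = 2 * (2 ^ (i - j - 1) * of_int e * u)" by (simp add: mult_ac)
    moreover have "2 ^ (i - j - 1) * of_int e * u \<in> \<O>"
      by (intro integers_mult integers_power integers_2 integers_of_int z)
    ultimately show ?thesis using not_conj_odd z_odd unfolding zc_def xy by blast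
  qed
  then have norm: "x\<^sup>2 - d * y\<^sup>2 = e * 2 ^ (j + 2)" using N e(2) by (simp add: power_add)
  \<comment> \<open>If x and y were even, j > 0 would make x1^2 - d y1^2 even, so x1 and y1 have
    equal parity and z / 2 is integral.\<close>
  have "odd x"
  proof
    assume "even x"
    then have "even y" using xy(2) by simp
    then obtain x1 y1 where xy1: "x = 2 * x1" "y = 2 * y1" using \<open>even x\<close> by (auto elim!: evenE)
    have "4 * (x1\<^sup>2 - d * y1\<^sup>2) = 4 * (e * 2 ^ j)" using norm unfolding xy1 by (simp add: power_add power_mult_distrib)
    then have "x1\<^sup>2 - d * y1\<^sup>2 = e * 2 ^ j" by simp
    then have "even (x1\<^sup>2 - d * y1\<^sup>2)" using j by (simp only:) simp
    moreover have "odd d" using d_mod by presburger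
    ultimately have "even (x1 - y1)" by simp
    then have "elt x1 y1 \<in> \<O>" unfolding integers_iff by blast
    moreover have "z = 2 * elt x1 y1" unfolding xy xy1 by (simp add: elt_def)
    ultimately show False using z_odd by blast
  qed
  moreover from this have "odd y" using xy(2) by simp
  ultimately show ?thesis using norm e(1) by blast
qed

theorem dvd_class_number:
  assumes "\<And>x y e j. odd x \<Longrightarrow> odd y \<Longrightarrow> e\<^sup>2 = 1 \<Longrightarrow> x\<^sup>2 - d * y\<^sup>2 = e * 2 ^ (j + 2) \<Longrightarrow> l dvd j"
  shows "l dvd class_number d"
  unfolding class_number_def ideal_classes_def
proof (rule card_quotient_dvd[OF equiv_class_rel])
  show "mix \<pi> ` X \<subseteq> X" using mix_X pi_integers by blast
  show "(mix \<pi> I, mix \<pi> J) \<in> ideal_class_rel R \<longleftrightarrow> (I, J) \<in> ideal_class_rel R"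
    if "I \<in> X" "J \<in> X" for I J using mix_class_rel_iff that by blast
  fix I j assume I: "I \<in> X" and rel: "((mix \<pi> ^^ j) I, I) \<in> ideal_class_rel R"
  show "l dvd j"
  proof (cases "j = 0")
    case False
    obtain a b where ab0: "a \<in> \<O> - {0}" "b \<in> \<O> - {0}" "(*) a ` (mix \<pi> ^^ j) I = (*) b ` I"
      using rel by (rule class_relE)
    then have ab: "a \<in> \<O>" "a \<noteq> 0" "b \<in> \<O>" "b \<noteq> 0" "(*) a ` (mix \<pi> ^^ j) I = (*) b ` I"
      by simp_all
    \<comment> \<open>The given relation says that b / a scales I to
      \<open>(mix \<pi> ^^ j) I\<close>. Acting with the conjugate prime shows that a 2^j / b scales
      I to \<open>(mix \<pi>' ^^ j) I\<close>.\<close>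
    have eq': "(*) (a * 2 ^ j) ` I = (*) b ` (mix \<pi>' ^^ j) I"
      using arg_cong[OF ab(5), of "mix \<pi>' ^^ j"]
      unfolding mix_power_scale mix_power_mix_power[OF I] image_mult .
    \<comment> \<open>If s I lies in t I, then s / t multiplies I into itself and is integral. All
      divisibilities between the generators are obtained from this.\<close>
    have O: "s / t \<in> \<O>" if "s \<in> \<O>" "t \<in> \<O>" "t \<noteq> 0" "\<And>x. x \<in> I \<Longrightarrow> s * x \<in> (*) t ` I" for s t
    proof (rule multiplier_in_integers[OF I quadratic_field_divide[OF that(1-3)]])
      fix x assume "x \<in> I"
      from that(4)[OF this] obtain y where "y \<in> I" "s * x = t * y" by blast
      then show "s / t * x \<in> I" using that(3) by (simp add: field_simps)
    qed
    have a2: "a * 2 ^ j \<in> \<O>" by (intro integers_mult integers_power ab integers_2)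
    have "a * 2 ^ j / b \<in> \<O>"
    proof (rule O)
      fix x assume "x \<in> I"
      from mix_power_mem(1)[OF I pi_integers(1) this, of j]
      have "a * (2 ^ j * x) \<in> (*) b ` I" unfolding ab(5)[symmetric] by blast
      then show "a * 2 ^ j * x \<in> (*) b ` I" by (simp add: mult.assoc)
    qed (use ab a2 in auto)
    moreover have "a * \<pi> ^ j / b \<in> \<O>"
    proof (rule O)
      fix x assume "x \<in> I"
      from mix_power_mem(2)[OF I pi_integers(1) this, of j]
      have "a * (\<pi> ^ j * x) \<in> (*) b ` I" unfolding ab(5)[symmetric] by blast
      then show "a * \<pi> ^ j * x \<in> (*) b ` I" by (simp add: mult.assoc)
    qed (use ab integers_mult integers_power pi_integers in auto)
    \<comment> \<open>This is b / a, written so that the conjugate relation \<open>eq'\<close>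
      applies.\<close>
    moreover have "b * 2 ^ j / (a * 2 ^ j) \<in> \<O>"
    proof (rule O)
      fix x assume "x \<in> I"
      from mix_power_mem(1)[OF I pi_integers(2) this, of j]
      have "b * (2 ^ j * x) \<in> (*) (a * 2 ^ j) ` I" unfolding eq' by blast
      then show "b * 2 ^ j * x \<in> (*) (a * 2 ^ j) ` I" by (simp add: mult.assoc)
    qed (use ab a2 integers_mult integers_power integers_2 in auto)
    moreover have "b * \<pi>' ^ j / (a * 2 ^ j) \<in> \<O>"
    proof (rule O)
      fix x assume "x \<in> I"
      from mix_power_mem(2)[OF I pi_integers(2) this, of j]
      have "b * (\<pi>' ^ j * x) \<in> (*) (a * 2 ^ j) ` I" unfolding eq' by blast
      then show "b * \<pi>' ^ j * x \<in> (*) (a * 2 ^ j) ` I" by (simp add: mult.assoc)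
    qed (use ab a2 integers_mult integers_power pi_integers in auto)
    ultimately have "\<exists>x y e. odd x \<and> odd y \<and> e\<^sup>2 = 1 \<and> x\<^sup>2 - d * y\<^sup>2 = e * 2 ^ (j + 2)"
      using False ab
      by (intro norm_of_power_generator[of j "b / a" "a * 2 ^ j / b" "a * \<pi> ^ j / b" "b * \<pi>' ^ j / (a * 2 ^ j)"])
        auto
    then show ?thesis using assms by blast
  qed simp
qed

end

section \<open>From m, n and k to the quadratic field\<close>

theorem theorem2p1:
  fixes m k :: int and n :: nat and d\<^sub>1 :: int
  assumes "m > 0" and "odd m" and "[m = 0] (mod 3)"
    and "n > 0"
    and "[k = 1] (mod 18) \<or> [k = - 1] (mod 18)"
    and "gcd m k = 1"
    and "d\<^sub>1 = squarefree_part (3 * (4 * m ^ (3 * n) - k\<^sup>2))"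
  shows "3 dvd class_number d\<^sub>1"
proof -
  define M where "M = m ^ n"
  have M: "m ^ (3 * n) = M ^ 3" by (simp add: M_def mult.commute flip: power_mult)
  have "3 dvd m" using assms(3) by (simp add: cong_0_iff)
  then have M3: "3 dvd M" using assms(4) by (simp add: M_def dvd_power_same dvd_trans[OF _ dvd_power])
  have Modd: "odd M" using assms(2) by (simp add: M_def)
  have "coprime m k" using assms(6) by (simp only: coprime_iff_gcd_eq_1)
  then have cop: "coprime M k" by (simp add: M_def)
  have kodd: "odd k" using assms(5) unfolding cong_iff_dvd_diff by presburger
  have k9: "[k\<^sup>2 = 1] (mod 9)"
  proof -
    have "k\<^sup>2 - 1 = (k - 1) * (k + 1)" by (simp add: power2_eq_square algebra_simps)
    moreover have "9 dvd k - 1 \<or> 9 dvd k + 1"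
      using assms(5) unfolding cong_iff_dvd_diff by presburger
    ultimately show ?thesis unfolding cong_iff_dvd_diff by auto
  qed
  define N where "N = 3 * (4 * m ^ (3 * n) - k\<^sup>2)"
  define t where "t = square_part N"
  have N: "N = d\<^sub>1 * t\<^sup>2" unfolding t_def assms(7) N_def[symmetric] by (rule squarefree_decompose)
  have k3: "\<not> 3 dvd k\<^sup>2" using k9 unfolding cong_def by presburger
  have odd_sq: "x\<^sup>2 mod 8 = 1" if x: "odd x" for x :: int
  proof -
    obtain c where c: "x = 2 * c + 1" using x by (rule oddE)
    have "even (c * (c + 1))" by simp
    then obtain b where b: "c * (c + 1) = 2 * b" by blast
    have "x\<^sup>2 = 4 * (c * (c + 1)) + 1" unfolding c by (simp add: power2_eq_square algebra_simps)
    then show ?thesis unfolding b by simp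
  qed
  \<comment> \<open>As M^3 and k are odd, 4 M^3 - k^2 is 3 modulo 8, and three times 3 is 1 modulo
    8.\<close>
  have N8: "N mod 8 = 1"
  proof -
    have "odd (M ^ 3)" using Modd by simp
    then obtain c where c: "M ^ 3 = 2 * c + 1" by (rule oddE)
    define b where "b = k\<^sup>2 div 8"
    have "k\<^sup>2 = 8 * b + 1" unfolding b_def using odd_sq[OF kodd] by presburger
    then show ?thesis unfolding N_def M c by presburger
  qed
  have "odd N" using N8 by presburger
  then have "odd t" unfolding N by simp
  then have d8: "d\<^sub>1 mod 8 = 1"
    using N8 odd_sq[of t] unfolding N by (metis mod_mult_right_eq mult.right_neutral)
  have "3 dvd d\<^sub>1"
  \<comment> \<open>Since 3 divides M but not k, 3 divides N exactly once, so the factor cannot sit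
    in the square of t.\<close>
  proof (rule ccontr)
    assume d: "\<not> 3 dvd d\<^sub>1"
    have "3 dvd d\<^sub>1 * t\<^sup>2" unfolding N[symmetric] N_def by simp
    then have "3 dvd t" using d by (simp add: prime_dvd_mult_iff prime_dvd_power_iff)
    then obtain t' where "t = 3 * t'" by blast
    then have "3 * (4 * M ^ 3 - k\<^sup>2) = 3 * (3 * (d\<^sub>1 * t'\<^sup>2))"
      using N unfolding N_def M by (simp add: power2_eq_square)
    then have "3 dvd 4 * M ^ 3 - k\<^sup>2" by presburger
    moreover have "3 dvd M ^ 3" using M3 by (simp add: power3_eq_cube)
    ultimately show False using k3 by presburger
  qed
  then obtain D' where D': "d\<^sub>1 = 3 * D'" by blast
  interpret quadratic d\<^sub>1
    by standard (use d8 \<open>3 dvd d\<^sub>1\<close> assms(7) in auto)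
  have D: "- D' * t\<^sup>2 = k\<^sup>2 - 4 * M ^ 3"
    using N unfolding N_def M D' by simp
  show ?thesis
  proof (rule dvd_class_number)
    fix x y e :: int and j :: nat
    assume *: "odd x" "odd y" "e\<^sup>2 = 1" "x\<^sup>2 - d\<^sub>1 * y\<^sup>2 = e * 2 ^ (j + 2)"
    show "3 dvd j"
      by (rule power_of_two_norm[OF D Modd M3 kodd k9 cop *(1-3)]) (use *(4) in \<open>simp add: D'\<close>)
  qed
qed

end
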